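(* Let $(N,h,J,\omega,\Omega)$ be a Calabi-Yau $6$-manifold. For every $\alpha\in\Lambda^1(N)$: \begin{enumerate} \item $d\alpha=-\frac13\,d^6_1(J^*\alpha)\cdot\omega-\frac12\star\left(J^*d^6_6\alpha\wedge\Omega^+\right)+d^6_8\alpha$; \item $d\star(\alpha\wedge\Omega^-)=-\frac12\,d^6_1\alpha\cdot\Omega^++\frac12\,d^6_1(J^*\alpha)\cdot\Omega^-+\frac12\,J^*d^6_6\alpha\wedge\omega+\star d^6_{12}\alpha$. \end{enumerate} Moreover, $d^6_1(J^*\alpha)=-\star d\star J^*\alpha=-\frac12\star d(\alpha\wedge\omega^2)$.
   Context: A Calabi-Yau 6-manifold $(N,h,J,\omega,\Omega)$ is a real 6-dimensional manifold with complex structure $J$, Kähler metric $h$, Kähler form $\omega=h(J\cdot,\cdot)$, and a holomorphic complex volume form $\Omega=\Omega^++i\Omega^-$ with $2\omega^3=3\,\Omega^+\wedge\Omega^-$ (so that $\omega,\Omega^\pm$ are parallel and at each point form an SU(3)-structure, with $\omega\wedge\Omega^\pm=0$ and $\Omega^-=J^*\Omega^+=\star\Omega^+$). The volume form is $\mathrm{vol}_h=\omega^3/6$; $\Lambda^k(N)$ is the space of smooth real $k$-forms, $\star$ the Hodge star, $d^*$ the formal adjoint of $d$, and $J^*\alpha=\alpha(J\cdot,\dots,J\cdot)$. Set $\Lambda^2_8(N)=\{\sigma\in\Lambda^2(N): J^*\sigma=\sigma,\ \sigma\wedge\omega^2=0\}$, $\Lambda^3_{12}(N)=\{\rho\in\Lambda^3(N):\rho\wedge\omega=0,\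 \rho\wedge\Omega^\pm=0\}$, with pointwise orthogonal projections $\pi^2_8:\Lambda^2(N)\to\Lambda^2_8(N)$, $\pi^3_{12}:\Lambda^3(N)\to\Lambda^3_{12}(N)$. For $\alpha\in\Lambda^1(N)$ define $d^6_1\alpha:=d^*\alpha$, $d^6_6\alpha:=\star d(\alpha\wedge\Omega^-)\in\Lambda^1(N)$, $d^6_8\alpha:=\pi^2_8(d\alpha)$, $d^6_{12}\alpha:=\pi^3_{12}(d^*(\alpha\wedge\Omega^-))$. In item 2, $d\star$ means the composition of $\star$ followed by $d$. *)

theory Defs
  imports "HOL-Analysis.Analysis"
begin

text \<open>Only meant for open \<open>S\<close>, where the Frechet derivative at a point is unique.\<close>

primrec Ck_on :: "nat \<Rightarrow> 'a::real_normed_vector set \<Rightarrow> ('a \<Rightarrow> 'b::real_normed_vector) \<Rightarrow> bool" where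
  "Ck_on 0 S f \<longleftrightarrow> continuous_on S f"
| "Ck_on (Suc n) S f \<longleftrightarrow>
     f differentiable_on S \<and> (\<forall>v. Ck_on n S (\<lambda>x. frechet_derivative f (at x) v))"

definition smooth_on :: "'a::real_normed_vector set \<Rightarrow> ('a \<Rightarrow> 'b::real_normed_vector) \<Rightarrow> bool" where
  "smooth_on S f \<longleftrightarrow> (\<forall>n. Ck_on n S f)"

text \<open>A \<open>k\<close>-form on the vector space \<open>real ^ 6\<close> is an alternating multilinear function of
  \<open>v 0, \<dots>, v (k - 1)\<close> which ignores the other entries of \<open>v\<close>. In particular a 0-form is a
  constant function. The codomain \<open>'a\<close> is \<open>real\<close> or \<open>complex\<close>.\<close>

type_synonym 'a mform = "(nat \<Rightarrow> real ^ 6) \<Rightarrow> 'a"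

definition alternating :: "nat \<Rightarrow> real mform \<Rightarrow> bool" where
  "alternating k a \<longleftrightarrow>
     (\<forall>v w. (\<forall>i<k. v i = w i) \<longrightarrow> a v = a w) \<and>
     (\<forall>i<k. \<forall>v. linear (\<lambda>u. a (v(i := u)))) \<and>
     (\<forall>v i j. i < j \<and> j < k \<and> v i = v j \<longrightarrow> a v = 0)"

text \<open>Wedge product of a \<open>p\<close>-form and a \<open>q\<close>-form, normalised so that
  \<open>dx \<and> dy\<close> takes the value 1 on the pair of coordinate vectors.\<close>

definition wedge :: "nat \<Rightarrow> nat \<Rightarrow> 'a::field_char_0 mform \<Rightarrow> 'a mform \<Rightarrow> 'a mform" where
  "wedge p q a b = (\<lambda>v. (\<Sum>\<sigma> | \<sigma> permutes {..<p + q}.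
       of_int (sign \<sigma>) * a (\<lambda>i. v (\<sigma> i)) * b (\<lambda>i. v (\<sigma> (p + i)))) / (fact p * fact q))"

definition pull :: "(real ^ 6 \<Rightarrow> real ^ 6) \<Rightarrow> 'a mform \<Rightarrow> 'a mform" where
  "pull L a = (\<lambda>v. a (\<lambda>i. L (v i)))"

definition cometric :: "(real ^ 6 \<Rightarrow> real ^ 6 \<Rightarrow> real) \<Rightarrow> real ^ 6 ^ 6" where
  "cometric g = matrix_inv (\<chi> i j. g (axis i 1) (axis j 1))"

text \<open>The inner product induced by \<open>g\<close> on \<open>k\<close>-forms,
  \<open>1/k! g\<^sup>I\<^sup>J a\<^sub>I b\<^sub>J\<close> summed over all multi-indices; for an orthonormal coframe \<open>e\<close> the forms
  \<open>e\<^sub>i \<and> \<dots> \<and> e\<^sub>j\<close> with increasing indices are orthonormal.\<close>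

definition form_inner ::
    "(real ^ 6 \<Rightarrow> real ^ 6 \<Rightarrow> real) \<Rightarrow> nat \<Rightarrow> real mform \<Rightarrow> real mform \<Rightarrow> real" where
  "form_inner g k a b =
     (\<Sum>I \<in> {..<k} \<rightarrow>\<^sub>E UNIV. \<Sum>J \<in> {..<k} \<rightarrow>\<^sub>E UNIV.
        (\<Prod>s<k. cometric g $ I s $ J s) * a (\<lambda>s. axis (I s) 1) * b (\<lambda>s. axis (J s) 1)) / fact k"

definition hodge_pt ::
    "(real ^ 6 \<Rightarrow> real ^ 6 \<Rightarrow> real) \<Rightarrow> real mform \<Rightarrow> nat \<Rightarrow> real mform \<Rightarrow> real mform" where
  "hodge_pt g vol k b = (THE s. alternating (6 - k) s \<and>
     (\<forall>a. alternating k a \<longrightarrow> wedge k (6 - k) a s = (\<lambda>v. form_inner g k a b * vol v)))"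

definition orth_proj ::
    "(real ^ 6 \<Rightarrow> real ^ 6 \<Rightarrow> real) \<Rightarrow> nat \<Rightarrow> real mform set \<Rightarrow> real mform \<Rightarrow> real mform" where
  "orth_proj g k W s = (THE t. t \<in> W \<and> (\<forall>w\<in>W. form_inner g k (\<lambda>v. s v - t v) w = 0))"

definition ext_d :: "nat \<Rightarrow> (real ^ 6 \<Rightarrow> real mform) \<Rightarrow> real ^ 6 \<Rightarrow> real mform" where
  "ext_d k a x = (\<lambda>v. \<Sum>i\<le>k. (-1) ^ i *
     frechet_derivative (\<lambda>y. a y (\<lambda>j. if j < i then v j else v (Suc j))) (at x) (v i))"

definition test_form :: "nat \<Rightarrow> (real ^ 6) set \<Rightarrow> (real ^ 6 \<Rightarrow> real mform) \<Rightarrow> bool" where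
  "test_form k V b \<longleftrightarrow>
     (\<forall>x. alternating k (b x)) \<and> (\<forall>v. smooth_on V (\<lambda>x. b x v)) \<and>
     (\<exists>K. compact K \<and> K \<subseteq> V \<and> (\<forall>x. x \<notin> K \<longrightarrow> b x = (\<lambda>v. 0)))"

text \<open>A chart is a coordinate domain together with a coordinate map (whose values outside
  the domain are irrelevant). The manifold is the whole type \<open>'m\<close>.\<close>

type_synonym 'm chart = "'m set \<times> ('m \<Rightarrow> real ^ 6)"

definition cimg :: "'m chart \<Rightarrow> (real ^ 6) set" where
  "cimg c = snd c ` fst c"

definition overlap :: "'m chart \<Rightarrow> 'm chart \<Rightarrow> (real ^ 6) set" where
  "overlap c d = snd c ` (fst c \<inter> fst d)"

definition transition :: "'m chart \<Rightarrow> 'm chart \<Rightarrow> real ^ 6 \<Rightarrow> real ^ 6" where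
  "transition c d = snd d \<circ> inv_into (fst c) (snd c)"

definition dtransition :: "'m chart \<Rightarrow> 'm chart \<Rightarrow> real ^ 6 \<Rightarrow> real ^ 6 \<Rightarrow> real ^ 6" where
  "dtransition c d x = frechet_derivative (transition c d) (at x)"

definition smooth_atlas :: "'m::{t2_space, second_countable_topology} chart set \<Rightarrow> bool" where
  "smooth_atlas A \<longleftrightarrow>
     (\<Union>c\<in>A. fst c) = UNIV \<and>
     (\<forall>c\<in>A. open (fst c) \<and> open (cimg c) \<and>
        homeomorphism (fst c) (cimg c) (snd c) (inv_into (fst c) (snd c))) \<and>
     (\<forall>c\<in>A. \<forall>d\<in>A. smooth_on (overlap c d) (transition c d))"

text \<open>Tensor fields are given by their coordinate representatives in all charts of the atlas,
  which have to agree on overlaps. For a form, \<open>\<alpha> c x\<close> is the value at the point of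
  the manifold with coordinates \<open>x\<close> in the chart \<open>c\<close>; it is set to 0 where this is meaningless, so
  that a form is a unique HOL function.\<close>

type_synonym ('m, 'a) field_form = "'m chart \<Rightarrow> real ^ 6 \<Rightarrow> 'a mform"

definition Forms :: "'m chart set \<Rightarrow> nat \<Rightarrow> ('m, real) field_form set" where
  "Forms A k = {\<alpha>.
     (\<forall>c\<in>A. \<forall>x\<in>cimg c. alternating k (\<alpha> c x)) \<and>
     (\<forall>c\<in>A. \<forall>v. smooth_on (cimg c) (\<lambda>x. \<alpha> c x v)) \<and>
     (\<forall>c\<in>A. \<forall>d\<in>A. \<forall>x\<in>overlap c d.
        \<alpha> c x = pull (dtransition c d x) (\<alpha> d (transition c d x))) \<and>
     (\<forall>c x. c \<notin> A \<or> x \<notin> cimg c \<longrightarrow> \<alpha> c x = (\<lambda>v. 0))}"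

definition riemannian_metric ::
    "'m chart set \<Rightarrow> ('m chart \<Rightarrow> real ^ 6 \<Rightarrow> real ^ 6 \<Rightarrow> real ^ 6 \<Rightarrow> real) \<Rightarrow> bool" where
  "riemannian_metric A h \<longleftrightarrow>
     (\<forall>c\<in>A. \<forall>x\<in>cimg c. bilinear (h c x) \<and> (\<forall>u v. h c x u v = h c x v u) \<and>
        (\<forall>u. u \<noteq> 0 \<longrightarrow> h c x u u > 0)) \<and>
     (\<forall>c\<in>A. \<forall>u v. smooth_on (cimg c) (\<lambda>x. h c x u v)) \<and>
     (\<forall>c\<in>A. \<forall>d\<in>A. \<forall>x\<in>overlap c d. \<forall>u v.
        h c x u v = h d (transition c d x) (dtransition c d x u) (dtransition c d x v))"

definition endomorphism_field ::
    "'m chart set \<Rightarrow> ('m chart \<Rightarrow> real ^ 6 \<Rightarrow> real ^ 6 \<Rightarrow> real ^ 6) \<Rightarrow> bool" where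
  "endomorphism_field A J \<longleftrightarrow>
     (\<forall>c\<in>A. \<forall>x\<in>cimg c. linear (J c x)) \<and>
     (\<forall>c\<in>A. \<forall>v. smooth_on (cimg c) (\<lambda>x. J c x v)) \<and>
     (\<forall>c\<in>A. \<forall>d\<in>A. \<forall>x\<in>overlap c d. \<forall>v.
        dtransition c d x (J c x v) = J d (transition c d x) (dtransition c d x v))"

record 'm cy_data =
  Atlas :: "'m chart set"
  Met :: "'m chart \<Rightarrow> real ^ 6 \<Rightarrow> real ^ 6 \<Rightarrow> real ^ 6 \<Rightarrow> real"
  Jcx :: "'m chart \<Rightarrow> real ^ 6 \<Rightarrow> real ^ 6 \<Rightarrow> real ^ 6"
  Omega :: "('m, complex) field_form"

definition Om_re :: "'m cy_data \<Rightarrow> ('m, real) field_form" where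
  "Om_re N c x v = Re (Omega N c x v)"

definition Om_im :: "'m cy_data \<Rightarrow> ('m, real) field_form" where
  "Om_im N c x v = Im (Omega N c x v)"

definition kform :: "'m cy_data \<Rightarrow> ('m, real) field_form" where
  "kform N c x v = Met N c x (Jcx N c x (v 0)) (v 1)"

definition wedgeF ::
    "nat \<Rightarrow> nat \<Rightarrow> ('m, real) field_form \<Rightarrow> ('m, real) field_form \<Rightarrow> ('m, real) field_form" where
  "wedgeF p q \<alpha> \<beta> c x = wedge p q (\<alpha> c x) (\<beta> c x)"

definition dF :: "nat \<Rightarrow> ('m, real) field_form \<Rightarrow> ('m, real) field_form" where
  "dF k \<alpha> c = ext_d k (\<alpha> c)"

definition kform2 :: "'m cy_data \<Rightarrow> ('m, real) field_form" where
  "kform2 N = wedgeF 2 2 (kform N) (kform N)"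

definition kform3 :: "'m cy_data \<Rightarrow> ('m, real) field_form" where
  "kform3 N = wedgeF 4 2 (kform2 N) (kform N)"

definition volF :: "'m cy_data \<Rightarrow> ('m, real) field_form" where
  "volF N c x v = kform3 N c x v / 6"

text \<open>Standard identification of \<open>\<real>\<^sup>6\<close> with \<open>\<complex>\<^sup>3\<close> by
  \<open>z\<^sub>1 = x\<^sub>1 + i x\<^sub>2\<close>, \<open>z\<^sub>2 = x\<^sub>3 + i x\<^sub>4\<close>, \<open>z\<^sub>3 = x\<^sub>5 + i x\<^sub>6\<close>.\<close>

definition J_std :: "real ^ 6 \<Rightarrow> real ^ 6" where
  "J_std v = vector [- v $ 2, v $ 1, - v $ 4, v $ 3, - v $ 6, v $ 5]"

definition dz1 :: "complex mform" where "dz1 v = Complex (v 0 $ 1) (v 0 $ 2)"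
definition dz2 :: "complex mform" where "dz2 v = Complex (v 0 $ 3) (v 0 $ 4)"
definition dz3 :: "complex mform" where "dz3 v = Complex (v 0 $ 5) (v 0 $ 6)"

definition dz123 :: "complex mform" where
  "dz123 = wedge 1 2 dz1 (wedge 1 1 dz2 dz3)"

definition holomorphic_on_J :: "(real ^ 6) set \<Rightarrow> (real ^ 6 \<Rightarrow> complex) \<Rightarrow> bool" where
  "holomorphic_on_J S f \<longleftrightarrow> (\<forall>x\<in>S. f differentiable (at x) \<and>
     (\<forall>u. frechet_derivative f (at x) (J_std u) = \<i> * frechet_derivative f (at x) u))"

definition holomorphic_chart :: "'m cy_data \<Rightarrow> 'm chart \<Rightarrow> bool" where
  "holomorphic_chart N c \<longleftrightarrow> c \<in> Atlas N \<and> (\<forall>x\<in>cimg c. Jcx N c x = J_std)"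

text \<open>\<open>J\<close> is a complex structure, not just an almost complex one: the atlas contains
  holomorphic charts around every point. The atlas may contain further smooth charts, for
  instance it may be the maximal one.\<close>

definition complex_structure :: "'m::{t2_space, second_countable_topology} cy_data \<Rightarrow> bool" where
  "complex_structure N \<longleftrightarrow>
     endomorphism_field (Atlas N) (Jcx N) \<and>
     (\<forall>c\<in>Atlas N. \<forall>x\<in>cimg c. \<forall>v. Jcx N c x (Jcx N c x v) = - v) \<and>
     (\<forall>p. \<exists>c. holomorphic_chart N c \<and> p \<in> fst c)"

definition kaehler :: "'m::{t2_space, second_countable_topology} cy_data \<Rightarrow> bool" where
  "kaehler N \<longleftrightarrow>
     riemannian_metric (Atlas N) (Met N) \<and>
     (\<forall>c\<in>Atlas N. \<forall>x\<in>cimg c. \<forall>u v.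
        Met N c x (Jcx N c x u) (Jcx N c x v) = Met N c x u v) \<and>
     (\<forall>c\<in>Atlas N. \<forall>x\<in>cimg c. dF 2 (kform N) c x = (\<lambda>v. 0))"

definition holomorphic_volume_form ::
    "'m::{t2_space, second_countable_topology} cy_data \<Rightarrow> bool" where
  "holomorphic_volume_form N \<longleftrightarrow>
     Om_re N \<in> Forms (Atlas N) 3 \<and> Om_im N \<in> Forms (Atlas N) 3 \<and>
     (\<forall>c. holomorphic_chart N c \<longrightarrow>
        (\<exists>f. holomorphic_on_J (cimg c) f \<and> (\<forall>x\<in>cimg c. f x \<noteq> 0) \<and>
             (\<forall>x\<in>cimg c. \<forall>v. Omega N c x v = f x * dz123 v)))"

definition calabi_yau6 :: "'m::{t2_space, second_countable_topology} cy_data \<Rightarrow> bool" where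
  "calabi_yau6 N \<longleftrightarrow>
     smooth_atlas (Atlas N) \<and> complex_structure N \<and> kaehler N \<and> holomorphic_volume_form N \<and>
     (\<forall>c\<in>Atlas N. \<forall>x\<in>cimg c. \<forall>v.
        2 * kform3 N c x v = 3 * wedgeF 3 3 (Om_re N) (Om_im N) c x v)"

definition Jstar :: "'m cy_data \<Rightarrow> ('m, real) field_form \<Rightarrow> ('m, real) field_form" where
  "Jstar N \<alpha> c x = pull (Jcx N c x) (\<alpha> c x)"

definition hodge :: "'m cy_data \<Rightarrow> nat \<Rightarrow> ('m, real) field_form \<Rightarrow> ('m, real) field_form" where
  "hodge N k \<alpha> c x = hodge_pt (Met N c x) (volF N c x) k (\<alpha> c x)"

text \<open>Density of the Riemannian measure with respect to Lebesgue measure in a chart: the absolute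
  value takes care of charts which are not positively oriented. \<open>of_nat\<close> maps
  \<open>1, \<dots>, 6\<close> to the six elements of the index type.\<close>

definition vol_density :: "'m cy_data \<Rightarrow> 'm chart \<Rightarrow> real ^ 6 \<Rightarrow> real" where
  "vol_density N c x = \<bar>volF N c x (\<lambda>i. axis (of_nat (Suc i)) 1)\<bar>"

text \<open>The formal adjoint \<open>d\<^sup>*\<close> of \<open>d\<close>, mapping \<open>(k + 1)\<close>-forms to \<open>k\<close>-forms:
  \<open>\<integral> \<langle>d\<beta>, \<gamma>\<rangle> vol = \<integral> \<langle>\<beta>, \<delta>\<rangle> vol\<close> for the compactly supported smooth \<open>k\<close>-forms \<open>\<beta>\<close>. By a
  partition of unity every such \<open>\<beta>\<close> is a finite sum of forms with compact support in a coordinate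
  domain, hence it is tested with the latter, for which the integrals are taken in
  coordinates.\<close>

definition codiff ::
    "'m cy_data \<Rightarrow> nat \<Rightarrow> ('m, real) field_form \<Rightarrow> ('m, real) field_form" where
  "codiff N k \<gamma> = (THE \<delta>. \<delta> \<in> Forms (Atlas N) k \<and>
     (\<forall>c\<in>Atlas N. \<forall>\<beta>. test_form k (cimg c) \<beta> \<longrightarrow>
        (LINT x:cimg c|lborel.
           form_inner (Met N c x) (Suc k) (ext_d k \<beta> x) (\<gamma> c x) * vol_density N c x) =
        (LINT x:cimg c|lborel.
           form_inner (Met N c x) k (\<beta> x) (\<delta> c x) * vol_density N c x)))"

definition L28 :: "'m cy_data \<Rightarrow> 'm chart \<Rightarrow> real ^ 6 \<Rightarrow> real mform set" where
  "L28 N c x = {s. alternating 2 s \<and> pull (Jcx N c x) s = s \<and>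
     wedge 2 4 s (kform2 N c x) = (\<lambda>v. 0)}"

definition L312 :: "'m cy_data \<Rightarrow> 'm chart \<Rightarrow> real ^ 6 \<Rightarrow> real mform set" where
  "L312 N c x = {r. alternating 3 r \<and> wedge 3 2 r (kform N c x) = (\<lambda>v. 0) \<and>
     wedge 3 3 r (Om_re N c x) = (\<lambda>v. 0) \<and> wedge 3 3 r (Om_im N c x) = (\<lambda>v. 0)}"

definition pi28 :: "'m cy_data \<Rightarrow> ('m, real) field_form \<Rightarrow> ('m, real) field_form" where
  "pi28 N \<alpha> c x = orth_proj (Met N c x) 2 (L28 N c x) (\<alpha> c x)"

definition pi312 :: "'m cy_data \<Rightarrow> ('m, real) field_form \<Rightarrow> ('m, real) field_form" where
  "pi312 N \<alpha> c x = orth_proj (Met N c x) 3 (L312 N c x) (\<alpha> c x)"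

definition d6_1 :: "'m cy_data \<Rightarrow> ('m, real) field_form \<Rightarrow> ('m, real) field_form" where
  "d6_1 N \<alpha> = codiff N 0 \<alpha>"

definition d6_6 :: "'m cy_data \<Rightarrow> ('m, real) field_form \<Rightarrow> ('m, real) field_form" where
  "d6_6 N \<alpha> = hodge N 5 (dF 4 (wedgeF 1 3 \<alpha> (Om_im N)))"

definition d6_8 :: "'m cy_data \<Rightarrow> ('m, real) field_form \<Rightarrow> ('m, real) field_form" where
  "d6_8 N \<alpha> = pi28 N (dF 1 \<alpha>)"

definition d6_12 :: "'m cy_data \<Rightarrow> ('m, real) field_form \<Rightarrow> ('m, real) field_form" where
  "d6_12 N \<alpha> = pi312 N (codiff N 3 (wedgeF 1 3 \<alpha> (Om_im N)))"

end

theory Submission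
  imports Defs
begin

text \<open>
  Everything is linear algebra at a point once \<open>d\<omega> = d\<Omega> = 0\<close> is known. In a unitary frame with
  \<open>\<Omega>(f\<^sub>0, f\<^sub>2, f\<^sub>4) = 1\<close> one finds \<open>\<star>J\<^sup>*\<alpha> = 1/2 \<alpha> \<and> \<omega>\<^sup>2\<close>, and \<open>\<sigma> = \<star>(\<alpha> \<and> \<Omega>\<^sup>-)\<close> satisfies
  \<open>\<sigma> \<and> \<omega> = \<alpha> \<and> \<Omega>\<^sup>-\<close>, \<open>\<sigma> \<and> \<Omega>\<^sup>- = 2 \<star>\<alpha>\<close> and \<open>\<sigma> \<and> \<Omega>\<^sup>+ = 2 \<star>J\<^sup>*\<alpha>\<close>. As \<open>\<omega>\<close> and \<open>\<Omega>\<close> are closed, the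
  products of \<open>d\<alpha>\<close> with \<open>\<omega>\<^sup>2\<close> and \<open>\<Omega>\<^sup>-\<close>, and those of \<open>d\<sigma>\<close> with \<open>\<omega>\<close> and \<open>\<Omega>\<^sup>\<plusminus>\<close>, are therefore exterior
  derivatives of known forms. They are exactly the components of \<open>d\<alpha>\<close> outside \<open>\<Lambda>\<^sup>2\<^sub>8\<close> and of \<open>d\<sigma>\<close> outside
  \<open>\<Lambda>\<^sup>3\<^sub>1\<^sub>2\<close>. The formal adjoint is \<open>-\<star>d\<star>\<close>: the integrand of the difference of both sides of the
  defining identity is \<open>d(\<beta> \<and> \<star>\<gamma>)\<close>, and test forms \<open>\<psi>\<delta>\<close> with a bump function \<open>\<psi>\<close> give uniqueness.

  The sum over permutations in the wedge product enters only through the rule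
  \<open>\<iota>\<^sub>u(a \<and> b) = \<iota>\<^sub>ua \<and> b \<plusminus> a \<and> \<iota>\<^sub>ub\<close>. It yields associativity and commutativity by induction, and makes
  the evaluation of products on a frame a matter of rewriting.
\<close>

section \<open>Alternating forms and interior products\<close>

text \<open>Adapted frames exist at each point but are not chosen smoothly, so they must not occur
  in an expression that is to be differentiated. Hence two descriptions of the inner product and the
  star coexist: by a frame, for computations at a point, and by the cometric and \<open>axis\<close>
  vectors, for smoothness. A second obstacle is that a form is a family of chart representatives,
  while \<open>codiff\<close> is a definite description over global forms. Every operator therefore
  has to be shown compatible with transition maps before \<open>codiff\<close> can be evaluated.
  This requires naturality of the exterior derivative, which also carries d\<Omega> = 0 from
  holomorphic charts to all others. Finally, charts need not be positively oriented. As the volume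
  form has no zeros, its sign is locally constant in a chart, and the orientation enters the
  integrals only as a factor \<open>sgn\<close> that commutes with differentiation.\<close>

definition vcons :: "'a \<Rightarrow> (nat \<Rightarrow> 'a) \<Rightarrow> nat \<Rightarrow> 'a" (infixr "##" 65) where
  "u ## v = case_nat u v"

lemma vcons_0 [simp]: "(u ## v) 0 = u"
  and vcons_Suc [simp]: "(u ## v) (Suc i) = v i"
  by (simp_all add: vcons_def)

lemma vcons_upd_0 [simp]: "(u ## v)(0 := w) = w ## v"
  and vcons_upd_Suc [simp]: "(u ## v)(Suc i := w) = u ## (v(i := w))"
  by (auto simp: vcons_def fun_eq_iff split: nat.splits)

lemma vcons_eta: "v 0 ## (\<lambda>i. v (Suc i)) = v"
  by (auto simp: vcons_def fun_eq_iff split: nat.splits)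

lemma vcons_comp: "(\<lambda>i. f ((u ## v) i)) = f u ## (\<lambda>i. f (v i))"
  by (auto simp: vcons_def fun_eq_iff split: nat.splits)

text \<open>Filler for the entries which a form ignores.\<close>

abbreviation zs :: "nat \<Rightarrow> real ^ 6" where
  "zs \<equiv> \<lambda>_. 0"

text \<open>With arguments written as \<open>u ## v ## w\<close>, the value of a form is an iterated
  interior product; all degrees are treated by recursion on the first slot.\<close>

definition iota :: "real ^ 6 \<Rightarrow> 'a mform \<Rightarrow> 'a mform" where
  "iota u a = (\<lambda>v. a (u ## v))"

lemma alternating_cong:
  "alternating k a \<Longrightarrow> (\<And>i. i < k \<Longrightarrow> v i = w i) \<Longrightarrow> a v = a w"
  unfolding alternating_def by blast

lemma alternating_slot_linear: "alternating k a \<Longrightarrow> i < k \<Longrightarrow> linear (\<lambda>u. a (v(i := u)))"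
  unfolding alternating_def by blast

lemma alternating_eq_0: "alternating k a \<Longrightarrow> i < j \<Longrightarrow> j < k \<Longrightarrow> v i = v j \<Longrightarrow> a v = 0"
  unfolding alternating_def by blast

lemma alternating_0_iff: "alternating 0 a \<longleftrightarrow> (\<forall>v. a v = a zs)"
proof
  assume *: "\<forall>v. a v = a zs"
  have "a v = a w" for v w
    using spec[OF *, of v] spec[OF *, of w] by simp
  then show "alternating 0 a" by (auto simp: alternating_def)
qed (auto simp: alternating_def)

lemma alternating_0_const: "alternating 0 a \<Longrightarrow> a v = a zs"
  using alternating_0_iff by blast

lemma alternating_iota:
  assumes "alternating (Suc k) a"
  shows "alternating k (iota u a)"
  unfolding alternating_def iota_def
proof (intro conjI allI impI)
  fix v w :: "nat \<Rightarrow> real ^ 6" assume *: "\<forall>i<k. v i = w i"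
  show "a (u ## v) = a (u ## w)"
    by (rule alternating_cong[OF assms]) (use * in \<open>auto simp: vcons_def split: nat.splits\<close>)
next
  fix i v assume "i < k"
  then show "linear (\<lambda>ua. a (u ## v(i := ua)))"
    using alternating_slot_linear[OF assms, of "Suc i" "u ## v"] by simp
next
  fix v :: "nat \<Rightarrow> real ^ 6" and i j assume "i < j \<and> j < k \<and> v i = v j"
  then show "a (u ## v) = 0"
    using alternating_eq_0[OF assms, of "Suc i" "Suc j" "u ## v"] by simp
qed

lemma alternating_linear: "alternating (Suc k) a \<Longrightarrow> linear (\<lambda>u. a (u ## v))"
  using alternating_slot_linear[of "Suc k" a 0 "0 ## v"] by simp

lemma alternating_add: "alternating (Suc k) a \<Longrightarrow> a ((u + w) ## v) = a (u ## v) + a (w ## v)"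
  by (rule linear_add[OF alternating_linear])

lemma alternating_scale: "alternating (Suc k) a \<Longrightarrow> a ((c *\<^sub>R u) ## v) = c * a (u ## v)"
  using linear_cmul[OF alternating_linear, of k a c u v] by simp

lemma alternating_minus: "alternating (Suc k) a \<Longrightarrow> a ((- u) ## v) = - a (u ## v)"
  by (rule linear_neg[OF alternating_linear])

lemma alternating_repeat: "alternating (Suc (Suc k)) a \<Longrightarrow> a (u ## u ## v) = 0"
  using alternating_eq_0[of "Suc (Suc k)" a 0 "Suc 0" "u ## u ## v"] by simp

text \<open>Polarisation of a(u + w, u + w) = 0. Only the first two slots are assumed additive,
  because the rule is also applied to functions not yet known to be alternating.\<close>

lemma swap_of_repeat:
  fixes a :: "real mform"
  assumes add: "\<And>u w x v. a ((u + w) ## x ## v) = a (u ## x ## v) + a (w ## x ## v)"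
    "\<And>u w x v. a (x ## (u + w) ## v) = a (x ## u ## v) + a (x ## w ## v)"
    and rep: "\<And>u v. a (u ## u ## v) = 0"
  shows "a (u ## w ## v) = - a (w ## u ## v)"
proof -
  have "0 = a ((u + w) ## (u + w) ## v)" by (simp add: rep)
  also have "\<dots> = a (u ## w ## v) + a (w ## u ## v)" unfolding add by (simp add: rep)
  finally show ?thesis by linarith
qed

lemma alternating_swap:
  assumes "alternating (Suc (Suc k)) a"
  shows "a (u ## w ## v) = - a (w ## u ## v)"
proof (rule swap_of_repeat)
  show "a (x ## (u + w) ## v) = a (x ## u ## v) + a (x ## w ## v)" for u w x v
    using alternating_add[OF alternating_iota[OF assms, of x], of u w v] by (simp add: iota_def)
qed (use assms alternating_add alternating_repeat in blast)+

text \<open>Degree recursion for \<open>alternating\<close>: beyond linearity in the first slot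
  everything concerns interior products, except a repetition that involves slot 0. Wedge products
  and the Kaehler form are shown to be alternating in this way.\<close>

lemma alternatingI_Suc:
  assumes iota: "\<And>u. alternating k (iota u a)"
    and lin: "\<And>v. linear (\<lambda>u. a (u ## v))"
    and rep: "\<And>u v. k > 0 \<Longrightarrow> a (u ## u ## v) = 0"
  shows "alternating (Suc k) a"
proof -
  have io: "iota u a v = a (u ## v)" for u v by (simp add: iota_def)
  have aeta: "a v = iota (v 0) a (\<lambda>i. v (Suc i))" for v by (simp add: io vcons_eta)
  show ?thesis
    unfolding alternating_def
  proof (intro conjI allI impI)
    fix v w :: "nat \<Rightarrow> real ^ 6" assume *: "\<forall>i<Suc k. v i = w i"
    show "a v = a w"
      using alternating_cong[OF iota, of "\<lambda>i. v (Suc i)" "\<lambda>i. w (Suc i)" "v 0"] *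
      by (simp add: aeta[of v] aeta[of w])
  next
    fix i and v :: "nat \<Rightarrow> real ^ 6" assume i: "i < Suc k"
    show "linear (\<lambda>u. a (v(i := u)))"
    proof (cases i)
      case 0
      then show ?thesis
        using lin[of "\<lambda>i. v (Suc i)"] vcons_upd_0[of "v 0" "\<lambda>i. v (Suc i)"] by (simp add: vcons_eta)
    next
      case (Suc j)
      then show ?thesis
        using alternating_slot_linear[OF iota, of j "v 0" "\<lambda>i. v (Suc i)"] i
          vcons_upd_Suc[of "v 0" "\<lambda>i. v (Suc i)" j] by (simp add: vcons_eta io)
    qed
  next
    fix v :: "nat \<Rightarrow> real ^ 6" and i j assume *: "i < j \<and> j < Suc k \<and> v i = v j"
    then obtain j' where j: "j = Suc j'" by (cases j) auto
    show "a v = 0"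
    proof (cases i)
      case (Suc i')
      then show ?thesis
        using * j alternating_eq_0[OF iota, of i' j' "\<lambda>i. v (Suc i)" "v 0"] by (simp add: aeta[of v])
    next
      case 0
      let ?w = "\<lambda>i. v (Suc (Suc i))"
      have v: "a v = a (v 0 ## v (Suc 0) ## ?w)"
        using vcons_eta[of v] vcons_eta[of "\<lambda>i. v (Suc i)"] by simp
      show ?thesis
      proof (cases j')
        case 0
        then have "v (Suc 0) = v 0" "k > 0" using * j \<open>i = 0\<close> by auto
        then show ?thesis using v rep by simp
      next
        case (Suc j'')
        obtain k' where k: "k = Suc k'" using * Suc j by (cases k) auto
        \<comment> \<open>The repetition is in slot 0 and a slot beyond 1. Swapping the first two
          entries moves it inside \<open>iota (v (Suc 0)) a\<close>, which is alternating by
          hypothesis.\<close>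
        have "a (v 0 ## v (Suc 0) ## ?w) = - a (v (Suc 0) ## v 0 ## ?w)"
        proof (rule swap_of_repeat)
          show "a (x ## (u + w) ## v) = a (x ## u ## v) + a (x ## w ## v)" for u w x v
            using alternating_add[OF iota[unfolded k], of x u w v] by (simp add: io)
        qed (use rep k linear_add[OF lin] in auto)
        moreover have "a (v (Suc 0) ## v 0 ## ?w) = 0"
          using alternating_eq_0[OF iota, of 0 j' "v 0 ## ?w" "v (Suc 0)"] Suc j * \<open>i = 0\<close>
          by (simp add: io)
        ultimately show ?thesis using v by simp
      qed
    qed
  qed
qed

section \<open>Permutations and the position of the first argument\<close>

definition insert_at :: "nat \<Rightarrow> 'a \<Rightarrow> (nat \<Rightarrow> 'a) \<Rightarrow> nat \<Rightarrow> 'a" where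
  "insert_at j u w = (\<lambda>i. if i < j then w i else if i = j then u else w (i - 1))"

lemma insert_at_0: "insert_at 0 u w = u ## w"
  and insert_at_Suc: "insert_at (Suc j) u w = w 0 ## insert_at j u (\<lambda>i. w (Suc i))"
  by (auto simp: insert_at_def vcons_def fun_eq_iff split: nat.splits)

text \<open>Bringing \<open>u\<close> from position \<open>j\<close> to the front takes
  \<open>j\<close> transpositions of neighbours.\<close>

lemma alternating_insert_at:
  "alternating (Suc k) a \<Longrightarrow> j \<le> k \<Longrightarrow> a (insert_at j u w) = (-1) ^ j * a (u ## w)"
proof (induction j arbitrary: k a w)
  case 0
  then show ?case by (simp add: insert_at_0)
next
  case (Suc j)
  then obtain k' where k: "k = Suc k'" by (cases k) auto
  have "a (insert_at (Suc j) u w) = iota (w 0) a (insert_at j u (\<lambda>i. w (Suc i)))"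
    by (simp add: insert_at_Suc iota_def)
  also have "\<dots> = (-1) ^ j * iota (w 0) a (u ## (\<lambda>i. w (Suc i)))"
    using Suc k alternating_iota by (intro Suc.IH) auto
  also have "iota (w 0) a (u ## (\<lambda>i. w (Suc i))) = - a (u ## w)"
    using alternating_swap[OF Suc.prems(1)[unfolded k], of "w 0" u] by (simp add: iota_def vcons_eta)
  finally show ?case by simp
qed

text \<open>\<open>cyc j\<close> moves \<open>j\<close> to the front. Every permutation of \<open>0, \<dots>, n\<close> is uniquely such a cycle followed
  by a permutation fixing 0.\<close>

definition cyc :: "nat \<Rightarrow> nat \<Rightarrow> nat" where
  "cyc j = (\<lambda>i. if i < j then Suc i else if i = j then 0 else i)"

lemma cyc_Suc: "cyc (Suc j) = cyc j \<circ> Transposition.transpose j (Suc j)"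
  by (auto simp: cyc_def fun_eq_iff Transposition.transpose_def)

lemma cyc_permutes: "j \<le> n \<Longrightarrow> cyc j permutes {..<Suc n}"
proof (induction j)
  case 0
  have "cyc 0 = id" by (auto simp: cyc_def)
  then show ?case using permutes_id[of "{..<Suc n}"] by (simp only:)
next
  case (Suc j)
  then show ?case
    unfolding cyc_Suc by (intro permutes_compose permutes_swap_id) auto
qed

lemma sign_cyc: "sign (cyc j) = (-1) ^ j"
proof (induction j)
  case 0
  have "cyc 0 = id" by (auto simp: cyc_def)
  then show ?case by simp
next
  case (Suc j)
  have "permutation (cyc j)"
    using cyc_permutes[of j j] permutation_permutes by blast
  then show ?case
    unfolding cyc_Suc by (subst sign_compose) (auto simp: Suc sign_swap_id permutation_swap_id)
qed

definition lift_perm :: "(nat \<Rightarrow> nat) \<Rightarrow> nat \<Rightarrow> nat" where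
  "lift_perm \<tau> = 0 ## (\<lambda>i. Suc (\<tau> i))"

lemma lift_perm_map:
  assumes "\<tau> permutes {..<n}"
  shows "lift_perm \<tau> = map_permutation {..<n} Suc \<tau>"
proof
  fix i
  show "lift_perm \<tau> i = map_permutation {..<n} Suc \<tau> i"
  proof (cases i)
    case 0
    then show ?thesis by (auto simp: lift_perm_def map_permutation_def restrict_id_def)
  next
    case (Suc k)
    show ?thesis
    proof (cases "k < n")
      case True
      then show ?thesis using Suc
        by (auto simp: lift_perm_def map_permutation_def restrict_id_def inv_into_f_f)
    next
      case False
      then show ?thesis using Suc assms
        by (auto simp: lift_perm_def map_permutation_def restrict_id_def permutes_not_in)
    qed
  qed
qed

lemma lift_perm_permutes:
  assumes "\<tau> permutes {..<n}"
  shows "lift_perm \<tau> permutes {..<Suc n}"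
proof -
  have "map_permutation {..<n} Suc \<tau> permutes Suc ` {..<n}"
    using assms by (intro map_permutation_permutes) (auto simp: bij_betw_def)
  then show ?thesis
    unfolding lift_perm_map[OF assms] by (rule permutes_subset) auto
qed

lemma sign_lift_perm: "\<tau> permutes {..<n} \<Longrightarrow> sign (lift_perm \<tau>) = sign \<tau>"
  by (simp add: lift_perm_map sign_map_permutation)

text \<open>Injective because \<open>j\<close> is the only index which the composite sends to 0;
  surjective by counting, as (n + 1) n! = (n + 1)!.\<close>

lemma bij_betw_cyc_lift:
  "bij_betw (\<lambda>(j, \<tau>). lift_perm \<tau> \<circ> cyc j) ({..n} \<times> {\<tau>. \<tau> permutes {..<n}})
     {\<sigma>. \<sigma> permutes {..<Suc n}}"
proof -
  let ?A = "{..n} \<times> {\<tau>. \<tau> permutes {..<n}}" and ?B = "{\<sigma>. \<sigma> permutes {..<Suc n}}"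
  let ?f = "\<lambda>(j, \<tau>). lift_perm \<tau> \<circ> cyc j"
  have sub: "?f ` ?A \<subseteq> ?B"
    using cyc_permutes lift_perm_permutes by (auto intro!: permutes_compose)
  have inj: "inj_on ?f ?A"
  proof (rule inj_onI, clarify)
    fix j j' :: nat and \<tau> \<tau>' assume *: "j \<le> n" "j' \<le> n" "\<tau> permutes {..<n}" "\<tau>' permutes {..<n}"
      and eq: "lift_perm \<tau> \<circ> cyc j = lift_perm \<tau>' \<circ> cyc j'"
    have z: "(lift_perm \<tau> \<circ> cyc j) i = 0 \<longleftrightarrow> i = j" for i j \<tau>
      by (auto simp: lift_perm_def cyc_def vcons_def split: nat.splits)
    have j: "j = j'" using z[of \<tau> j j] z[of \<tau>' j' j] eq by simp
    have "surj (cyc j)" using cyc_permutes[OF *(1)] permutes_surj by blast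
    then have "lift_perm \<tau> = lift_perm \<tau>'"
      using eq j by (metis fun.map_id0 id_apply o_assoc surj_iff comp_id)
    then have "\<tau> i = \<tau>' i" for i
      by (metis lift_perm_def nat.inject vcons_Suc)
    then show "j = j' \<and> \<tau> = \<tau>'" using j by auto
  qed
  have fin: "finite ?B" by (simp add: finite_permutations)
  have "card (?f ` ?A) = card ?A" by (rule card_image[OF inj])
  also have "\<dots> = card ?B" by (simp add: card_permutations card_cartesian_product)
  finally have "?f ` ?A = ?B" using sub fin card_subset_eq by blast
  then show ?thesis using inj by (simp add: bij_betw_def)
qed

lemma sum_permutes_Suc:
  fixes F :: "(nat \<Rightarrow> nat) \<Rightarrow> 'b::comm_monoid_add"
  shows "(\<Sum>\<sigma> | \<sigma> permutes {..<Suc n}. F \<sigma>) =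
    (\<Sum>j\<le>n. \<Sum>\<tau> | \<tau> permutes {..<n}. F (lift_perm \<tau> \<circ> cyc j))"
  using sum.reindex_bij_betw[OF bij_betw_cyc_lift, of F n, symmetric]
  by (simp add: sum.cartesian_product case_prod_unfold)

lemma sign_lift_cyc:
  assumes "\<tau> permutes {..<n}" "j \<le> n"
  shows "sign (lift_perm \<tau> \<circ> cyc j) = (-1) ^ j * sign \<tau>"
proof -
  have "permutation (cyc j)" "permutation (lift_perm \<tau>)"
    using cyc_permutes[OF assms(2)] lift_perm_permutes[OF assms(1)] permutation_permutes by blast+
  then show ?thesis by (simp add: sign_compose sign_cyc sign_lift_perm[OF assms(1)])
qed

text \<open>The parameter \<open>j\<close> of the decomposition is the position at which
  \<open>u\<close> ends up, and \<tau> permutes the remaining vectors.\<close>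

lemma vcons_lift_cyc:
  "(\<lambda>i. (u ## w) ((lift_perm \<tau> \<circ> cyc j) i)) = insert_at j u (\<lambda>i. w (\<tau> i))"
  by (auto simp: fun_eq_iff lift_perm_def cyc_def insert_at_def vcons_def split: nat.splits)

lemma alternating_split_seq:
  assumes "alternating p a"
  shows "a (\<lambda>i. insert_at (p + j) u x i) = a x"
  by (rule alternating_cong[OF assms]) (auto simp: insert_at_def)

text \<open>Permutations are sorted by the position \<open>j\<close> of \<open>u\<close>: for
  \<open>j < p\<close> it is an argument of \<open>a\<close>, otherwise of \<open>b\<close>. All
  positions within one factor contribute equally. They give a factor \<open>p\<close> or
  \<open>q\<close>, which turns \<open>fact p\<close> or \<open>fact q\<close> into the factorial of
  the lower degree.\<close>

lemma wedge_iota: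
  fixes a b :: "real mform"
  assumes a: "alternating p a" and b: "alternating q b" and n: "p + q = Suc n"
  shows "wedge p q a b (u ## w) =
    (if p = 0 then 0 else wedge (p - 1) q (iota u a) b w) +
    (if q = 0 then 0 else (-1) ^ p * wedge p (q - 1) a (iota u b) w)"
proof -
  let ?P = "{\<tau>. \<tau> permutes {..<n}}"
  let ?t = "\<lambda>\<sigma>. of_int (sign \<sigma>) * a (\<lambda>i. (u ## w) (\<sigma> i)) * b (\<lambda>i. (u ## w) (\<sigma> (p + i)))"
  define A where "A = (\<Sum>\<tau>\<in>?P. of_int (sign \<tau>) * a (u ## (\<lambda>i. w (\<tau> i))) * b (\<lambda>i. w (\<tau> (p - 1 + i))))"
  define B where "B = (\<Sum>\<tau>\<in>?P. of_int (sign \<tau>) * a (\<lambda>i. w (\<tau> i)) * b (u ## (\<lambda>i. w (\<tau> (p + i)))))"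
  \<comment> \<open>The sign (-1)^j of the cycle cancels against the sign of moving \<open>u\<close>
    to the front of \<open>a\<close>.\<close>
  have lo: "(\<Sum>\<tau>\<in>?P. ?t (lift_perm \<tau> \<circ> cyc j)) = A" if j: "j < p" for j
    unfolding A_def
  proof (rule sum.cong[OF refl])
    fix \<tau> assume "\<tau> \<in> ?P"
    then have s: "sign (lift_perm \<tau> \<circ> cyc j) = (-1) ^ j * sign \<tau>"
      using j n by (intro sign_lift_cyc) auto
    obtain p' where p': "p = Suc p'" using j by (cases p) auto
    have "a (\<lambda>i. (u ## w) ((lift_perm \<tau> \<circ> cyc j) i)) = (-1) ^ j * a (u ## (\<lambda>i. w (\<tau> i)))"
      unfolding vcons_lift_cyc by (rule alternating_insert_at[OF a[unfolded p']]) (use j p' in auto)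
    moreover have "b (\<lambda>i. (u ## w) ((lift_perm \<tau> \<circ> cyc j) (p + i))) = b (\<lambda>i. w (\<tau> (p - 1 + i)))"
      using vcons_lift_cyc[of u w \<tau> j] j p'
      by (intro arg_cong[of _ _ b]) (auto simp: fun_eq_iff insert_at_def)
    ultimately show "?t (lift_perm \<tau> \<circ> cyc j) =
        of_int (sign \<tau>) * a (u ## (\<lambda>i. w (\<tau> i))) * b (\<lambda>i. w (\<tau> (p - 1 + i)))"
      unfolding s by (simp add: power_mult_distrib[symmetric] flip: mult.assoc)
  qed
  \<comment> \<open>The cycle has sign (-1)^(p + j), of which (-1)^j is used up inside
    \<open>b\<close>; the remaining (-1)^p is the sign of the antiderivation rule.\<close>
  have hi: "(\<Sum>\<tau>\<in>?P. ?t (lift_perm \<tau> \<circ> cyc (p + j))) = (-1) ^ p * B" if j: "j < q" for j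
    unfolding B_def sum_distrib_left
  proof (rule sum.cong[OF refl])
    fix \<tau> assume "\<tau> \<in> ?P"
    then have s: "sign (lift_perm \<tau> \<circ> cyc (p + j)) = (-1) ^ (p + j) * sign \<tau>"
      using j n by (intro sign_lift_cyc) auto
    obtain q' where q': "q = Suc q'" using j by (cases q) auto
    have "a (\<lambda>i. (u ## w) ((lift_perm \<tau> \<circ> cyc (p + j)) i)) = a (\<lambda>i. w (\<tau> i))"
      unfolding vcons_lift_cyc by (rule alternating_split_seq[OF a])
    moreover have "(\<lambda>i. (u ## w) ((lift_perm \<tau> \<circ> cyc (p + j)) (p + i))) =
        insert_at j u (\<lambda>i. w (\<tau> (p + i)))"
      using vcons_lift_cyc[of u w \<tau> "p + j"]
      by (auto simp: fun_eq_iff insert_at_def)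
    then have "b (\<lambda>i. (u ## w) ((lift_perm \<tau> \<circ> cyc (p + j)) (p + i))) =
        (-1) ^ j * b (u ## (\<lambda>i. w (\<tau> (p + i))))"
      using alternating_insert_at[OF b[unfolded q'], of j u "\<lambda>i. w (\<tau> (p + i))"] j q' by auto
    ultimately show "?t (lift_perm \<tau> \<circ> cyc (p + j)) = (-1) ^ p *
        (of_int (sign \<tau>) * a (\<lambda>i. w (\<tau> i)) * b (u ## (\<lambda>i. w (\<tau> (p + i)))))"
      unfolding s by (simp add: power_add flip: mult.assoc)
  qed
  have "(\<Sum>\<sigma> | \<sigma> permutes {..<p + q}. ?t \<sigma>) = (\<Sum>j\<le>n. \<Sum>\<tau>\<in>?P. ?t (lift_perm \<tau> \<circ> cyc j))"
    unfolding n by (rule sum_permutes_Suc)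
  also have "{..n} = {..<p} \<union> (\<lambda>j. p + j) ` {..<q}"
  proof -
    have "j \<in> (\<lambda>j. p + j) ` {..<q}" if "j \<le> n" "\<not> j < p" for j
      by (rule image_eqI[of _ _ "j - p"]) (use that n in auto)
    then show ?thesis using n by auto
  qed
  also have "(\<Sum>j\<in>{..<p} \<union> (\<lambda>j. p + j) ` {..<q}. \<Sum>\<tau>\<in>?P. ?t (lift_perm \<tau> \<circ> cyc j)) =
      (\<Sum>j<p. \<Sum>\<tau>\<in>?P. ?t (lift_perm \<tau> \<circ> cyc j)) +
      (\<Sum>j<q. \<Sum>\<tau>\<in>?P. ?t (lift_perm \<tau> \<circ> cyc (p + j)))"
    by (subst sum.union_disjoint) (auto simp: sum.reindex)
  also have "\<dots> = real p * A + real q * ((-1) ^ p * B)"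
    using lo hi by simp
  finally have main: "wedge p q a b (u ## w) =
      (real p * A + real q * ((-1) ^ p * B)) / (fact p * fact q)"
    by (simp add: wedge_def)
  have A: "real p * A / (fact p * fact q) =
      (if p = 0 then 0 else wedge (p - 1) q (iota u a) b w)"
  proof (cases p)
    case (Suc p')
    then have "p' + q = n" using n by simp
    then show ?thesis using Suc
      by (simp add: A_def wedge_def iota_def)
  qed simp
  have B: "real q * B / (fact p * fact q) =
      (if q = 0 then 0 else wedge p (q - 1) a (iota u b) w)"
  proof (cases q)
    case (Suc q')
    then have "p + q' = n" using n by simp
    then show ?thesis using Suc
      by (simp add: B_def wedge_def iota_def)
  qed simp
  have "wedge p q a b (u ## w) = real p * A / (fact p * fact q) +
      (-1) ^ p * (real q * B / (fact p * fact q))"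
    unfolding main by (simp add: add_divide_distrib)
  then show ?thesis unfolding A B by auto
qed

section \<open>Linearity, low degrees and algebra of the wedge product\<close>

lemma alternating_plus:
  assumes "alternating k a" "alternating k b"
  shows "alternating k (\<lambda>v. a v + b v)"
  unfolding alternating_def
proof (intro conjI allI impI)
  fix v w :: "nat \<Rightarrow> real ^ 6" assume "\<forall>i<k. v i = w i"
  then show "a v + b v = a w + b w"
    using alternating_cong[OF assms(1), of v w] alternating_cong[OF assms(2), of v w] by simp
next
  fix i v assume "i < k"
  then show "linear (\<lambda>u. a (v(i := u)) + b (v(i := u)))"
    using linear_compose_add alternating_slot_linear assms by blast
next
  fix v :: "nat \<Rightarrow> real ^ 6" and i j assume "i < j \<and> j < k \<and> v i = v j"
  then show "a v + b v = 0"
    using alternating_eq_0[OF assms(1), of i j v] alternating_eq_0[OF assms(2), of i j v] by simp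
qed

lemma alternating_cmult:
  assumes "alternating k a"
  shows "alternating k (\<lambda>v. c * a v)"
  unfolding alternating_def
proof (intro conjI allI impI)
  fix v w :: "nat \<Rightarrow> real ^ 6" assume "\<forall>i<k. v i = w i"
  then show "c * a v = c * a w"
    using alternating_cong[OF assms, of v w] by simp
next
  fix i v assume "i < k"
  then show "linear (\<lambda>u. c * a (v(i := u)))"
    using linear_compose_scale_right[OF alternating_slot_linear[OF assms], of i c v] by simp
next
  fix v :: "nat \<Rightarrow> real ^ 6" and i j assume "i < j \<and> j < k \<and> v i = v j"
  then show "c * a v = 0"
    using alternating_eq_0[OF assms, of i j v] by simp
qed

lemma alternating_zero [simp]: "alternating k (\<lambda>v. 0)"
  unfolding alternating_def by (auto intro: linear_zero)

lemma alternating_uminus: "alternating k a \<Longrightarrow> alternating k (\<lambda>v. - a v)"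
  using alternating_cmult[of k a "-1"] by simp

lemma alternating_diff:
  "alternating k a \<Longrightarrow> alternating k b \<Longrightarrow> alternating k (\<lambda>v. a v - b v)"
  using alternating_plus[of k a "\<lambda>v. - b v"] alternating_uminus[of k b] by simp

lemma alternating_divide: "alternating k a \<Longrightarrow> alternating k (\<lambda>v. a v / c)"
  using alternating_cmult[of k a "1 / c"] by simp

lemma alternating_sum:
  "(\<And>i. i \<in> S \<Longrightarrow> alternating k (f i)) \<Longrightarrow> alternating k (\<lambda>v. \<Sum>i\<in>S. f i v)"
  by (induction S rule: infinite_finite_induct) (auto intro: alternating_plus)

lemma alternating_sum_list:
  "(\<And>x. x \<in> set xs \<Longrightarrow> alternating k (f x)) \<Longrightarrow> alternating k (\<lambda>v. \<Sum>x\<leftarrow>xs. f x v)"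
  by (induction xs) (auto intro: alternating_plus)

lemma alternating_const [simp]: "alternating 0 (\<lambda>v. c)"
  by (simp add: alternating_0_iff)

lemma iota_add: "alternating (Suc k) a \<Longrightarrow> iota (u + w) a = (\<lambda>v. iota u a v + iota w a v)"
  by (auto simp: iota_def alternating_add)

lemma iota_scale: "alternating (Suc k) a \<Longrightarrow> iota (c *\<^sub>R u) a = (\<lambda>v. c * iota u a v)"
  by (auto simp: iota_def alternating_scale)

lemma iota_swap: "alternating (Suc (Suc k)) a \<Longrightarrow> iota u (iota w a) = (\<lambda>v. - iota w (iota u a) v)"
  using alternating_swap by (auto simp: iota_def)

lemma iota_repeat: "alternating (Suc (Suc k)) a \<Longrightarrow> iota u (iota u a) = (\<lambda>v. 0)"
  by (auto simp: iota_def alternating_repeat)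

lemma wedge_add_left: "wedge p q (\<lambda>v. a v + a' v) b v = wedge p q a b v + wedge p q a' b v"
  and wedge_add_right: "wedge p q a (\<lambda>v. b v + b' v) v = wedge p q a b v + wedge p q a b' v"
  by (simp_all add: wedge_def algebra_simps add_divide_distrib sum.distrib)

lemma wedge_cmult_left: "wedge p q (\<lambda>v. c * a v) b v = c * wedge p q a b v"
  and wedge_cmult_right: "wedge p q a (\<lambda>v. c * b v) v = c * wedge p q a b v"
  by (simp_all add: wedge_def sum_distrib_left ac_simps)

lemma wedge_zero_left [simp]: "wedge p q (\<lambda>v. 0) b v = 0"
  and wedge_zero_right [simp]: "wedge p q a (\<lambda>v. 0) v = 0"
  by (simp_all add: wedge_def)

lemma wedge_uminus_left: "wedge p q (\<lambda>v. - a v) b v = - wedge p q a b v"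
  and wedge_uminus_right: "wedge p q a (\<lambda>v. - b v) v = - wedge p q a b v"
  using wedge_cmult_left[of p q "-1"] wedge_cmult_right[of p q a "-1"] by simp_all

lemma wedge_diff_left: "wedge p q (\<lambda>v. a v - a' v) b v = wedge p q a b v - wedge p q a' b v"
  and wedge_diff_right: "wedge p q a (\<lambda>v. b v - b' v) v = wedge p q a b v - wedge p q a b' v"
  by (simp_all add: wedge_def algebra_simps diff_divide_distrib sum_subtractf)

lemma wedge_sum_left: "wedge p q (\<lambda>v. \<Sum>i\<in>S. a i v) b v = (\<Sum>i\<in>S. wedge p q (a i) b v)"
  by (induction S rule: infinite_finite_induct) (auto simp: wedge_add_left)

lemma wedge_sum_right: "wedge p q a (\<lambda>v. \<Sum>i\<in>S. b i v) v = (\<Sum>i\<in>S. wedge p q a (b i) v)"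
  by (induction S rule: infinite_finite_induct) (auto simp: wedge_add_right)

lemma wedge_sum_list_right:
  "wedge p q a (\<lambda>v. \<Sum>x\<leftarrow>xs. b x v) v = (\<Sum>x\<leftarrow>xs. wedge p q a (b x) v)"
  by (induction xs) (auto simp: wedge_add_right)

lemma wedge_iota_Suc:
  assumes "alternating (Suc p) a" "alternating (Suc q) b"
  shows "wedge (Suc p) (Suc q) a b (u ## w) =
    wedge p (Suc q) (iota u a) b w - (-1) ^ p * wedge (Suc p) q a (iota u b) w"
  using wedge_iota[OF assms, of "p + Suc q" u w] by simp

lemma wedge_0_0: "wedge 0 0 (a :: real mform) b v = a v * b v"
  by (simp add: wedge_def permutes_empty)

lemma wedge_0_left:
  "alternating 0 a \<Longrightarrow> alternating q b \<Longrightarrow> wedge 0 q a b v = a zs * b v"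
proof (induction q arbitrary: b v)
  case 0
  then show ?case using alternating_0_const by (metis wedge_0_0)
next
  case (Suc q)
  have "wedge 0 (Suc q) a b (u ## w) = a zs * b (u ## w)" for u w
    using wedge_iota[OF Suc.prems(1,2), of q u w] Suc.IH[OF Suc.prems(1) alternating_iota[OF Suc.prems(2)]]
    by (simp add: iota_def)
  from this[of "v 0" "\<lambda>i. v (Suc i)"] show ?case by (simp add: vcons_eta)
qed

lemma wedge_0_right:
  "alternating p a \<Longrightarrow> alternating 0 b \<Longrightarrow> wedge p 0 a b v = a v * b zs"
proof (induction p arbitrary: a v)
  case 0
  then show ?case using alternating_0_const by (metis wedge_0_0)
next
  case (Suc p)
  have "wedge (Suc p) 0 a b (u ## w) = a (u ## w) * b zs" for u w
    using wedge_iota[OF Suc.prems(1,2), of p u w] Suc.IH[OF alternating_iota[OF Suc.prems(1)] Suc.prems(2)]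
    by (simp add: iota_def)
  from this[of "v 0" "\<lambda>i. v (Suc i)"] show ?case by (simp add: vcons_eta)
qed

lemma seq_cases: obtains u w where "v = u ## w"
  using vcons_eta[of v] by metis

text \<open>Induction on the total degree by the rule for interior products; a factor of degree 0 is
  a scalar, which starts the induction.\<close>

lemma alternating_wedge:
  "alternating p a \<Longrightarrow> alternating q b \<Longrightarrow> alternating (p + q) (wedge p q a b)"
proof (induction "p + q" arbitrary: p q a b rule: less_induct)
  case less
  note a = less.prems(1) and b = less.prems(2)
  consider "p = 0" | "q = 0" | p' q' where "p = Suc p'" "q = Suc q'"
    by (cases p; cases q) auto
  then show ?case
  proof cases
    case 1
    then have "wedge p q a b = (\<lambda>v. a zs * b v)" using a b by (auto simp: wedge_0_left)
    then show ?thesis using 1 b alternating_cmult by simp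
  next
    case 2
    then have "wedge p q a b = (\<lambda>v. b zs * a v)" using a b by (auto simp: wedge_0_right)
    then show ?thesis using 2 a alternating_cmult by simp
  next
    case 3
    note a' = a[unfolded 3] and b' = b[unfolded 3]
    have io: "iota u (wedge p q a b) = (\<lambda>w. wedge p' q (iota u a) b w - (-1) ^ p' * wedge p q' a (iota u b) w)" for u
      unfolding 3 iota_def by (auto simp: wedge_iota_Suc[OF a' b'] iota_def)
    have "alternating (Suc (p' + q)) (wedge p q a b)"
    proof (rule alternatingI_Suc)
      fix u
      have "alternating (p' + q) (wedge p' q (iota u a) b)" "alternating (p + q') (wedge p q' a (iota u b))"
        using less.hyps[of p' q "iota u a" b] less.hyps[of p q' a "iota u b"] a b
          alternating_iota[OF a', of u] alternating_iota[OF b', of u] 3 by simp_all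
      then show "alternating (p' + q) (iota u (wedge p q a b))"
        unfolding io using 3 by (auto intro!: alternating_diff alternating_cmult)
    next
      fix v
      show "linear (\<lambda>u. wedge p q a b (u ## v))"
        unfolding 3 wedge_iota_Suc[OF a' b']
        by (rule linearI) (simp_all add: iota_add[OF a'] iota_add[OF b'] iota_scale[OF a'] iota_scale[OF b']
          wedge_add_left wedge_add_right wedge_cmult_left wedge_cmult_right algebra_simps)
    next
      fix u v
      \<comment> \<open>A second contraction with \<open>u\<close> kills the terms in which both
        copies hit the same factor. The two mixed terms are the same product of
        \<open>iota u a\<close> and \<open>iota u b\<close> with opposite signs.\<close>
      have "wedge p q a b (u ## u ## v) = wedge p' q (iota u a) b (u ## v) - (-1) ^ p' * wedge p q' a (iota u b) (u ## v)"
        by (simp only: 3 wedge_iota_Suc[OF a' b'])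
      also have "wedge p' q (iota u a) b (u ## v) = (-1) ^ p' * wedge p' q' (iota u a) (iota u b) v"
      proof (cases p')
        case 0
        then show ?thesis
          using wedge_iota[OF alternating_iota[OF a'] b', of q' u u v] 3 by simp
      next
        case (Suc r)
        then show ?thesis
          using wedge_iota[OF alternating_iota[OF a'] b', of "p' + q'" u u v] 3 iota_repeat a' by simp
      qed
      also have "wedge p q' a (iota u b) (u ## v) = wedge p' q' (iota u a) (iota u b) v"
      proof (cases q')
        case 0
        then show ?thesis
          using wedge_iota[OF a' alternating_iota[OF b'], of "p' + q'" u u v] 3 by simp
      next
        case (Suc r)
        then show ?thesis
          using wedge_iota[OF a' alternating_iota[OF b'], of "p' + q'" u u v] 3 iota_repeat b' by simp
      qed
      finally show "wedge p q a b (u ## u ## v) = 0" by simp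
    qed
    then show ?thesis using 3 by simp
  qed
qed

lemma alternating_wedge':
  "alternating p a \<Longrightarrow> alternating q b \<Longrightarrow> p + q = n \<Longrightarrow> alternating n (wedge p q a b)"
  using alternating_wedge by blast

lemma iota_wedge:
  assumes "alternating (Suc p) a" "alternating (Suc q) b"
  shows "iota u (wedge (Suc p) (Suc q) a b) =
    (\<lambda>w. wedge p (Suc q) (iota u a) b w + (- ((-1) ^ p)) * wedge (Suc p) q a (iota u b) w)"
  by (auto simp: iota_def wedge_iota_Suc[OF assms])

lemma wedge_assoc:
  "alternating p a \<Longrightarrow> alternating q b \<Longrightarrow> alternating r c \<Longrightarrow>
    wedge (p + q) r (wedge p q a b) c v = wedge p (q + r) a (wedge q r b c) v"
proof (induction "p + q + r" arbitrary: p q r a b c v rule: less_induct)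
  case less
  note a = less.prems(1) and b = less.prems(2) and c = less.prems(3)
  consider "p = 0" | "q = 0" | "r = 0" | p' q' r' where "p = Suc p'" "q = Suc q'" "r = Suc r'"
    by (cases p; cases q; cases r) auto
  then show ?case
  proof cases
    case 1
    then have "wedge p q a b = (\<lambda>v. a zs * b v)" using a b by (auto simp: wedge_0_left)
    then show ?thesis
      using 1 a wedge_0_left[of a "q + r" "wedge q r b c" v] alternating_wedge[OF b c]
      by (simp add: wedge_cmult_left)
  next
    case 2
    then have "wedge p q a b = (\<lambda>v. b zs * a v)" using a b by (auto simp: wedge_0_right)
    moreover have "wedge q r b c = (\<lambda>v. b zs * c v)" using 2 b c by (auto simp: wedge_0_left)
    ultimately show ?thesis
      using 2 by (simp add: wedge_cmult_left wedge_cmult_right)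
  next
    case 3
    then have "wedge q r b c = (\<lambda>v. c zs * b v)" using b c by (auto simp: wedge_0_right)
    then show ?thesis
      using 3 c wedge_0_right[of "p + q" "wedge p q a b" c v] alternating_wedge[OF a b]
      by (simp add: wedge_cmult_right)
  next
    case 4
    note a' = a[unfolded 4] and b' = b[unfolded 4] and c' = c[unfolded 4]
    obtain u w where v: "v = u ## w" by (rule seq_cases)
    note IH = less.hyps[unfolded 4]
    have 1: "alternating (Suc (p' + Suc q')) (wedge (Suc p') (Suc q') a b)"
      using alternating_wedge[OF a' b'] by simp
    have 2: "alternating (Suc (q' + Suc r')) (wedge (Suc q') (Suc r') b c)"
      using alternating_wedge[OF b' c'] by simp
    have i1: "wedge (p' + Suc q') (Suc r') (wedge p' (Suc q') (iota u a) b) c w =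
        wedge p' (Suc q' + Suc r') (iota u a) (wedge (Suc q') (Suc r') b c) w"
      by (rule IH) (use alternating_iota[OF a'] b' c' in auto)
    have i2: "wedge (Suc p' + q') (Suc r') (wedge (Suc p') q' a (iota u b)) c w =
        wedge (Suc p') (q' + Suc r') a (wedge q' (Suc r') (iota u b) c) w"
      by (rule IH) (use alternating_iota[OF b'] a' c' in auto)
    have i3: "wedge (Suc p' + Suc q') r' (wedge (Suc p') (Suc q') a b) (iota u c) w =
        wedge (Suc p') (Suc q' + r') a (wedge (Suc q') r' b (iota u c)) w"
      by (rule IH) (use alternating_iota[OF c'] a' b' in auto)
    show ?thesis
      using wedge_iota_Suc[OF 1 c', of u w] wedge_iota_Suc[OF a' 2, of u w] i1 i2 i3
      by (simp add: 4 v iota_wedge[OF a' b'] iota_wedge[OF b' c'] wedge_add_left wedge_add_right wedge_diff_left wedge_diff_right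
          wedge_cmult_left wedge_cmult_right wedge_uminus_left wedge_uminus_right power_add algebra_simps)
  qed
qed

lemma wedge_commute:
  "alternating p a \<Longrightarrow> alternating q b \<Longrightarrow> wedge p q a b v = (-1) ^ (p * q) * wedge q p b a v"
proof (induction "p + q" arbitrary: p q a b v rule: less_induct)
  case less
  note a = less.prems(1) and b = less.prems(2)
  consider "p = 0" | "q = 0" | p' q' where "p = Suc p'" "q = Suc q'"
    by (cases p; cases q) auto
  then show ?case
  proof cases
    case 1
    then show ?thesis using a b by (simp add: wedge_0_left wedge_0_right)
  next
    case 2
    then show ?thesis using a b by (simp add: wedge_0_left wedge_0_right)
  next
    case 3
    note a' = a[unfolded 3] and b' = b[unfolded 3]
    obtain u w where v: "v = u ## w" by (rule seq_cases)
    note IH = less.hyps[unfolded 3]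
    have i1: "wedge p' (Suc q') (iota u a) b w = (-1) ^ (p' * Suc q') * wedge (Suc q') p' b (iota u a) w"
      by (rule IH) (use alternating_iota[OF a'] b' in auto)
    have i2: "wedge (Suc p') q' a (iota u b) w = (-1) ^ (Suc p' * q') * wedge q' (Suc p') (iota u b) a w"
      by (rule IH) (use alternating_iota[OF b'] a' in auto)
    show ?thesis
      unfolding 3 v wedge_iota_Suc[OF a' b'] wedge_iota_Suc[OF b' a'] i1 i2
      by (simp add: power_add algebra_simps power_mult_distrib[symmetric])
  qed
qed

section \<open>Products with 1-forms and pullback\<close>

definition drop_at :: "nat \<Rightarrow> (nat \<Rightarrow> 'a) \<Rightarrow> nat \<Rightarrow> 'a" where
  "drop_at i v = (\<lambda>j. if j < i then v j else v (Suc j))"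

lemma drop_at_0 [simp]: "drop_at 0 (u ## w) = w"
  and drop_at_Suc [simp]: "drop_at (Suc i) (u ## w) = u ## drop_at i w"
  by (auto simp: drop_at_def vcons_def fun_eq_iff split: nat.splits)

text \<open>The right-hand side has the shape of \<open>ext_d\<close>, so formulas for exterior
  derivatives become statements about products with coordinate 1-forms.\<close>

lemma wedge_1_expand:
  "alternating 1 c \<Longrightarrow> alternating k b \<Longrightarrow>
    wedge 1 k c b v = (\<Sum>i\<le>k. (-1) ^ i * c (v i ## zs) * b (drop_at i v))"
proof (induction k arbitrary: b v)
  case 0
  obtain u w where v: "v = u ## w" by (rule seq_cases)
  have "c v = c (u ## zs)"
    by (rule alternating_cong[OF 0(1)]) (simp add: v)
  moreover have "b w = b zs" using 0 alternating_0_const by blast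
  ultimately show ?case using 0 v by (simp add: wedge_0_right)
next
  case (Suc k)
  obtain u w where v: "v = u ## w" by (rule seq_cases)
  have c': "alternating (Suc 0) c" using Suc.prems by simp
  have "wedge 1 (Suc k) c b v = iota u c zs * b w - wedge 1 k c (iota u b) w"
    using wedge_iota_Suc[OF c' Suc.prems(2), of u w] alternating_iota[OF c', of u] Suc.prems(2)
    by (simp add: wedge_0_left v)
  also have "wedge 1 k c (iota u b) w =
      (\<Sum>i\<le>k. (-1) ^ i * c (w i ## zs) * b (u ## drop_at i w))"
    using Suc.IH[OF Suc.prems(1) alternating_iota[OF Suc.prems(2)]] by (simp add: iota_def)
  finally show ?case
    unfolding sum.atMost_Suc_shift by (simp add: v iota_def sum_negf)
qed

lemma wedge_pull: "wedge p q (pull L a) (pull L b) = pull L (wedge p q a b)"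
  by (simp add: wedge_def pull_def)

lemma iota_pull: "iota u (pull L a) = pull L (iota (L u) a)"
  by (auto simp: iota_def pull_def vcons_comp)

lemma alternating_pull:
  assumes "linear L" "alternating k a"
  shows "alternating k (pull L a)"
  unfolding alternating_def pull_def
proof (intro conjI allI impI)
  fix v w :: "nat \<Rightarrow> real ^ 6" assume "\<forall>i<k. v i = w i"
  then show "a (\<lambda>i. L (v i)) = a (\<lambda>i. L (w i))"
    by (intro alternating_cong[OF assms(2)]) auto
next
  fix i and v :: "nat \<Rightarrow> real ^ 6" assume "i < k"
  then have "linear (\<lambda>u. a ((\<lambda>i. L (v i))(i := u)))" by (rule alternating_slot_linear[OF assms(2)])
  from linear_compose[OF assms(1) this]
  show "linear (\<lambda>u. a (\<lambda>j. L ((v(i := u)) j)))"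
    by (simp add: o_def fun_upd_def if_distrib)
next
  fix v :: "nat \<Rightarrow> real ^ 6" and i j assume "i < j \<and> j < k \<and> v i = v j"
  then show "a (\<lambda>i. L (v i)) = 0"
    by (intro alternating_eq_0[OF assms(2), of i j]) auto
qed

text \<open>For an orthonormal list \<open>xs\<close> and a \<open>k\<close>-form \<open>b\<close> this is \<open>k! \<star>b\<close> if \<open>w\<close> is the volume form, and \<open>k!\<close>
  times the inner product of \<open>b\<close> and \<open>w\<close> if \<open>w\<close> is a \<open>k\<close>-form.\<close>

primrec contr :: "(real ^ 6) list \<Rightarrow> nat \<Rightarrow> real mform \<Rightarrow> real mform \<Rightarrow> real mform" where
  "contr xs 0 b w = (\<lambda>v. b zs * w v)"
| "contr xs (Suc k) b w = (\<lambda>v. \<Sum>x\<leftarrow>xs. contr xs k (iota x b) (iota x w) v)"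

lemma iota_neg: "iota x (\<lambda>v. - b v) = (\<lambda>v. - iota x b v)" for b :: "real mform"
  by (simp add: iota_def)

lemma contr_neg_right: "contr xs k b (\<lambda>v. - w v) v = - contr xs k b w v"
  by (induction k arbitrary: b w) (simp_all add: iota_neg uminus_sum_list_map o_def)

lemma contr_neg_left: "contr xs k (\<lambda>v. - b v) w v = - contr xs k b w v"
  by (induction k arbitrary: b w) (simp_all add: iota_neg uminus_sum_list_map o_def)

lemma contr_zero_right [simp]: "contr xs k b (\<lambda>v. 0) v = 0"
  by (induction k arbitrary: b) (simp_all add: iota_def)

lemma contr_commute: "contr xs k a b zs = contr xs k b a zs"
  by (induction k arbitrary: a b) simp_all

lemma contr_pull: "contr xs k (pull L b) (pull L w) v = contr (map L xs) k b w (\<lambda>i. L (v i))"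
  if "linear L" for L
proof (induction k arbitrary: b w)
  case 0
  have "L 0 = 0" using that linear_0 by blast
  then show ?case by (simp add: pull_def)
next
  case (Suc k)
  then show ?case by (simp add: iota_pull o_def)
qed

text \<open>As \<iota>_x \<iota>_x = 0, the new vector \<open>x\<close> is used at most once; by
  antisymmetry of both arguments it can be moved from any of the \<open>Suc k\<close> places to the
  outermost one without changing the term.\<close>

lemma contr_Cons:
  "alternating (Suc k) b \<Longrightarrow> alternating (Suc k + m) w \<Longrightarrow>
    contr (x # xs) (Suc k) b w v = contr xs (Suc k) b w v + Suc k * contr xs k (iota x b) (iota x w) v"
proof (induction k arbitrary: b w)
  case 0
  then show ?case by simp
next
  case (Suc k)
  have b: "alternating (Suc (Suc k)) b" and w: "alternating (Suc (Suc (k + m))) w"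
    using Suc.prems by auto
  have IH: "contr (x # xs) (Suc k) (iota y b) (iota y w) v =
      contr xs (Suc k) (iota y b) (iota y w) v + real (Suc k) * contr xs k (iota x (iota y b)) (iota x (iota y w)) v" for y
    by (rule Suc.IH) (use alternating_iota[OF b] alternating_iota[OF w] in auto)
  have sw: "contr xs k (iota x (iota y b)) (iota x (iota y w)) v =
      contr xs k (iota y (iota x b)) (iota y (iota x w)) v" for y
    by (simp add: iota_swap[OF b, of x y] iota_swap[OF w, of x y] contr_neg_left contr_neg_right)
  have "contr (x # xs) (Suc (Suc k)) b w v =
      contr (x # xs) (Suc k) (iota x b) (iota x w) v + (\<Sum>y\<leftarrow>xs. contr (x # xs) (Suc k) (iota y b) (iota y w) v)"
    by (simp only: contr.simps list.map sum_list.Cons)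
  also have "contr (x # xs) (Suc k) (iota x b) (iota x w) v = contr xs (Suc k) (iota x b) (iota x w) v"
    unfolding IH by (simp add: iota_repeat[OF w])
  also have "(\<Sum>y\<leftarrow>xs. contr (x # xs) (Suc k) (iota y b) (iota y w) v) =
      contr xs (Suc (Suc k)) b w v + real (Suc k) * contr xs (Suc k) (iota x b) (iota x w) v"
    unfolding IH sw by (simp only: contr.simps sum_list_addf sum_list_const_mult)
  finally show ?case by (simp add: algebra_simps)
qed

text \<open>A term with more slots than there are vectors uses one of them twice.\<close>

lemma contr_gt_length:
  "length xs < k \<Longrightarrow> alternating k b \<Longrightarrow> alternating (k + m) w \<Longrightarrow> contr xs k b w v = 0"
proof (induction xs arbitrary: k b w)
  case Nil
  then show ?case by (cases k) auto
next
  case (Cons x xs)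
  then obtain k' where k: "k = Suc k'" by (cases k) auto
  have "contr xs k b w v = 0" using Cons by simp
  moreover have "contr xs k' (iota x b) (iota x w) v = 0"
    using Cons k alternating_iota by (intro Cons.IH) auto
  ultimately show ?case
    using contr_Cons[of k' b m w x xs v] Cons.prems k by simp
qed

lemma alternating_contr: "alternating (k + m) w \<Longrightarrow> alternating m (contr xs k b w)"
proof (induction k arbitrary: b w)
  case 0
  then show ?case unfolding contr.simps by (intro alternating_cmult) simp
next
  case (Suc k)
  then have w: "alternating (Suc (k + m)) w" by simp
  show ?case
    unfolding contr.simps by (rule alternating_sum_list, rule Suc.IH, rule alternating_iota[OF w])
qed

text \<open>The contraction occupies the first \<open>k\<close> slots of \<open>w\<close>, so
  \<open>x\<close> has to be moved past \<open>k\<close> vectors.\<close>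

lemma iota_contr:
  "alternating (Suc (k + m)) w \<Longrightarrow> iota x (contr xs k b w) v = (-1) ^ k * contr xs k b (iota x w) v"
proof (induction k arbitrary: b w)
  case 0
  show ?case unfolding contr.simps iota_def by simp
next
  case (Suc k)
  have w: "alternating (Suc (Suc (k + m))) w" using Suc.prems by simp
  have "iota x (contr xs (Suc k) b w) v = (\<Sum>y\<leftarrow>xs. iota x (contr xs k (iota y b) (iota y w)) v)"
    unfolding contr.simps iota_def[of x] by (rule refl)
  also have "\<dots> = (\<Sum>y\<leftarrow>xs. (-1) ^ k * contr xs k (iota y b) (iota x (iota y w)) v)"
    by (subst Suc.IH) (use alternating_iota[OF w] in auto)
  also have "\<dots> = (\<Sum>y\<leftarrow>xs. (-1) ^ Suc k * contr xs k (iota y b) (iota y (iota x w)) v)"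
    by (subst iota_swap[OF w, of x]) (simp add: contr_neg_right)
  also have "\<dots> = (-1) ^ Suc k * contr xs (Suc k) b (iota x w) v"
    by (simp only: sum_list_const_mult contr.simps)
  finally show ?case .
qed

lemma contr_nonneg: "contr xs k a a zs \<ge> 0"
  by (induction k arbitrary: a) (auto intro!: sum_list_nonneg)

text \<open>\<open>contr xs k a a\<close> is the sum of the squares of the values of
  \<open>a\<close> on all \<open>k\<close>-tuples from \<open>xs\<close>.\<close>

lemma contr_definite:
  assumes "span (set xs) = UNIV"
  shows "alternating k a \<Longrightarrow> contr xs k a a zs = 0 \<Longrightarrow> a v = 0"
proof (induction k arbitrary: a v)
  case 0
  then show ?case using alternating_0_const[of a v] by simp
next
  case (Suc k)
  obtain u w where v: "v = u ## w" by (rule seq_cases)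
  have "contr xs k (iota x a) (iota x a) zs = 0" if "x \<in> set xs" for x
    using Suc.prems(2) that
    by (subst (asm) contr.simps, subst (asm) sum_list_nonneg_eq_0_iff) (auto simp: contr_nonneg)
  then have z: "a (x ## w) = 0" if "x \<in> set xs" for x
    using Suc.IH[OF alternating_iota[OF Suc.prems(1)], of x w] that by (simp add: iota_def)
  have "a (u ## w) = 0"
    using linear_eq_0_on_span[OF alternating_linear[OF Suc.prems(1)], of "set xs" w u] z assms by simp
  then show ?case using v by simp
qed

lemma alternating_gt_length:
  fixes xs :: "(real ^ 6) list"
  assumes "span (set xs) = UNIV" "alternating k a" "length xs < k"
  shows "a v = 0"
  using contr_definite[OF assms(1), of k a v] contr_gt_length[of xs k a 0 a] assms by simp

text \<open>By induction: as \<open>a \<and> F\<close> vanishes for degree reasons, \<open>\<iota>\<^sub>x(a \<and> F) = 0\<close> moves \<open>\<iota>\<^sub>x\<close> from \<open>F\<close> to \<open>a\<close>.\<close>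

lemma wedge_contr:
  assumes xs: "span (set xs) = UNIV" "length xs = n" and w: "alternating n w"
  shows "k \<le> n \<Longrightarrow> alternating k a \<Longrightarrow> alternating k b \<Longrightarrow>
    wedge k (n - k) a (contr xs k b w) v = contr xs k a b zs * w v"
proof (induction k arbitrary: a b)
  case 0
  then show ?case using w alternating_cmult[OF w] by (simp add: wedge_0_left)
next
  case (Suc k)
  define m where "m = n - Suc k"
  have m: "n - k = Suc m" "n = k + Suc m" using Suc.prems m_def by auto
  have w': "alternating (Suc (k + m)) w" using w m by simp
  have step: "wedge (Suc k) m a (contr xs k (iota x b) (iota x w)) v =
      contr xs k (iota x a) (iota x b) zs * w v" for x
  proof -
    let ?F = "contr xs k (iota x b) w"
    have F: "alternating (Suc m) ?F" using w m by (intro alternating_contr) simp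
    have "alternating (Suc k + Suc m) (wedge (Suc k) (Suc m) a ?F)"
      by (rule alternating_wedge[OF Suc.prems(2) F])
    then have "wedge (Suc k) (Suc m) a ?F (x ## v) = 0"
      by (rule alternating_gt_length[OF xs(1)]) (use xs m in auto)
    then have "(-1) ^ k * wedge (Suc k) m a (iota x ?F) v = wedge k (Suc m) (iota x a) ?F v"
      using wedge_iota_Suc[OF Suc.prems(2) F, of x v] by simp
    also have "iota x ?F = (\<lambda>v. (-1) ^ k * contr xs k (iota x b) (iota x w) v)"
      using iota_contr[OF w'] by auto
    also have "wedge k (Suc m) (iota x a) ?F v = contr xs k (iota x a) (iota x b) zs * w v"
      using Suc.IH[OF _ alternating_iota alternating_iota, of a b x x] Suc.prems m by simp
    finally show ?thesis
      by (simp add: wedge_cmult_right flip: mult.assoc power_mult_distrib)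
  qed
  show ?case
    by (simp add: wedge_sum_list_right step sum_list_mult_const flip: m_def)
qed

text \<open>Freezing the last arguments of \<open>w\<close> at \<open>v\<close> makes a value of the
  contraction a pairing of two \<open>k\<close>-forms, which can then be expressed without a
  frame.\<close>

lemma contr_eq_append:
  "contr xs k b w v = contr xs k b (\<lambda>u. w (\<lambda>i. if i < k then u i else v (i - k))) zs"
proof (induction k arbitrary: b w)
  case (Suc k)
  have "iota x (\<lambda>u. w (\<lambda>i. if i < Suc k then u i else v (i - Suc k))) =
      (\<lambda>u. iota x w (\<lambda>i. if i < k then u i else v (i - k)))" for x
    by (auto simp: iota_def vcons_def fun_eq_iff split: nat.splits intro!: arg_cong[of _ _ w])
  then show ?case using Suc by simp
qed simp

section \<open>The Hodge star in an orthonormal frame\<close>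

text \<open>The terms of \<open>contr\<close> with increasing indices; all others are repetitions of these or 0.\<close>

primrec scontr :: "(real ^ 6) list \<Rightarrow> nat \<Rightarrow> real mform \<Rightarrow> real mform \<Rightarrow> real mform" where
  "scontr [] k b w = (\<lambda>v. if k = 0 then b zs * w v else 0)"
| "scontr (x # xs) k b w = (\<lambda>v. if k = 0 then b zs * w v
     else scontr xs k b w v + scontr xs (k - 1) (iota x b) (iota x w) v)"

lemma scontr_0 [simp]: "scontr xs 0 b w v = b zs * w v"
  by (cases xs) auto

lemma contr_eq_scontr:
  "alternating k b \<Longrightarrow> alternating (k + m) w \<Longrightarrow> contr xs k b w v = fact k * scontr xs k b w v"
proof (induction xs arbitrary: k b w)
  case Nil
  then show ?case by (cases k) auto
next
  case (Cons x xs)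
  show ?case
  proof (cases k)
    case (Suc k')
    have b: "alternating (Suc k') b" and w: "alternating (Suc (k' + m)) w"
      using Cons.prems Suc by auto
    have "contr xs k' (iota x b) (iota x w) v = fact k' * scontr xs k' (iota x b) (iota x w) v"
      by (rule Cons.IH[OF alternating_iota[OF b] alternating_iota[OF w]])
    moreover have "contr xs k b w v = fact k * scontr xs k b w v"
      by (rule Cons.IH[OF Cons.prems])
    moreover have "contr (x # xs) k b w v = contr xs k b w v + Suc k' * contr xs k' (iota x b) (iota x w) v"
      unfolding Suc by (rule contr_Cons[where m = m]) (use b w in auto)
    ultimately show ?thesis
      using Suc by (simp add: algebra_simps)
  qed simp
qed

section \<open>Inner products of forms by an orthonormal frame\<close>

definition inner_form :: "(real ^ 6 \<Rightarrow> real ^ 6 \<Rightarrow> real) \<Rightarrow> bool" where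
  "inner_form g \<longleftrightarrow> bilinear g \<and> (\<forall>u v. g u v = g v u) \<and> (\<forall>u. u \<noteq> 0 \<longrightarrow> g u u > 0)"

definition orthoframe :: "(real ^ 6 \<Rightarrow> real ^ 6 \<Rightarrow> real) \<Rightarrow> (real ^ 6) list \<Rightarrow> bool" where
  "orthoframe g fs \<longleftrightarrow> length fs = 6 \<and>
     (\<forall>i<6. \<forall>j<6. g (fs ! i) (fs ! j) = (if i = j then 1 else 0))"

lemma orthoframe_pairing:
  assumes "inner_form g" "orthoframe g fs" "i < 6"
  shows "(\<Sum>j<6. c j * g (fs ! j) (fs ! i)) = c i"
proof -
  have "(\<Sum>j<6. c j * g (fs ! j) (fs ! i)) = (\<Sum>j<6. if j = i then c i else 0)"
    using assms by (intro sum.cong) (auto simp: orthoframe_def)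
  then show ?thesis using assms(3) by simp
qed

lemma bilinear_sum_left: "bilinear g \<Longrightarrow> g (\<Sum>i\<in>S. f i) u = (\<Sum>i\<in>S. g (f i) u)"
  and bilinear_sum_right: "bilinear g \<Longrightarrow> g u (\<Sum>i\<in>S. f i) = (\<Sum>i\<in>S. g u (f i))"
  using linear_sum[of "\<lambda>x. g x u" f S] linear_sum[of "g u" f S] by (auto simp: bilinear_def)

lemma orthoframe_span:
  assumes g: "inner_form g" and fs: "orthoframe g fs"
  shows "span (set fs) = UNIV"
proof -
  have len: "length fs = 6" using fs by (simp add: orthoframe_def)
  have bil: "bilinear g" using g by (simp add: inner_form_def)
  have "fs ! i \<noteq> fs ! j" if "i < 6" "j < 6" "i \<noteq> j" for i j
  proof
    assume "fs ! i = fs ! j"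
    then have "g (fs ! i) (fs ! j) = g (fs ! j) (fs ! j)" by simp
    then show False using fs that by (simp add: orthoframe_def)
  qed
  then have dist: "distinct fs" by (simp add: distinct_conv_nth len)
  have sum: "(\<Sum>x\<in>set fs. F x) = (\<Sum>i<6. F (fs ! i))" for F :: "real ^ 6 \<Rightarrow> 'z::comm_monoid_add"
    using sum.reindex_bij_betw[OF bij_betw_nth[OF dist refl refl], of F] len by simp
  have "independent (set fs)"
  proof (rule independent_if_scalars_zero)
    fix c :: "real ^ 6 \<Rightarrow> real" and x
    assume 0: "(\<Sum>x\<in>set fs. c x *\<^sub>R x) = 0" and "x \<in> set fs"
    then obtain i where i: "i < 6" "x = fs ! i" by (metis in_set_conv_nth len)
    have "0 = g (\<Sum>j<6. c (fs ! j) *\<^sub>R fs ! j) (fs ! i)"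
      using 0 by (simp add: sum bilinear_lzero[OF bil])
    also have "\<dots> = (\<Sum>j<6. c (fs ! j) * g (fs ! j) (fs ! i))"
      by (simp add: bilinear_sum_left[OF bil] bilinear_lmul[OF bil])
    also have "\<dots> = c x"
      using orthoframe_pairing[OF g fs i(1), of "\<lambda>j. c (fs ! j)"] i(2) by simp
    finally show "c x = 0" by simp
  qed simp
  moreover have "card (set fs) = 6" using dist len by (simp add: distinct_card)
  ultimately have "UNIV \<subseteq> span (set fs)"
    by (intro card_ge_dim_independent) auto
  then show ?thesis by auto
qed

lemma orthoframe_expand:
  assumes g: "inner_form g" and fs: "orthoframe g fs"
  shows "(\<Sum>x\<leftarrow>fs. g v x *\<^sub>R x) = v"
proof -
  have len: "length fs = 6" using fs by (simp add: orthoframe_def)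
  have bil: "bilinear g" and sym: "\<And>u v. g u v = g v u" and pos: "\<And>u. u \<noteq> 0 \<Longrightarrow> g u u > 0"
    using g unfolding inner_form_def by blast+
  define r where "r = v - (\<Sum>j<6. g v (fs ! j) *\<^sub>R fs ! j)"
  have lin: "linear (\<lambda>u. g r u)" using bil by (simp add: bilinear_def)
  have "g r (fs ! i) = 0" if "i < 6" for i
    using orthoframe_pairing[OF g fs that, of "\<lambda>j. g v (fs ! j)"]
    by (simp add: r_def bilinear_lsub[OF bil] bilinear_sum_left[OF bil] bilinear_lmul[OF bil])
  then have "g r x = 0" if "x \<in> set fs" for x
    using that len by (metis in_set_conv_nth)
  then have "g r r = 0"
    using linear_eq_0_on_span[OF lin, of "set fs" r] orthoframe_span[OF g fs] by simp
  then have "r = 0" using pos[of r] by auto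
  then show ?thesis
    by (simp add: r_def sum_list_sum_nth len atLeast0LessThan)
qed

lemma matrix_inv_eqI:
  fixes A :: "real ^ 'n ^ 'n"
  assumes "A ** B = mat 1"
  shows "matrix_inv A = B"
proof -
  have "B ** A = mat 1" using assms matrix_left_right_inverse by blast
  then have "\<exists>B. A ** B = mat 1 \<and> B ** A = mat 1" using assms by blast
  then have "matrix_inv A ** A = mat 1"
    unfolding matrix_inv_def by (rule someI2_ex) simp
  then have "matrix_inv A ** (A ** B) = B"
    by (simp add: matrix_mul_assoc)
  then show ?thesis using assms by simp
qed

text \<open>This is \<open>orthoframe_expand\<close> in coordinates: the sum of x x^T over the frame
  is inverse to the Gram matrix. The second claim records invertibility, on which the smoothness of
  the cometric rests.\<close>

lemma cometric_frame:
  assumes g: "inner_form g" and fs: "orthoframe g fs"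
  shows "cometric g $ i $ j = (\<Sum>x\<leftarrow>fs. x $ i * x $ j)"
    and "(\<chi> i j. g (axis i 1) (axis j 1)) ** cometric g = mat 1"
proof -
  have bil: "bilinear g" using g by (simp add: inner_form_def)
  let ?M = "\<chi> i j. \<Sum>x\<leftarrow>fs. x $ i * x $ j"
  have comp: "(\<Sum>x\<leftarrow>xs. F x) $ k = (\<Sum>x\<leftarrow>xs. F x $ k)" for xs and F :: "real ^ 6 \<Rightarrow> real ^ 6" and k
    by (induction xs) auto
  have swap: "(\<Sum>j\<in>UNIV. \<Sum>x\<leftarrow>xs. F j x) = (\<Sum>x\<leftarrow>xs. \<Sum>j\<in>UNIV. F j x)" for xs and F :: "6 \<Rightarrow> real ^ 6 \<Rightarrow> real"
    by (induction xs) (auto simp: sum.distrib)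
  have row: "(\<Sum>j\<in>UNIV. g u (axis j 1) * x $ j) = g u x" for u x
  proof -
    have "g u x = g u (\<Sum>j\<in>UNIV. x $ j *\<^sub>R axis j 1)"
      by (simp add: basis_expansion flip: scalar_mult_eq_scaleR)
    also have "\<dots> = (\<Sum>j\<in>UNIV. g u (axis j 1) * x $ j)"
      by (simp add: bilinear_sum_right[OF bil] bilinear_rmul[OF bil] mult.commute)
    finally show ?thesis by simp
  qed
  have 1: "(\<chi> i j. g (axis i 1) (axis j 1)) ** ?M = mat 1"
  proof (simp add: vec_eq_iff matrix_matrix_mult_def, intro allI)
    fix i k :: 6
    have "(\<Sum>j\<in>UNIV. g (axis i 1) (axis j 1) * (\<Sum>x\<leftarrow>fs. x $ j * x $ k)) =
        (\<Sum>x\<leftarrow>fs. (\<Sum>j\<in>UNIV. g (axis i 1) (axis j 1) * x $ j) * x $ k)"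
      by (simp add: sum_list_const_mult[symmetric] swap sum_distrib_right mult.assoc)
    also have "\<dots> = (\<Sum>x\<leftarrow>fs. g (axis i 1) x *\<^sub>R x) $ k"
      by (simp add: row comp)
    finally show "(\<Sum>j\<in>UNIV. g (axis i 1) (axis j 1) * (\<Sum>x\<leftarrow>fs. x $ j * x $ k)) = mat 1 $ i $ k"
      by (simp add: orthoframe_expand[OF g fs] mat_def axis_def)
  qed
  then show "cometric g $ i $ j = (\<Sum>x\<leftarrow>fs. x $ i * x $ j)"
    unfolding cometric_def by (simp add: matrix_inv_eqI)
  show "(\<chi> i j. g (axis i 1) (axis j 1)) ** cometric g = mat 1"
    unfolding cometric_def matrix_inv_eqI[OF 1] by (rule 1)
qed

lemma contr_add_left: "contr xs k (\<lambda>v. b v + b' v) w v = contr xs k b w v + contr xs k b' w v"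
proof (induction k arbitrary: b b' w)
  case (Suc k)
  have "iota x (\<lambda>v. b v + b' v) = (\<lambda>v. iota x b v + iota x b' v)" for x by (simp add: iota_def)
  then show ?case by (simp add: Suc sum_list_addf)
qed (simp add: algebra_simps)

lemma contr_cmult_left: "contr xs k (\<lambda>v. c * b v) w v = c * contr xs k b w v"
proof (induction k arbitrary: b w)
  case (Suc k)
  have "iota x (\<lambda>v. c * b v) = (\<lambda>v. c * iota x b v)" for x by (simp add: iota_def)
  then show ?case by (simp add: Suc sum_list_const_mult)
qed simp

lemma contr_zero_left [simp]: "contr xs k (\<lambda>v. 0) w v = 0"
  using contr_cmult_left[of xs k 0] by simp

lemma contr_sum_left: "contr xs k (\<lambda>v. \<Sum>i\<in>S. b i v) w v = (\<Sum>i\<in>S. contr xs k (b i) w v)"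
  by (induction S rule: infinite_finite_induct) (auto simp: contr_add_left)

lemma iota_expand:
  assumes "alternating (Suc k) a"
  shows "iota x a = (\<lambda>v. \<Sum>i\<in>UNIV. x $ i * iota (axis i 1) a v)"
proof
  fix v
  have "iota x a v = a ((\<Sum>i\<in>UNIV. x $ i *\<^sub>R axis i 1) ## v)"
    by (simp add: basis_expansion iota_def flip: scalar_mult_eq_scaleR)
  also have "\<dots> = (\<Sum>i\<in>UNIV. x $ i * iota (axis i 1) a v)"
    using linear_sum[OF alternating_linear[OF assms], of "\<lambda>i. x $ i *\<^sub>R axis i 1" UNIV v]
    by (simp add: alternating_scale[OF assms] iota_def)
  finally show "iota x a v = (\<Sum>i\<in>UNIV. x $ i * iota (axis i 1) a v)" .
qed

lemma contr_iota_expand: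
  assumes a: "alternating (Suc k) a" and b: "alternating (Suc k) b"
  shows "contr xs k (iota x a) (iota x b) zs =
    (\<Sum>i\<in>UNIV. \<Sum>j\<in>UNIV. x $ i * x $ j * contr xs k (iota (axis i 1) a) (iota (axis j 1) b) zs)"
proof -
  have "contr xs k (iota x a) (iota x b) zs =
      (\<Sum>i\<in>UNIV. x $ i * contr xs k (iota (axis i 1) a) (iota x b) zs)"
    by (subst iota_expand[OF a]) (simp add: contr_sum_left contr_cmult_left)
  also have "\<dots> = (\<Sum>i\<in>UNIV. x $ i * (\<Sum>j\<in>UNIV. x $ j * contr xs k (iota (axis j 1) b) (iota (axis i 1) a) zs))"
    by (subst contr_commute, subst iota_expand[OF b]) (simp add: contr_sum_left contr_cmult_left)
  finally show ?thesis
    by (simp add: sum_distrib_left mult.assoc contr_commute[of xs k "iota _ b"])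
qed

lemma sum_PiE_Suc:
  fixes F :: "(nat \<Rightarrow> 6) \<Rightarrow> real"
  shows "(\<Sum>I\<in>{..<Suc k} \<rightarrow>\<^sub>E UNIV. F I) = (\<Sum>i\<in>UNIV. \<Sum>I\<in>{..<k} \<rightarrow>\<^sub>E UNIV. F (i ## I))"
proof -
  have "bij_betw (\<lambda>(i, I). i ## I) (UNIV \<times> ({..<k} \<rightarrow>\<^sub>E UNIV)) ({..<Suc k} \<rightarrow>\<^sub>E (UNIV :: 6 set))"
    unfolding bij_betw_def
  proof
    show "inj_on (\<lambda>(i, I). i ## I) (UNIV \<times> ({..<k} \<rightarrow>\<^sub>E (UNIV :: 6 set)))"
    proof (rule inj_onI, clarify)
      fix i j :: 6 and I J assume eq: "i ## I = j ## J"
      have "I s = J s" for s using fun_cong[OF eq, of "Suc s"] by simp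
      then show "i = j \<and> I = J" using fun_cong[OF eq, of 0] by auto
    qed
    show "(\<lambda>(i, I). i ## I) ` (UNIV \<times> ({..<k} \<rightarrow>\<^sub>E UNIV)) = {..<Suc k} \<rightarrow>\<^sub>E (UNIV :: 6 set)"
    proof (intro equalityI subsetI)
      fix I :: "nat \<Rightarrow> 6" assume I: "I \<in> {..<Suc k} \<rightarrow>\<^sub>E UNIV"
      have "I = (\<lambda>(i, I). i ## I) (I 0, \<lambda>s. I (Suc s))" by (simp add: vcons_eta)
      moreover have "(\<lambda>s. I (Suc s)) \<in> {..<k} \<rightarrow>\<^sub>E UNIV"
        using I by (auto simp: PiE_def extensional_def)
      ultimately show "I \<in> (\<lambda>(i, I). i ## I) ` (UNIV \<times> ({..<k} \<rightarrow>\<^sub>E UNIV))" by blast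
    qed (auto simp: PiE_def extensional_def vcons_def split: nat.splits)
  qed
  from sum.reindex_bij_betw[OF this, of F] show ?thesis
    by (simp add: sum.cartesian_product case_prod_unfold)
qed

text \<open>Peeling off the first entries of both multi-indices leaves one entry of the cometric,
  which \<open>cometric_frame\<close> splits into a sum over the frame. The induction hypothesis
  applies to the interior products.\<close>

lemma form_inner_contr:
  assumes g: "inner_form g" and fs: "orthoframe g fs"
  shows "alternating k a \<Longrightarrow> alternating k b \<Longrightarrow>
    form_inner g k a b = contr fs k a b zs / fact k"
proof (induction k arbitrary: a b)
  case 0
  then have "a v = a zs" "b v = b zs" for v using alternating_0_const by blast+
  from this(1)[of "\<lambda>s. axis undefined 1"] this(2)[of "\<lambda>s. axis undefined 1"]
  show ?case by (simp add: form_inner_def)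
next
  case (Suc k)
  let ?C = "cometric g"
  let ?S = "\<lambda>a b. \<Sum>I\<in>{..<k} \<rightarrow>\<^sub>E UNIV. \<Sum>J\<in>{..<k} \<rightarrow>\<^sub>E UNIV.
    (\<Prod>s<k. ?C $ I s $ J s) * a (\<lambda>s. axis (I s) 1) * b (\<lambda>s. axis (J s) 1)"
  have S: "?S (iota x a) (iota y b) = contr fs k (iota x a) (iota y b) zs" for x y
    using Suc.IH[OF alternating_iota[OF Suc.prems(1)] alternating_iota[OF Suc.prems(2)], of x y]
    by (simp add: form_inner_def)
  have ax: "(\<lambda>s. axis ((i ## I) s) 1) = axis i 1 ## (\<lambda>s. axis (I s) (1::real))" for i :: 6 and I
    by (rule vcons_comp)
  have "form_inner g (Suc k) a b * fact (Suc k) =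
      (\<Sum>i\<in>UNIV. \<Sum>I\<in>{..<k} \<rightarrow>\<^sub>E UNIV. \<Sum>j\<in>UNIV. \<Sum>J\<in>{..<k} \<rightarrow>\<^sub>E UNIV.
        ?C $ i $ j * ((\<Prod>s<k. ?C $ I s $ J s) * iota (axis i 1) a (\<lambda>s. axis (I s) 1) *
          iota (axis j 1) b (\<lambda>s. axis (J s) 1)))"
    unfolding form_inner_def sum_PiE_Suc
    by (simp add: prod.lessThan_Suc_shift ax iota_def mult.assoc del: prod.lessThan_Suc)
  also have "\<dots> = (\<Sum>i\<in>UNIV. \<Sum>j\<in>UNIV. ?C $ i $ j * ?S (iota (axis i 1) a) (iota (axis j 1) b))"
    by (subst sum.swap[of _ UNIV "{..<k} \<rightarrow>\<^sub>E UNIV"]) (simp add: sum_distrib_left)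
  also have "\<dots> = (\<Sum>i\<in>UNIV. \<Sum>j\<in>UNIV. \<Sum>x\<leftarrow>fs. x $ i * x $ j *
      contr fs k (iota (axis i 1) a) (iota (axis j 1) b) zs)"
    by (simp only: S) (simp only: cometric_frame(1)[OF g fs] sum_list_mult_const)
  also have "\<dots> = (\<Sum>x\<leftarrow>fs. contr fs k (iota x a) (iota x b) zs)"
  proof -
    have swap: "(\<Sum>j\<in>UNIV. \<Sum>x\<leftarrow>xs. F j x) = (\<Sum>x\<leftarrow>xs. \<Sum>j\<in>UNIV. F j x)" for xs and F :: "6 \<Rightarrow> real ^ 6 \<Rightarrow> real"
      by (induction xs) (auto simp: sum.distrib)
    show ?thesis
      by (simp only: swap contr_iota_expand[OF Suc.prems])
  qed
  finally show ?case
    by (simp only: contr.simps eq_divide_eq fact_nonzero if_False if_True simp_thms)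
qed

lemma form_inner_scontr:
  assumes "inner_form g" "orthoframe g fs" "alternating k a" "alternating k b"
  shows "form_inner g k a b = scontr fs k a b zs"
  using form_inner_contr[OF assms] contr_eq_scontr[of k a 0 b] assms by simp

lemma form_inner_definite:
  assumes "inner_form g" "orthoframe g fs" "alternating k a" "form_inner g k a a = 0"
  shows "a v = 0"
  using contr_definite[OF orthoframe_span[OF assms(1,2)] assms(3)] assms(4)
    form_inner_contr[OF assms(1,2,3,3)] by simp

lemma form_inner_diff_left:
  "form_inner g k (\<lambda>v. a v - a' v) b = form_inner g k a b - form_inner g k a' b"
  by (simp add: form_inner_def diff_divide_distrib algebra_simps sum_subtractf)

text \<open>Existence in the definite description is \<open>wedge_contr\<close>. For uniqueness, the
  difference \<open>d\<close> of two candidates has product 0 with every \<open>k\<close>-form, in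
  particular with its own contraction against \<open>w\<close>; up to a factor that product is |d|^2
  w.\<close>

lemma hodge_pt_contr:
  assumes g: "inner_form g" and fs: "orthoframe g fs" and w: "alternating 6 w" "w e \<noteq> 0"
    and k: "k \<le> 6" and b: "alternating k b"
  shows "hodge_pt g w k b = (\<lambda>v. contr fs k b w v / fact k)"
  unfolding hodge_pt_def
proof (rule the_equality, intro conjI allI impI)
  note sp = orthoframe_span[OF g fs]
  have len: "length fs = 6" using fs by (simp add: orthoframe_def)
  let ?s = "\<lambda>v. contr fs k b w v / fact k"
  show alt: "alternating (6 - k) ?s"
    using w k by (intro alternating_divide alternating_contr) simp
  have wd: "wedge k (6 - k) a ?s v = form_inner g k a b * w v" if "alternating k a" for a v
  proof -
    have "wedge k (6 - k) a ?s v = wedge k (6 - k) a (\<lambda>v. (1 / fact k) * contr fs k b w v) v" by simp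
    also have "\<dots> = (1 / fact k) * wedge k (6 - k) a (contr fs k b w) v"
      by (rule wedge_cmult_right)
    also have "\<dots> = form_inner g k a b * w v"
      using wedge_contr[OF sp len w(1) k that b] form_inner_contr[OF g fs that b] by simp
    finally show ?thesis .
  qed
  then show "wedge k (6 - k) a ?s = (\<lambda>v. form_inner g k a b * w v)" if "alternating k a" for a
    using that by auto
  fix s assume s: "alternating (6 - k) s \<and>
    (\<forall>a. alternating k a \<longrightarrow> wedge k (6 - k) a s = (\<lambda>v. form_inner g k a b * w v))"
  define d where "d = (\<lambda>v. s v - ?s v)"
  have d: "alternating (6 - k) d" unfolding d_def using s alt by (auto intro: alternating_diff)
  have z: "wedge k (6 - k) a d v = 0" if "alternating k a" for a v
    using wd[OF that] s that by (simp add: d_def wedge_diff_right)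
  define a where "a = contr fs (6 - k) d w"
  have a: "alternating k a" unfolding a_def using w k by (intro alternating_contr) simp
  have "contr fs (6 - k) d d zs * w e = wedge (6 - k) k d a e"
    using wedge_contr[OF sp len w(1) _ d d] k by (simp add: a_def)
  also have "\<dots> = 0"
    using wedge_commute[OF d a] z[OF a] by simp
  finally have "contr fs (6 - k) d d zs = 0" using w by simp
  then have "d v = 0" for v by (rule contr_definite[OF sp d])
  then show "s = ?s" by (auto simp: d_def fun_eq_iff)
qed

lemma hodge_pt_scontr:
  assumes "inner_form g" "orthoframe g fs" "alternating 6 w" "w e \<noteq> 0" "k \<le> 6" "alternating k b"
  shows "hodge_pt g w k b = scontr fs k b w"
  using hodge_pt_contr[OF assms] contr_eq_scontr[of k b "6 - k" w] assms by auto

text \<open>The right-hand side is free of the frame and therefore depends smoothly on the point;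
  this is what makes \<open>hodge\<close> a smooth field.\<close>

lemma hodge_pt_append:
  assumes "inner_form g" "orthoframe g fs" "alternating 6 w" "w e \<noteq> 0" "k \<le> 6" "alternating k b"
  shows "hodge_pt g w k b v = form_inner g k b (\<lambda>u. w (\<lambda>i. if i < k then u i else v (i - k)))"
proof -
  let ?w = "\<lambda>u. w (\<lambda>i. if i < k then u i else v (i - k))"
  have "alternating k ?w"
    unfolding alternating_def
  proof (intro conjI allI impI)
    fix x y :: "nat \<Rightarrow> real ^ 6" assume "\<forall>i<k. x i = y i"
    then show "?w x = ?w y" by (intro arg_cong[of _ _ w]) auto
  next
    fix i and u :: "nat \<Rightarrow> real ^ 6" assume i: "i < k"
    let ?f = "\<lambda>j. if j < k then u j else v (j - k)"
    have "(\<lambda>j. if j < k then (u(i := x)) j else v (j - k)) = ?f(i := x)" for x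
      using i by auto
    then show "linear (\<lambda>x. ?w (u(i := x)))"
      using alternating_slot_linear[OF assms(3), of i ?f] i assms(5) by simp
  next
    fix u :: "nat \<Rightarrow> real ^ 6" and i j assume "i < j \<and> j < k \<and> u i = u j"
    then show "?w u = 0"
      using assms(5) by (intro alternating_eq_0[OF assms(3), of i j]) auto
  qed
  then show ?thesis
    using hodge_pt_contr[OF assms] form_inner_contr[OF assms(1,2,6), of ?w]
      contr_eq_append[of fs k b w v] by simp
qed

lemma alternating_hodge_pt:
  assumes "inner_form g" "orthoframe g fs" "alternating 6 w" "w e \<noteq> 0" "k \<le> 6" "alternating k b"
  shows "alternating (6 - k) (hodge_pt g w k b)"
  unfolding hodge_pt_contr[OF assms] using assms by (intro alternating_divide alternating_contr) simp

lemma wedge_hodge_pt: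
  assumes "inner_form g" "orthoframe g fs" "alternating 6 w" "w e \<noteq> 0" "k \<le> 6" "alternating k b"
    "alternating k a"
  shows "wedge k (6 - k) a (hodge_pt g w k b) v = form_inner g k a b * w v"
proof -
  have len: "length fs = 6" using assms by (simp add: orthoframe_def)
  have "wedge k (6 - k) a (hodge_pt g w k b) v = wedge k (6 - k) a (\<lambda>v. (1 / fact k) * contr fs k b w v) v"
    by (simp add: hodge_pt_contr[OF assms(1-6)])
  also have "\<dots> = (1 / fact k) * wedge k (6 - k) a (contr fs k b w) v"
    by (rule wedge_cmult_right)
  also have "\<dots> = form_inner g k a b * w v"
    using wedge_contr[OF orthoframe_span[OF assms(1,2)] len assms(3,5,7,6)]
      form_inner_contr[OF assms(1,2,7,6)] by simp
  finally show ?thesis .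
qed

text \<open>An isometry carries orthonormal frames to orthonormal frames, so both contractions agree
  term by term. It is applied to the derivatives of transition maps.\<close>

lemma hodge_pt_pull:
  assumes g: "inner_form g" and fs: "orthoframe g fs" and g': "inner_form g'"
    and w: "alternating 6 w'" "w' e \<noteq> 0" "pull L w' e' \<noteq> 0" and k: "k \<le> 6" and b: "alternating k b"
    and L: "linear L" and pull: "\<And>u v. g u v = g' (L u) (L v)"
  shows "hodge_pt g (pull L w') k (pull L b) = pull L (hodge_pt g' w' k b)"
proof -
  have fs': "orthoframe g' (map L fs)"
    using fs pull by (auto simp: orthoframe_def)
  show ?thesis
    unfolding hodge_pt_contr[OF g fs alternating_pull[OF L w(1)] w(3) k alternating_pull[OF L b]]
      hodge_pt_contr[OF g' fs' w(1,2) k b] contr_pull[OF L] by (simp add: pull_def)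
qed

lemma orth_proj_eqI:
  assumes "inner_form g" "orthoframe g fs" and W: "\<And>t. t \<in> W \<Longrightarrow> alternating k t"
    "\<And>t u. t \<in> W \<Longrightarrow> u \<in> W \<Longrightarrow> (\<lambda>v. t v - u v) \<in> W"
    and t: "t \<in> W" "\<And>w. w \<in> W \<Longrightarrow> form_inner g k (\<lambda>v. s v - t v) w = 0"
  shows "orth_proj g k W s = t"
  unfolding orth_proj_def
proof (rule the_equality)
  fix t' assume t': "t' \<in> W \<and> (\<forall>w\<in>W. form_inner g k (\<lambda>v. s v - t' v) w = 0)"
  let ?d = "\<lambda>v. t v - t' v"
  have d: "?d \<in> W" using t(1) t' W(2) by blast
  have "form_inner g k ?d ?d =
      form_inner g k (\<lambda>v. s v - t' v) ?d - form_inner g k (\<lambda>v. s v - t v) ?d"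
    by (simp add: form_inner_diff_left)
  then have "form_inner g k ?d ?d = 0" using t(2)[OF d] t' d by simp
  then have "?d v = 0" for v by (rule form_inner_definite[OF assms(1,2) W(1)[OF d]])
  then show "t' = t" by (auto simp: fun_eq_iff)
qed (use t in auto)

text \<open>Equality of the components with increasing indices.\<close>

primrec agree :: "(real ^ 6) list \<Rightarrow> nat \<Rightarrow> real mform \<Rightarrow> real mform \<Rightarrow> bool" where
  "agree [] k a b \<longleftrightarrow> k = 0 \<longrightarrow> a zs = b zs"
| "agree (x # xs) k a b \<longleftrightarrow> (if k = 0 then a zs = b zs
     else agree xs k a b \<and> agree xs (k - 1) (iota x a) (iota x b))"

text \<open>The \<open>scontr\<close> of \<open>a - b\<close> with itself is the sum of the squares
  of the compared components. An identity of forms is thereby reduced to finitely many equations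
  that simplification can settle.\<close>

lemma agree_eq:
  assumes sp: "span (set xs) = UNIV" and a: "alternating k a" and b: "alternating k b"
    and "agree xs k a b"
  shows "a = b"
proof -
  have "scontr xs k (\<lambda>v. a v - b v) (\<lambda>v. a v - b v) zs = 0" if "agree xs k a b" for xs k a b
    using that
  proof (induction xs arbitrary: k a b)
    case (Cons x xs)
    have "iota x (\<lambda>v. a v - b v) = (\<lambda>v. iota x a v - iota x b v)" by (simp add: iota_def)
    then show ?case using Cons by (simp split: if_splits)
  qed (auto split: if_splits)
  from this[OF assms(4)] have "contr xs k (\<lambda>v. a v - b v) (\<lambda>v. a v - b v) zs = 0"
    using contr_eq_scontr[of k "\<lambda>v. a v - b v" 0 "\<lambda>v. a v - b v"] alternating_diff[OF a b] by simp
  then have "a v - b v = 0" for v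
    using contr_definite[OF sp alternating_diff[OF a b]] by blast
  then show ?thesis by (auto simp: fun_eq_iff)
qed

lemma form_inner_cmult_left: "form_inner g k (\<lambda>v. c * a v) b = c * form_inner g k a b"
  by (simp add: form_inner_def sum_distrib_left ac_simps)

lemma form_inner_diff_right:
  "form_inner g k a (\<lambda>v. b v - b' v) = form_inner g k a b - form_inner g k a b'"
  by (simp add: form_inner_def diff_divide_distrib algebra_simps sum_subtractf)

lemma form_inner_zero_left [simp]: "form_inner g k (\<lambda>v. 0) b = 0"
  by (simp add: form_inner_def)

lemma form_inner_nonneg:
  assumes "inner_form g" "orthoframe g fs" "alternating k a"
  shows "form_inner g k a a \<ge> 0"
  using form_inner_contr[OF assms(1,2,3,3)] contr_nonneg[of fs k a] by simp

section \<open>Smooth functions\<close>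

lemma has_frechet_derivative:
  assumes "open S" "x \<in> S" "f differentiable_on S"
  shows "(f has_derivative frechet_derivative f (at x)) (at x)"
  using assms by (simp add: differentiable_on_eq_differentiable_at frechet_derivative_works)

lemma frechet_derivative_eq: "(f has_derivative f') (at x) \<Longrightarrow> frechet_derivative f (at x) = f'"
  by (rule frechet_derivative_at[symmetric])

lemma has_derivative_cong_open:
  assumes "open S" "x \<in> S" "\<And>y. y \<in> S \<Longrightarrow> f y = g y"
  shows "(f has_derivative D) (at x) \<longleftrightarrow> (g has_derivative D) (at x)"
  using has_derivative_transform_within_open[OF _ assms(1,2), of f D UNIV g]
    has_derivative_transform_within_open[OF _ assms(1,2), of g D UNIV f] assms(3) by auto

lemma frechet_derivative_transform:
  assumes "open S" "x \<in> S" "\<And>y. y \<in> S \<Longrightarrow> f y = g y"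
  shows "frechet_derivative f (at x) = frechet_derivative g (at x)"
  using has_derivative_cong_open[OF assms] by (simp add: frechet_derivative_def)

lemma Ck_on_cong:
  assumes "open S"
  shows "(\<And>x. x \<in> S \<Longrightarrow> f x = g x) \<Longrightarrow> Ck_on n S f \<longleftrightarrow> Ck_on n S g"
proof (induction n arbitrary: f g)
  case 0
  then show ?case by (auto cong: continuous_on_cong)
next
  case (Suc n)
  have "frechet_derivative f (at x) v = frechet_derivative g (at x) v" if "x \<in> S" for x v
    using frechet_derivative_transform[OF assms that, of f g] Suc.prems by simp
  then have "Ck_on n S (\<lambda>x. frechet_derivative f (at x) v) \<longleftrightarrow> Ck_on n S (\<lambda>x. frechet_derivative g (at x) v)" for v
    by (rule Suc.IH)
  moreover have "f differentiable_on S \<longleftrightarrow> g differentiable_on S"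
    using has_derivative_cong_open[OF assms, of _ f g] Suc.prems
    unfolding differentiable_on_eq_differentiable_at[OF assms] differentiable_def by blast
  ultimately show ?case by simp
qed

lemma Ck_on_continuous: "Ck_on n S f \<Longrightarrow> continuous_on S f"
  by (cases n) (auto intro: differentiable_imp_continuous_on)

lemma Ck_on_SucD: "Ck_on (Suc n) S f \<Longrightarrow> Ck_on n S f"
  by (induction n arbitrary: f) (auto intro: differentiable_imp_continuous_on)

text \<open>Any known derivative may replace the one chosen by \<open>frechet_derivative\<close>;
  each closure property below differentiates once and then uses its induction hypothesis.\<close>

lemma Ck_on_SucI:
  assumes "open S" "\<And>x. x \<in> S \<Longrightarrow> (f has_derivative f' x) (at x)" "\<And>v. Ck_on n S (\<lambda>x. f' x v)"
  shows "Ck_on (Suc n) S f"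
proof -
  have "f differentiable_on S"
    using assms(2) by (auto simp: differentiable_on_def differentiable_def intro: has_derivative_at_withinI)
  moreover have "Ck_on n S (\<lambda>x. frechet_derivative f (at x) v)" for v
    using Ck_on_cong[OF assms(1), of "\<lambda>x. frechet_derivative f (at x) v" "\<lambda>x. f' x v" n]
      frechet_derivative_eq[OF assms(2)] assms(3) by auto
  ultimately show ?thesis by simp
qed

lemma Ck_on_SucE:
  assumes "open S" "Ck_on (Suc n) S f"
  shows "\<And>x. x \<in> S \<Longrightarrow> (f has_derivative frechet_derivative f (at x)) (at x)"
    "\<And>v. Ck_on n S (\<lambda>x. frechet_derivative f (at x) v)"
  using assms has_frechet_derivative by auto

lemma Ck_on_const: "open S \<Longrightarrow> Ck_on n S (\<lambda>x. c)"
proof (induction n arbitrary: c)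
  case (Suc n)
  then show ?case by (intro Ck_on_SucI[where f' = "\<lambda>_ _. 0"]) auto
qed auto

lemma Ck_on_add: "open S \<Longrightarrow> Ck_on n S f \<Longrightarrow> Ck_on n S g \<Longrightarrow> Ck_on n S (\<lambda>x. f x + g x)"
proof (induction n arbitrary: f g)
  case 0
  then show ?case by (auto intro: continuous_intros)
next
  case (Suc n)
  note f = Ck_on_SucE[OF Suc.prems(1,2)] and g = Ck_on_SucE[OF Suc.prems(1,3)]
  show ?case
    by (rule Ck_on_SucI[OF Suc.prems(1) has_derivative_add[OF f(1) g(1)]])
      (use Suc.IH[OF Suc.prems(1) f(2) g(2)] in auto)
qed

lemma Ck_on_mult:
  fixes f g :: "'a::real_normed_vector \<Rightarrow> real"
  shows "open S \<Longrightarrow> Ck_on n S f \<Longrightarrow> Ck_on n S g \<Longrightarrow> Ck_on n S (\<lambda>x. f x * g x)"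
proof (induction n arbitrary: f g)
  case 0
  then show ?case by (auto intro: continuous_intros)
next
  case (Suc n)
  note f = Ck_on_SucE[OF Suc.prems(1,2)] and g = Ck_on_SucE[OF Suc.prems(1,3)]
  note f' = Ck_on_SucD[OF Suc.prems(2)] and g' = Ck_on_SucD[OF Suc.prems(3)]
  show ?case
    by (rule Ck_on_SucI[OF Suc.prems(1) has_derivative_mult[OF f(1) g(1)]])
      (use Suc.IH[OF Suc.prems(1) f' g(2)] Suc.IH[OF Suc.prems(1) f(2) g'] Suc.prems in \<open>auto intro: Ck_on_add\<close>)
qed

lemma Ck_on_inverse:
  fixes f :: "'a::real_normed_vector \<Rightarrow> real"
  shows "open S \<Longrightarrow> Ck_on n S f \<Longrightarrow> (\<And>x. x \<in> S \<Longrightarrow> f x \<noteq> 0) \<Longrightarrow> Ck_on n S (\<lambda>x. inverse (f x))"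
proof (induction n arbitrary: f)
  case 0
  then show ?case by (auto intro!: continuous_intros)
next
  case (Suc n)
  note f = Ck_on_SucE[OF Suc.prems(1,2)]
  have i: "Ck_on n S (\<lambda>x. inverse (f x))"
    by (rule Suc.IH) (use Suc.prems Ck_on_SucD in auto)
  show ?case
  proof (rule Ck_on_SucI[OF Suc.prems(1)])
    show "((\<lambda>x. inverse (f x)) has_derivative
        (\<lambda>v. (-1) * (inverse (f x) * frechet_derivative f (at x) v * inverse (f x)))) (at x)" if "x \<in> S" for x
      using Deriv.has_derivative_inverse[OF Suc.prems(3)[OF that] f(1)[OF that]] by simp
    show "Ck_on n S (\<lambda>x. (-1) * (inverse (f x) * frechet_derivative f (at x) v * inverse (f x)))" for v
      using Suc.prems(1) i f(2) by (intro Ck_on_mult Ck_on_const)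
  qed
qed

lemma Ck_on_bounded_linear:
  assumes L: "bounded_linear L" and S: "open S"
  shows "Ck_on n S f \<Longrightarrow> Ck_on n S (\<lambda>x. L (f x))"
proof (induction n arbitrary: f)
  case 0
  then show ?case by (auto intro: bounded_linear.continuous_on[OF L])
next
  case (Suc n)
  note f = Ck_on_SucE[OF S Suc.prems]
  show ?case
    by (rule Ck_on_SucI[OF S bounded_linear.has_derivative[OF L f(1)]]) (use Suc.IH[OF f(2)] in auto)
qed

lemma smooth_onD: "smooth_on S f \<Longrightarrow> Ck_on n S f"
  by (simp add: smooth_on_def)

lemma smooth_on_cong: "open S \<Longrightarrow> (\<And>x. x \<in> S \<Longrightarrow> f x = g x) \<Longrightarrow> smooth_on S f \<longleftrightarrow> smooth_on S g"
  unfolding smooth_on_def using Ck_on_cong by blast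

lemma smooth_on_const: "open S \<Longrightarrow> smooth_on S (\<lambda>x. c)"
  by (simp add: smooth_on_def Ck_on_const)

lemma smooth_on_add: "open S \<Longrightarrow> smooth_on S f \<Longrightarrow> smooth_on S g \<Longrightarrow> smooth_on S (\<lambda>x. f x + g x)"
  by (simp add: smooth_on_def Ck_on_add)

lemma smooth_on_mult:
  fixes f g :: "'a::real_normed_vector \<Rightarrow> real"
  shows "open S \<Longrightarrow> smooth_on S f \<Longrightarrow> smooth_on S g \<Longrightarrow> smooth_on S (\<lambda>x. f x * g x)"
  by (simp add: smooth_on_def Ck_on_mult)

lemma smooth_on_inverse:
  fixes f :: "'a::real_normed_vector \<Rightarrow> real"
  shows "open S \<Longrightarrow> smooth_on S f \<Longrightarrow> (\<And>x. x \<in> S \<Longrightarrow> f x \<noteq> 0) \<Longrightarrow> smooth_on S (\<lambda>x. inverse (f x))"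
  by (simp add: smooth_on_def Ck_on_inverse)

lemma smooth_on_divide:
  fixes f g :: "'a::real_normed_vector \<Rightarrow> real"
  assumes "open S" "smooth_on S f" "smooth_on S g" "\<And>x. x \<in> S \<Longrightarrow> g x \<noteq> 0"
  shows "smooth_on S (\<lambda>x. f x / g x)"
  unfolding divide_inverse by (intro smooth_on_mult smooth_on_inverse assms)

lemma smooth_on_divide_const:
  fixes f :: "'a::real_normed_vector \<Rightarrow> real"
  assumes "open S" "smooth_on S f"
  shows "smooth_on S (\<lambda>x. f x / c)"
  unfolding divide_inverse by (intro smooth_on_mult smooth_on_const assms)

lemma smooth_on_bounded_linear:
  "bounded_linear L \<Longrightarrow> open S \<Longrightarrow> smooth_on S f \<Longrightarrow> smooth_on S (\<lambda>x. L (f x))"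
  by (simp add: smooth_on_def Ck_on_bounded_linear)

lemma smooth_on_sum:
  assumes "open S" "\<And>i. i \<in> I \<Longrightarrow> smooth_on S (f i)"
  shows "smooth_on S (\<lambda>x. \<Sum>i\<in>I. f i x)"
  using assms(2)
  by (induction I rule: infinite_finite_induct) (auto intro: smooth_on_add smooth_on_const assms(1))

lemma smooth_on_prod:
  fixes f :: "'i \<Rightarrow> 'a::real_normed_vector \<Rightarrow> real"
  assumes "open S" "\<And>i. i \<in> I \<Longrightarrow> smooth_on S (f i)"
  shows "smooth_on S (\<lambda>x. \<Prod>i\<in>I. f i x)"
  using assms(2)
  by (induction I rule: infinite_finite_induct) (auto intro: smooth_on_mult smooth_on_const assms(1))

lemma smooth_on_derivative: "smooth_on S f \<Longrightarrow> smooth_on S (\<lambda>x. frechet_derivative f (at x) v)"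
  unfolding smooth_on_def by (metis Ck_on.simps(2))

lemma smooth_on_has_derivative:
  "open S \<Longrightarrow> smooth_on S f \<Longrightarrow> x \<in> S \<Longrightarrow> (f has_derivative frechet_derivative f (at x)) (at x)"
  using Ck_on_SucE(1)[of S 0 f x] smooth_onD[of S f 1] by simp

lemma smooth_on_imp_continuous_on: "smooth_on S f \<Longrightarrow> continuous_on S f"
  using smooth_onD[of S f 0] by simp

text \<open>Both mixed derivatives are limits of the same second difference quotient.\<close>

lemma second_difference_mean_value:
  fixes F :: "'a::real_normed_vector \<Rightarrow> real"
  assumes S: "open S" and F: "Ck_on 2 S F" and h: "h > 0"
    and ball: "\<And>s t. 0 \<le> s \<Longrightarrow> s \<le> h \<Longrightarrow> 0 \<le> t \<Longrightarrow> t \<le> h \<Longrightarrow> x + s *\<^sub>R u + t *\<^sub>R v \<in> S"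
  shows "\<exists>s t. 0 \<le> s \<and> s \<le> h \<and> 0 \<le> t \<and> t \<le> h \<and>
    F (x + h *\<^sub>R u + h *\<^sub>R v) - F (x + h *\<^sub>R u) - F (x + h *\<^sub>R v) + F x =
    h * h * frechet_derivative (\<lambda>y. frechet_derivative F (at y) u) (at (x + s *\<^sub>R u + t *\<^sub>R v)) v"
proof -
  let ?D = "\<lambda>y. frechet_derivative F (at y)"
  have F': "Ck_on (Suc (Suc 0)) S F" using F by (simp add: numeral_2_eq_2)
  have d1: "(F has_derivative ?D y) (at y)" if "y \<in> S" for y
    using Ck_on_SucE(1)[OF S F' that] .
  have d2: "((\<lambda>y. ?D y u) has_derivative frechet_derivative (\<lambda>y. ?D y u) (at y)) (at y)" if "y \<in> S" for y
    using Ck_on_SucE(1)[OF S Ck_on_SucE(2)[OF S F'] that] .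
  have along: "((\<lambda>s. G (y + s *\<^sub>R w)) has_real_derivative G' w) (at s)"
    if "(G has_derivative G') (at (y + s *\<^sub>R w))" for G :: "'a \<Rightarrow> real" and G' y w s
  proof -
    have "((\<lambda>s. y + s *\<^sub>R w) has_derivative (\<lambda>r. r *\<^sub>R w)) (at s)"
      by (auto intro!: derivative_eq_intros)
    from has_derivative_compose[OF this that]
    have "((\<lambda>s. G (y + s *\<^sub>R w)) has_derivative (\<lambda>r. G' (r *\<^sub>R w))) (at s)" .
    moreover have "G' (r *\<^sub>R w) = r * G' w" for r
      using linear_cmul[OF has_derivative_linear[OF that], of r w] by simp
    ultimately show ?thesis by (simp add: has_field_derivative_def mult.commute[of _ "G' w"] )
  qed
  \<comment> \<open>The second difference is the increment over [0, h] of a first difference in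
    direction \<open>v\<close>. The mean value theorem in direction \<open>u\<close> is followed by
    one in direction \<open>v\<close>.\<close>
  define p where "p = (\<lambda>s. F ((x + h *\<^sub>R v) + s *\<^sub>R u) - F (x + s *\<^sub>R u))"
  have "(p has_real_derivative (?D ((x + h *\<^sub>R v) + s *\<^sub>R u) u - ?D (x + s *\<^sub>R u) u)) (at s)"
    if "0 \<le> s" "s \<le> h" for s
    unfolding p_def
    by (intro DERIV_diff along d1) (use ball[of s h] ball[of s 0] that h in \<open>auto simp: algebra_simps\<close>)
  then obtain s where s: "0 < s" "s < h"
    "p h - p 0 = (h - 0) * (?D ((x + h *\<^sub>R v) + s *\<^sub>R u) u - ?D (x + s *\<^sub>R u) u)"
    using MVT2[of 0 h p "\<lambda>s. ?D ((x + h *\<^sub>R v) + s *\<^sub>R u) u - ?D (x + s *\<^sub>R u) u"] h by auto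
  define q where "q = (\<lambda>t. ?D ((x + s *\<^sub>R u) + t *\<^sub>R v) u)"
  have "(q has_real_derivative frechet_derivative (\<lambda>y. ?D y u) (at ((x + s *\<^sub>R u) + t *\<^sub>R v)) v) (at t)"
    if "0 \<le> t" "t \<le> h" for t
    unfolding q_def by (intro along d2) (use ball[of s t] that s in auto)
  then obtain t where t: "0 < t" "t < h"
    "q h - q 0 = (h - 0) * frechet_derivative (\<lambda>y. ?D y u) (at ((x + s *\<^sub>R u) + t *\<^sub>R v)) v"
    using MVT2[of 0 h q "\<lambda>t. frechet_derivative (\<lambda>y. ?D y u) (at ((x + s *\<^sub>R u) + t *\<^sub>R v)) v"] h by auto
  have "F (x + h *\<^sub>R u + h *\<^sub>R v) - F (x + h *\<^sub>R u) - F (x + h *\<^sub>R v) + F x = p h - p 0"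
    by (simp add: p_def algebra_simps)
  also have "\<dots> = h * (q h - q 0)"
    using s(3) by (simp add: q_def algebra_simps)
  also have "\<dots> = h * h * frechet_derivative (\<lambda>y. ?D y u) (at (x + s *\<^sub>R u + t *\<^sub>R v)) v"
    using t(3) by simp
  finally show ?thesis
    using s(1,2) t(1,2) by (intro exI[of _ s] exI[of _ t]) auto
qed

lemma symmetric_second_derivative:
  fixes F :: "'a::real_normed_vector \<Rightarrow> real"
  assumes S: "open S" and F: "Ck_on 2 S F" and x: "x \<in> S"
  shows "frechet_derivative (\<lambda>y. frechet_derivative F (at y) u) (at x) v =
    frechet_derivative (\<lambda>y. frechet_derivative F (at y) v) (at x) u"
proof (rule ccontr)
  let ?A = "\<lambda>u v x. frechet_derivative (\<lambda>y. frechet_derivative F (at y) u) (at x) v"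
  assume ne: "?A u v x \<noteq> ?A v u x"
  \<comment> \<open>Half of the gap: no number can be closer than this to both values.\<close>
  define e where "e = \<bar>?A u v x - ?A v u x\<bar> / 2"
  have e: "e > 0" using ne by (simp add: e_def)
  have F': "Ck_on (Suc (Suc 0)) S F" using F by (simp add: numeral_2_eq_2)
  have cont: "continuous_on S (?A u v)" for u v
    using Ck_on_SucE(2)[OF S Ck_on_SucE(2)[OF S F']] by simp
  have "\<exists>d>0. \<forall>y\<in>ball x d. y \<in> S \<and> \<bar>?A u v y - ?A u v x\<bar> < e" for u v
  proof -
    obtain d1 where "d1 > 0" "ball x d1 \<subseteq> S" using S x open_contains_ball by blast
    moreover obtain d2 where "d2 > 0" "\<forall>y\<in>S. dist y x < d2 \<longrightarrow> dist (?A u v y) (?A u v x) < e"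
      using cont[of u v] e x unfolding continuous_on_iff by metis
    ultimately show ?thesis
      by (intro exI[of _ "min d1 d2"]) (auto simp: dist_real_def dist_commute subset_iff)
  qed
  then obtain d1 d2 where d1: "d1 > 0" "\<And>y. y \<in> ball x d1 \<Longrightarrow> y \<in> S \<and> \<bar>?A u v y - ?A u v x\<bar> < e"
    and d2: "d2 > 0" "\<And>y. y \<in> ball x d2 \<Longrightarrow> y \<in> S \<and> \<bar>?A v u y - ?A v u x\<bar> < e"
    by metis
  \<comment> \<open>Small enough for the parallelogram with sides h u and h v to lie in both balls;
    the summand 1 covers the case that \<open>u\<close> and \<open>v\<close> are 0.\<close>
  define h where "h = min d1 d2 / (2 * (norm u + norm v + 1))"
  have nz: "norm u + norm v + 1 > 0" by (simp add: add_nonneg_pos)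
  have h: "h > 0" using d1 d2 nz by (simp add: h_def)
  have near: "dist x (x + s *\<^sub>R a + t *\<^sub>R b) < min d1 d2"
    if "0 \<le> s" "s \<le> h" "0 \<le> t" "t \<le> h" "a = u \<and> b = v \<or> a = v \<and> b = u" for s t a b
  proof -
    have "dist x (x + s *\<^sub>R a + t *\<^sub>R b) = norm (s *\<^sub>R a + t *\<^sub>R b)"
      by (simp add: dist_norm norm_minus_commute[of x] algebra_simps flip: norm_minus_cancel[of "_ + _"])
    also have "\<dots> \<le> s * norm a + t * norm b"
      using norm_triangle_ineq[of "s *\<^sub>R a" "t *\<^sub>R b"] that by simp
    also have "\<dots> \<le> h * norm a + h * norm b"
      using that by (intro add_mono mult_right_mono) auto
    also have "\<dots> \<le> h * (norm u + norm v + 1)"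
      using that(5) h by (auto simp: algebra_simps)
    also have "\<dots> = min d1 d2 / 2"
      using nz by (simp add: h_def nonzero_divide_eq_eq eq_divide_eq)
    also have "\<dots> < min d1 d2"
      using d1(1) d2(1) by (auto simp: min_def)
    finally show ?thesis .
  qed
  obtain s t where st: "0 \<le> s" "s \<le> h" "0 \<le> t" "t \<le> h"
    "F (x + h *\<^sub>R u + h *\<^sub>R v) - F (x + h *\<^sub>R u) - F (x + h *\<^sub>R v) + F x = h * h * ?A u v (x + s *\<^sub>R u + t *\<^sub>R v)"
    using second_difference_mean_value[OF S F h, of x u v] near[of _ _ u v] d1(2) by auto
  obtain s' t' where st': "0 \<le> s'" "s' \<le> h" "0 \<le> t'" "t' \<le> h"
    "F (x + h *\<^sub>R v + h *\<^sub>R u) - F (x + h *\<^sub>R v) - F (x + h *\<^sub>R u) + F x = h * h * ?A v u (x + s' *\<^sub>R v + t' *\<^sub>R u)"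
    using second_difference_mean_value[OF S F h, of x v u] near[of _ _ v u] d1(2) by auto
  have "h * h * ?A u v (x + s *\<^sub>R u + t *\<^sub>R v) = h * h * ?A v u (x + s' *\<^sub>R v + t' *\<^sub>R u)"
    using st(5) st'(5) by (simp add: algebra_simps)
  then have "?A u v (x + s *\<^sub>R u + t *\<^sub>R v) = ?A v u (x + s' *\<^sub>R v + t' *\<^sub>R u)"
    using h by simp
  moreover have "\<bar>?A u v (x + s *\<^sub>R u + t *\<^sub>R v) - ?A u v x\<bar> < e"
    using d1(2)[of "x + s *\<^sub>R u + t *\<^sub>R v"] near[of s t u v] st by auto
  moreover have "\<bar>?A v u (x + s' *\<^sub>R v + t' *\<^sub>R u) - ?A v u x\<bar> < e"
    using d2(2)[of "x + s' *\<^sub>R v + t' *\<^sub>R u"] near[of s' t' v u] st' by auto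
  moreover have "False" if "A = B" "\<bar>A - a\<bar> < e" "\<bar>B - b\<bar> < e" "e = \<bar>a - b\<bar> / 2" for A B a b :: real
    using that by (auto simp: abs_if split: if_splits)
  ultimately show False using e_def by blast
qed

section \<open>The exterior derivative in coordinates\<close>

definition form_on :: "nat \<Rightarrow> (real ^ 6) set \<Rightarrow> (real ^ 6 \<Rightarrow> real mform) \<Rightarrow> bool" where
  "form_on k V a \<longleftrightarrow> (\<forall>x\<in>V. alternating k (a x)) \<and> (\<forall>v. smooth_on V (\<lambda>x. a x v))"

definition dirD :: "6 \<Rightarrow> (real ^ 6 \<Rightarrow> real mform) \<Rightarrow> real ^ 6 \<Rightarrow> real mform" where
  "dirD b a x = (\<lambda>v. frechet_derivative (\<lambda>y. a y v) (at x) (axis b 1))"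

definition coord :: "6 \<Rightarrow> real mform" where
  "coord b = (\<lambda>v. v 0 $ b)"

lemma form_on_alternating: "form_on k V a \<Longrightarrow> x \<in> V \<Longrightarrow> alternating k (a x)"
  and form_on_smooth: "form_on k V a \<Longrightarrow> smooth_on V (\<lambda>x. a x v)"
  by (auto simp: form_on_def)

lemma form_on_derivative:
  "open V \<Longrightarrow> form_on k V a \<Longrightarrow> x \<in> V \<Longrightarrow>
    ((\<lambda>y. a y v) has_derivative frechet_derivative (\<lambda>y. a y v) (at x)) (at x)"
  by (rule smooth_on_has_derivative) (auto intro: form_on_smooth)

lemma form_on_cong:
  assumes "open V" "\<And>x. x \<in> V \<Longrightarrow> a x = b x"
  shows "form_on k V a \<longleftrightarrow> form_on k V b"
proof -
  have "smooth_on V (\<lambda>x. a x v) \<longleftrightarrow> smooth_on V (\<lambda>x. b x v)" for v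
    by (rule smooth_on_cong) (use assms in auto)
  then show ?thesis using assms(2) by (simp add: form_on_def)
qed

lemma form_on_wedge:
  assumes "open V" "form_on p V a" "form_on q V b" "p + q = n"
  shows "form_on n V (\<lambda>x. wedge p q (a x) (b x))"
  unfolding form_on_def wedge_def[abs_def]
proof (intro conjI ballI allI)
  fix x assume "x \<in> V"
  then show "alternating n (\<lambda>v. (\<Sum>\<sigma> | \<sigma> permutes {..<p + q}.
       of_int (sign \<sigma>) * a x (\<lambda>i. v (\<sigma> i)) * b x (\<lambda>i. v (\<sigma> (p + i)))) / (fact p * fact q))"
    using alternating_wedge'[of p "a x" q "b x" n] assms(2-4) by (simp add: form_on_def wedge_def)
qed (auto intro!: smooth_on_divide_const smooth_on_sum smooth_on_mult smooth_on_const assms(1)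
    form_on_smooth[OF assms(2)] form_on_smooth[OF assms(3)])

lemma form_on_cmult: "open V \<Longrightarrow> form_on k V a \<Longrightarrow> form_on k V (\<lambda>x v. c * a x v)"
  by (auto simp: form_on_def intro!: alternating_cmult smooth_on_mult smooth_on_const)

lemma form_on_scale:
  "open V \<Longrightarrow> smooth_on V f \<Longrightarrow> form_on k V a \<Longrightarrow> form_on k V (\<lambda>x v. f x * a x v)"
  by (auto simp: form_on_def intro!: alternating_cmult smooth_on_mult)

lemma form_on_diff:
  assumes "open V" "form_on k V a" "form_on k V b"
  shows "form_on k V (\<lambda>x v. a x v - b x v)"
proof -
  have "smooth_on V (\<lambda>x. a x v + (-1) * b x v)" for v
    by (intro smooth_on_add smooth_on_mult smooth_on_const assms(1) form_on_smooth[OF assms(2)] form_on_smooth[OF assms(3)])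
  then show ?thesis using assms by (auto simp: form_on_def intro: alternating_diff)
qed

text \<open>Each clause of \<open>alternating\<close> is an identity valid throughout the open set,
  so it may be differentiated.\<close>

lemma alternating_derivative:
  assumes V: "open V" and a: "form_on k V a" and x: "x \<in> V"
  shows "alternating k (\<lambda>v. frechet_derivative (\<lambda>y. a y v) (at x) w)"
  unfolding alternating_def
proof (intro conjI allI impI)
  note alt = form_on_alternating[OF a]
  fix v v' :: "nat \<Rightarrow> real ^ 6" assume "\<forall>i<k. v i = v' i"
  then have "frechet_derivative (\<lambda>y. a y v) (at x) = frechet_derivative (\<lambda>y. a y v') (at x)"
    using alternating_cong[OF alt, of _ v v'] by (intro frechet_derivative_transform[OF V x]) auto
  then show "frechet_derivative (\<lambda>y. a y v) (at x) w = frechet_derivative (\<lambda>y. a y v') (at x) w" by simp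
next
  note alt = form_on_alternating[OF a]
  note der = form_on_derivative[OF V a x]
  fix i v assume i: "i < k"
  show "linear (\<lambda>u. frechet_derivative (\<lambda>y. a y (v(i := u))) (at x) w)"
  proof (rule linearI)
    fix u u' and c :: real
    have "frechet_derivative (\<lambda>y. a y (v(i := u + u'))) (at x) =
        frechet_derivative (\<lambda>y. a y (v(i := u)) + a y (v(i := u'))) (at x)"
      by (intro frechet_derivative_transform[OF V x] linear_add[OF alternating_slot_linear[OF alt i]])
    then show "frechet_derivative (\<lambda>y. a y (v(i := u + u'))) (at x) w =
        frechet_derivative (\<lambda>y. a y (v(i := u))) (at x) w + frechet_derivative (\<lambda>y. a y (v(i := u'))) (at x) w"
      by (simp add: frechet_derivative_eq[OF has_derivative_add[OF der der]])
    have "frechet_derivative (\<lambda>y. a y (v(i := c *\<^sub>R u))) (at x) =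
        frechet_derivative (\<lambda>y. c * a y (v(i := u))) (at x)"
    proof (rule frechet_derivative_transform[OF V x])
      fix y assume "y \<in> V"
      from linear_cmul[OF alternating_slot_linear[OF alt[OF this] i], of v c u]
      show "a y (v(i := c *\<^sub>R u)) = c * a y (v(i := u))" by simp
    qed
    then show "frechet_derivative (\<lambda>y. a y (v(i := c *\<^sub>R u))) (at x) w =
        c *\<^sub>R frechet_derivative (\<lambda>y. a y (v(i := u))) (at x) w"
      by (simp add: frechet_derivative_eq[OF has_derivative_mult_right[OF der]])
  qed
next
  fix v :: "nat \<Rightarrow> real ^ 6" and i j assume *: "i < j \<and> j < k \<and> v i = v j"
  have "frechet_derivative (\<lambda>y. a y v) (at x) = frechet_derivative (\<lambda>y. 0 :: real) (at x)"
    by (intro frechet_derivative_transform[OF V x] alternating_eq_0[OF form_on_alternating[OF a], of _ i j v])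
      (use * in auto)
  then show "frechet_derivative (\<lambda>y. a y v) (at x) w = 0" by simp
qed

lemma alternating_dirD: "open V \<Longrightarrow> form_on k V a \<Longrightarrow> x \<in> V \<Longrightarrow> alternating k (dirD b a x)"
  unfolding dirD_def by (rule alternating_derivative)

lemma alternating_1I: "linear (\<lambda>u. c (u ## zs)) \<Longrightarrow> (\<And>v. c v = c (v 0 ## zs)) \<Longrightarrow> alternating 1 c"
  unfolding One_nat_def
proof (rule alternatingI_Suc)
  assume *: "linear (\<lambda>u. c (u ## zs))" "\<And>v. c v = c (v 0 ## zs)"
  have eq: "c (u ## v) = c (u ## zs)" for u v using *(2)[of "u ## v"] by simp
  show "linear (\<lambda>u. c (u ## v))" for v using *(1) by (simp add: eq[of _ v])
  show "alternating 0 (iota u c)" for u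
    unfolding alternating_0_iff iota_def using eq by simp
qed simp

lemma alternating_linear_form: "linear L \<Longrightarrow> alternating 1 (\<lambda>v. L (v 0))"
  by (rule alternating_1I) simp_all

lemma alternating_coord [simp]: "alternating 1 (coord b)"
  unfolding coord_def by (rule alternating_linear_form) (simp add: linear_iff)

lemma linear_expand_axis:
  fixes L :: "real ^ 6 \<Rightarrow> real"
  assumes "linear L"
  shows "(\<Sum>b\<in>UNIV. u $ b * L (axis b 1)) = L u"
proof -
  have "L u = L (\<Sum>b\<in>UNIV. u $ b *\<^sub>R axis b 1)"
    by (simp add: basis_expansion flip: scalar_mult_eq_scaleR)
  also have "\<dots> = (\<Sum>b\<in>UNIV. u $ b * L (axis b 1))"
    by (simp add: linear_sum[OF assms] linear_cmul[OF assms])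
  finally show ?thesis by simp
qed

lemma ext_d_eq_drop_at:
  "ext_d k a x v = (\<Sum>i\<le>k. (-1) ^ i * frechet_derivative (\<lambda>y. a y (drop_at i v)) (at x) (v i))"
  by (simp add: ext_d_def drop_at_def)

text \<open>The classical da = \<Sum> dx_b \<and> \<partial>_b a. It makes the Leibniz rule a matter
  of associativity and commutativity of the wedge product.\<close>

lemma ext_d_wedge:
  assumes V: "open V" and a: "form_on k V a" and x: "x \<in> V"
  shows "ext_d k a x v = (\<Sum>b\<in>UNIV. wedge 1 k (coord b) (dirD b a x) v)"
proof -
  have lin: "linear (frechet_derivative (\<lambda>y. a y w) (at x))" for w
    using form_on_derivative[OF V a x] has_derivative_linear by blast
  have "(\<Sum>b\<in>UNIV. wedge 1 k (coord b) (dirD b a x) v) =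
      (\<Sum>b\<in>UNIV. \<Sum>i\<le>k. (-1) ^ i * (v i $ b * frechet_derivative (\<lambda>y. a y (drop_at i v)) (at x) (axis b 1)))"
    by (simp only: wedge_1_expand[OF alternating_coord alternating_dirD[OF V a x]])
      (simp add: coord_def dirD_def mult.assoc)
  also have "\<dots> = (\<Sum>i\<le>k. (-1) ^ i * (\<Sum>b\<in>UNIV. v i $ b * frechet_derivative (\<lambda>y. a y (drop_at i v)) (at x) (axis b 1)))"
    by (subst sum.swap) (simp add: sum_distrib_left)
  finally show ?thesis
    by (simp add: linear_expand_axis[OF lin] ext_d_eq_drop_at)
qed

lemma alternating_ext_d:
  assumes V: "open V" and a: "form_on k V a" and x: "x \<in> V"
  shows "alternating (Suc k) (ext_d k a x)"
proof -
  have "alternating (Suc k) (\<lambda>v. \<Sum>b\<in>UNIV. wedge 1 k (coord b) (dirD b a x) v)"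
    by (intro alternating_sum alternating_wedge'[OF alternating_coord alternating_dirD[OF V a x]]) simp
  then show ?thesis by (simp add: ext_d_wedge[OF V a x, abs_def])
qed

lemma form_on_ext_d:
  assumes V: "open V" and a: "form_on k V a"
  shows "form_on (Suc k) V (ext_d k a)"
  unfolding form_on_def
proof (intro conjI ballI allI)
  show "smooth_on V (\<lambda>x. ext_d k a x v)" for v
    unfolding ext_d_eq_drop_at
    by (intro smooth_on_sum smooth_on_mult smooth_on_const V smooth_on_derivative form_on_smooth[OF a])
qed (rule alternating_ext_d[OF V a])

lemma ext_d_cong:
  assumes "open V" "x \<in> V" "\<And>y. y \<in> V \<Longrightarrow> a y = b y"
  shows "ext_d k a x = ext_d k b x"
proof
  fix v
  have "frechet_derivative (\<lambda>y. a y w) (at x) = frechet_derivative (\<lambda>y. b y w) (at x)" for w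
    by (rule frechet_derivative_transform[OF assms(1,2)]) (simp add: assms(3))
  then show "ext_d k a x v = ext_d k b x v" by (simp add: ext_d_def)
qed

lemma ext_d_cmult:
  assumes V: "open V" and a: "form_on k V a" and x: "x \<in> V"
  shows "ext_d k (\<lambda>y v. c * a y v) x v = c * ext_d k a x v"
  unfolding ext_d_def
  by (simp add: frechet_derivative_eq[OF has_derivative_mult_right[OF form_on_derivative[OF V a x]]]
      sum_distrib_left ac_simps)

lemma has_derivative_wedge:
  assumes V: "open V" and a: "form_on p V a" and b: "form_on q V b" and x: "x \<in> V"
  shows "((\<lambda>y. wedge p q (a y) (b y) v) has_derivative
    (\<lambda>w. wedge p q (\<lambda>v. frechet_derivative (\<lambda>y. a y v) (at x) w) (b x) v +
      wedge p q (a x) (\<lambda>v. frechet_derivative (\<lambda>y. b y v) (at x) w) v)) (at x)"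
  unfolding wedge_def
  by (auto intro!: derivative_eq_intros form_on_derivative[OF V a x] form_on_derivative[OF V b x]
      simp: algebra_simps sum.distrib add_divide_distrib)

lemma dirD_wedge:
  assumes V: "open V" and a: "form_on p V a" and b: "form_on q V b" and x: "x \<in> V"
  shows "dirD c (\<lambda>y. wedge p q (a y) (b y)) x =
    (\<lambda>v. wedge p q (dirD c a x) (b x) v + wedge p q (a x) (dirD c b x) v)"
  by (simp add: dirD_def frechet_derivative_eq[OF has_derivative_wedge[OF assms]])

lemma ext_d_Leibniz:
  assumes V: "open V" and a: "form_on p V a" and b: "form_on q V b" and x: "x \<in> V"
  shows "ext_d (p + q) (\<lambda>y. wedge p q (a y) (b y)) x v =
    wedge (Suc p) q (ext_d p a x) (b x) v + (-1) ^ p * wedge p (Suc q) (a x) (ext_d q b x) v"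
proof -
  note ax = form_on_alternating[OF a x] and bx = form_on_alternating[OF b x]
  note da = alternating_dirD[OF V a x] and db = alternating_dirD[OF V b x]
  have 1: "wedge 1 (p + q) (coord c) (wedge p q (dirD c a x) (b x)) v =
      wedge (Suc p) q (wedge 1 p (coord c) (dirD c a x)) (b x) v" for c
    using wedge_assoc[OF alternating_coord da bx, of c c v] by (simp only: plus_1_eq_Suc)
  \<comment> \<open>Moving dx_c past \<open>a\<close> is the only source of the sign in the Leibniz
    rule.\<close>
  have cm: "wedge 1 p (coord c) (a x) = (\<lambda>v. (-1) ^ p * wedge p 1 (a x) (coord c) v)" for c
    using wedge_commute[OF alternating_coord ax] by auto
  have 2: "wedge 1 (p + q) (coord c) (wedge p q (a x) (dirD c b x)) v =
      (-1) ^ p * wedge p (Suc q) (a x) (wedge 1 q (coord c) (dirD c b x)) v" for c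
    using wedge_assoc[OF alternating_coord ax db, of c c v]
      wedge_assoc[OF ax alternating_coord db, of c c v] by (simp only: cm wedge_cmult_left plus_1_eq_Suc Suc_eq_plus1[symmetric])
  have "ext_d (p + q) (\<lambda>y. wedge p q (a y) (b y)) x v =
      (\<Sum>c\<in>UNIV. wedge 1 (p + q) (coord c) (wedge p q (dirD c a x) (b x)) v) +
      (\<Sum>c\<in>UNIV. wedge 1 (p + q) (coord c) (wedge p q (a x) (dirD c b x)) v)"
    unfolding ext_d_wedge[OF V form_on_wedge[OF V a b refl] x] dirD_wedge[OF V a b x]
    by (simp add: wedge_add_right sum.distrib)
  also have "\<dots> = wedge (Suc p) q (ext_d p a x) (b x) v + (-1) ^ p * wedge p (Suc q) (a x) (ext_d q b x) v"
    unfolding 1 2 ext_d_wedge[OF V a x, abs_def] ext_d_wedge[OF V b x, abs_def]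
    by (simp add: wedge_sum_left wedge_sum_right sum_distrib_left)
  finally show ?thesis .
qed

section \<open>Naturality of the exterior derivative\<close>

lemma form_on_iota: "open V \<Longrightarrow> form_on (Suc k) V F \<Longrightarrow> form_on k V (\<lambda>z. iota u (F z))"
  unfolding form_on_def iota_def using alternating_iota[unfolded iota_def] by blast

lemma upd_0_eq: "(v :: nat \<Rightarrow> 'a)(0 := u) = u ## (\<lambda>i. v (Suc i))"
  using vcons_upd_0[of "v 0" "\<lambda>i. v (Suc i)" u] by (simp add: vcons_eta)

lemma upd_Suc_eq: "(v :: nat \<Rightarrow> 'a)(Suc i := u) = v 0 ## (\<lambda>i. v (Suc i))(i := u)"
  using vcons_upd_Suc[of "v 0" "\<lambda>i. v (Suc i)" i u] by (simp add: vcons_eta)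

lemma alternating_expand_0:
  assumes "alternating (Suc k) a"
  shows "a v = (\<Sum>b\<in>UNIV. v 0 $ b * iota (axis b 1) a (\<lambda>i. v (Suc i)))"
  using fun_cong[OF iota_expand[OF assms, of "v 0"], of "\<lambda>i. v (Suc i)"]
  by (simp add: iota_def vcons_eta)

text \<open>Chain and product rule for a form whose arguments move with the base point. Smoothness
  of forms is given only for fixed arguments, so the first slot is expanded in coordinates and the
  others follow by induction on the degree.\<close>

lemma has_derivative_multilinear:
  fixes \<phi> :: "real ^ 6 \<Rightarrow> real ^ 6"
  assumes V: "open V" and x: "\<phi> x \<in> V" and \<phi>: "(\<phi> has_derivative \<phi>') (at x)"
  shows "form_on k V F \<Longrightarrow> (\<And>s. s < k \<Longrightarrow> ((\<lambda>y. M y s) has_derivative M' s) (at x)) \<Longrightarrow>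
    ((\<lambda>y. F (\<phi> y) (M y)) has_derivative
      (\<lambda>w. frechet_derivative (\<lambda>z. F z (M x)) (at (\<phi> x)) (\<phi>' w) + (\<Sum>s<k. F (\<phi> x) ((M x)(s := M' s w))))) (at x)"
proof -
  \<comment> \<open>\<open>F\<close> is alternating only over \<open>V\<close>, so functions are
    compared on a neighbourhood \<open>U\<close> of \<open>x\<close> that \<phi> maps into
    \<open>V\<close>.\<close>
  have "eventually (\<lambda>y. \<phi> y \<in> V) (at x)"
    using has_derivative_continuous[OF \<phi>] V x unfolding continuous_within by (rule topological_tendstoD)
  then have "eventually (\<lambda>y. \<phi> y \<in> V) (nhds x)"
    using x by (simp add: eventually_nhds_conv_at)
  then obtain U where U: "open U" "x \<in> U" "\<And>y. y \<in> U \<Longrightarrow> \<phi> y \<in> V"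
    by (auto simp: eventually_nhds)
  show "form_on k V F \<Longrightarrow> (\<And>s. s < k \<Longrightarrow> ((\<lambda>y. M y s) has_derivative M' s) (at x)) \<Longrightarrow>
    ((\<lambda>y. F (\<phi> y) (M y)) has_derivative
      (\<lambda>w. frechet_derivative (\<lambda>z. F z (M x)) (at (\<phi> x)) (\<phi>' w) + (\<Sum>s<k. F (\<phi> x) ((M x)(s := M' s w))))) (at x)"
  proof (induction k arbitrary: F M M')
    case 0
    have "((\<lambda>y. F (\<phi> y) (M x)) has_derivative (\<lambda>w. frechet_derivative (\<lambda>z. F z (M x)) (at (\<phi> x)) (\<phi>' w))) (at x)"
      by (rule has_derivative_compose[OF \<phi> form_on_derivative[OF V 0(1) x]])
    moreover have "F (\<phi> y) (M x) = F (\<phi> y) (M y)" if "y \<in> U" for y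
      using alternating_cong[OF form_on_alternating[OF 0(1) U(3)[OF that]], of "M x" "M y"] by simp
    ultimately show ?case
      using has_derivative_cong_open[OF U(1,2), of "\<lambda>y. F (\<phi> y) (M x)" "\<lambda>y. F (\<phi> y) (M y)"] by simp
  next
    case (Suc k)
    note alt = form_on_alternating[OF Suc.prems(1)]
    let ?T = "\<lambda>v i. v (Suc i)"
    let ?F = "\<lambda>b z. iota (axis b 1) (F z)"
    have tail: "((\<lambda>y. ?T (M y) s) has_derivative M' (Suc s)) (at x)" if "s < k" for s
      using Suc.prems(2)[of "Suc s"] that by simp
    have IH: "((\<lambda>y. ?F b (\<phi> y) (?T (M y))) has_derivative
        (\<lambda>w. frechet_derivative (\<lambda>z. ?F b z (?T (M x))) (at (\<phi> x)) (\<phi>' w) +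
          (\<Sum>s<k. ?F b (\<phi> x) ((?T (M x))(s := M' (Suc s) w))))) (at x)" for b
      by (rule Suc.IH[OF form_on_iota[OF V Suc.prems(1)] tail])
    have head: "((\<lambda>y. M y 0 $ b) has_derivative (\<lambda>w. M' 0 w $ b)) (at x)" for b
      using bounded_linear.has_derivative[OF bounded_linear_vec_nth Suc.prems(2)[of 0]] by simp
    let ?D = "\<lambda>w. \<Sum>b\<in>UNIV. M x 0 $ b * (frechet_derivative (\<lambda>z. ?F b z (?T (M x))) (at (\<phi> x)) (\<phi>' w) +
        (\<Sum>s<k. ?F b (\<phi> x) ((?T (M x))(s := M' (Suc s) w)))) + M' 0 w $ b * ?F b (\<phi> x) (?T (M x))"
    have "((\<lambda>y. \<Sum>b\<in>UNIV. M y 0 $ b * ?F b (\<phi> y) (?T (M y))) has_derivative ?D) (at x)"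
      by (intro has_derivative_sum has_derivative_mult head IH)
    moreover have "(\<Sum>b\<in>UNIV. M y 0 $ b * ?F b (\<phi> y) (?T (M y))) = F (\<phi> y) (M y)" if "y \<in> U" for y
      using alternating_expand_0[OF alt[OF U(3)[OF that]], of "M y"] by simp
    ultimately have der: "((\<lambda>y. F (\<phi> y) (M y)) has_derivative ?D) (at x)"
      using has_derivative_cong_open[OF U(1,2),
        of "\<lambda>y. \<Sum>b\<in>UNIV. M y 0 $ b * ?F b (\<phi> y) (?T (M y))" "\<lambda>y. F (\<phi> y) (M y)"] by simp
    have D: "?D w = frechet_derivative (\<lambda>z. F z (M x)) (at (\<phi> x)) (\<phi>' w) +
        (\<Sum>s<Suc k. F (\<phi> x) ((M x)(s := M' s w)))" for w
    proof -
      have "frechet_derivative (\<lambda>z. F z (M x)) (at (\<phi> x)) =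
          frechet_derivative (\<lambda>z. \<Sum>b\<in>UNIV. M x 0 $ b * ?F b z (?T (M x))) (at (\<phi> x))"
        by (intro frechet_derivative_transform[OF V x] alternating_expand_0[OF alt])
      also have "\<dots> = (\<lambda>w. \<Sum>b\<in>UNIV. M x 0 $ b * frechet_derivative (\<lambda>z. ?F b z (?T (M x))) (at (\<phi> x)) w)"
        by (intro frechet_derivative_eq has_derivative_sum has_derivative_mult_right
          form_on_derivative[OF V form_on_iota[OF V Suc.prems(1)] x])
      finally have 1: "frechet_derivative (\<lambda>z. F z (M x)) (at (\<phi> x)) (\<phi>' w) =
          (\<Sum>b\<in>UNIV. M x 0 $ b * frechet_derivative (\<lambda>z. ?F b z (?T (M x))) (at (\<phi> x)) (\<phi>' w))" by simp
      have 2: "F (\<phi> x) ((M x)(0 := M' 0 w)) = (\<Sum>b\<in>UNIV. M' 0 w $ b * ?F b (\<phi> x) (?T (M x)))"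
        using alternating_expand_0[OF alt[OF x], of "M' 0 w ## ?T (M x)"] by (simp add: upd_0_eq)
      have 3: "F (\<phi> x) ((M x)(Suc s := M' (Suc s) w)) =
          (\<Sum>b\<in>UNIV. M x 0 $ b * ?F b (\<phi> x) ((?T (M x))(s := M' (Suc s) w)))" for s
        using alternating_expand_0[OF alt[OF x], of "M x 0 ## (?T (M x))(s := M' (Suc s) w)"]
        by (simp only: upd_Suc_eq vcons_0 vcons_Suc)
      show ?thesis
        unfolding sum.lessThan_Suc_shift 1 2 3 sum.swap[of _ _ "{..<k}"]
        by (simp add: distrib_left sum.distrib sum_distrib_left)
    qed
    show ?case using der by (simp only: D)
  qed
qed

text \<open>The Hessian terms in the derivative of a pulled back form cancel because the Hessian is
  symmetric while the form is alternating.\<close>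

lemma symmetric_terms_cancel:
  fixes L :: "real ^ 6 \<Rightarrow> real ^ 6"
  assumes A: "alternating k A" and L: "linear L"
    and S: "\<And>w. linear (S w)" "\<And>u w. S u w = S w u"
  shows "(\<Sum>i\<le>k. (-1) ^ i * (\<Sum>s<k. A ((\<lambda>j. L (drop_at i v j))(s := S (v i) (drop_at i v s))))) = 0"
proof (cases k)
  case (Suc m)
  \<comment> \<open>Expanding the slot that contains \<open>S\<close> in coordinates
    \<open>d\<close> turns the inner sum into products of the 1-forms \<open>C b d\<close> with the
    pulled back interior products \<open>B d\<close>; the sum over \<open>i\<close> is then a
    product with coordinate 1-forms.\<close>
  define B where "B = (\<lambda>d. pull L (iota (axis d 1) A))"
  define C :: "6 \<Rightarrow> 6 \<Rightarrow> real mform" where "C = (\<lambda>b d v. S (axis b 1) (v 0) $ d)"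
  have B: "alternating m (B d)" for d
    unfolding B_def using A Suc by (intro alternating_pull[OF L] alternating_iota) simp
  have linC: "linear (\<lambda>u. S w u $ d)" for w d
    using linear_compose[OF S(1), of "\<lambda>z. z $ d" w] by (simp add: o_def linear_iff)
  have C: "alternating 1 (C b d)" for b d
    unfolding C_def by (rule alternating_linear_form[OF linC])
  define E :: "real ^ 6 \<Rightarrow> real mform" where "E = (\<lambda>w v. \<Sum>s<k. A ((\<lambda>j. L (v j))(s := S w (v s))))"
  have slot: "A ((\<lambda>j. L (v j))(s := y)) = (\<Sum>d\<in>UNIV. (-1) ^ s * y $ d * B d (drop_at s v))" if "s \<le> m" for s v y
  proof -
    have "(\<lambda>j. L (v j))(s := y) = insert_at s y (\<lambda>j. L (drop_at s v j))"
      by (auto simp: insert_at_def drop_at_def fun_eq_iff)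
    then have "A ((\<lambda>j. L (v j))(s := y)) = (-1) ^ s * A (y ## (\<lambda>j. L (drop_at s v j)))"
      using alternating_insert_at[OF A[unfolded Suc] that] by simp
    also have "\<dots> = (\<Sum>d\<in>UNIV. (-1) ^ s * y $ d * B d (drop_at s v))"
      using alternating_expand_0[OF A[unfolded Suc], of "y ## (\<lambda>j. L (drop_at s v j))"]
      by (simp add: B_def pull_def sum_distrib_left mult.assoc)
    finally show ?thesis .
  qed
  have E: "E (axis b 1) v = (\<Sum>d\<in>UNIV. wedge 1 m (C b d) (B d) v)" for b v
  proof -
    have "E (axis b 1) v = (\<Sum>s\<le>m. \<Sum>d\<in>UNIV. (-1) ^ s * S (axis b 1) (v s) $ d * B d (drop_at s v))"
      unfolding E_def Suc lessThan_Suc_atMost by (rule sum.cong) (simp_all add: slot)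
    also have "\<dots> = (\<Sum>d\<in>UNIV. wedge 1 m (C b d) (B d) v)"
      by (subst sum.swap) (simp only: wedge_1_expand[OF C B], simp add: C_def)
    finally show ?thesis .
  qed
  have linE: "linear (\<lambda>w. E w v)" for v
  proof -
    have lin: "linear (\<lambda>w. S w u)" for u using S(1)[of u] by (simp add: S(2)[of _ u])
    have "linear (\<lambda>w. A ((\<lambda>j. L (v j))(s := S w (v s))))" if "s < k" for s
      using linear_compose[OF lin alternating_slot_linear[OF A that]] by (simp add: o_def)
    then show ?thesis unfolding E_def by (intro linear_compose_sum) auto
  qed
  have altE: "alternating k (E (axis b 1))" for b
  proof -
    have "alternating k (\<lambda>v. \<Sum>d\<in>UNIV. wedge 1 m (C b d) (B d) v)"
      using Suc by (intro alternating_sum alternating_wedge'[OF C B]) simp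
    then show ?thesis by (simp only: E[abs_def])
  qed
  \<comment> \<open>This is the antisymmetrisation of the symmetric map \<open>S\<close>;
    associativity makes it a factor of the whole sum.\<close>
  have zero: "(\<Sum>b\<in>UNIV. wedge 1 1 (coord b) (C b d) v) = 0" for d v
  proof -
    obtain u w where v: "v = u ## w" by (rule seq_cases)
    have "wedge 1 1 (coord b) (C b d) v = u $ b * S (axis b 1) (w 0) $ d - w 0 $ b * S (axis b 1) u $ d" for b
      using wedge_1_expand[OF alternating_coord C, of b b d v] by (simp add: coord_def C_def v)
    then have "(\<Sum>b\<in>UNIV. wedge 1 1 (coord b) (C b d) v) =
        (\<Sum>b\<in>UNIV. u $ b * S (w 0) (axis b 1) $ d) - (\<Sum>b\<in>UNIV. w 0 $ b * S u (axis b 1) $ d)"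
      by (simp add: sum_subtractf S(2)[of "axis _ 1"])
    also have "\<dots> = 0"
      using linear_expand_axis[OF linC, of "w 0" u d] linear_expand_axis[OF linC, of u "w 0" d] S(2)[of u "w 0"]
      by simp
    finally show ?thesis .
  qed
  have "(\<Sum>i\<le>k. (-1) ^ i * E (v i) (drop_at i v)) =
      (\<Sum>i\<le>k. (-1) ^ i * (\<Sum>b\<in>UNIV. v i $ b * E (axis b 1) (drop_at i v)))"
    by (simp add: linear_expand_axis[OF linE])
  also have "\<dots> = (\<Sum>b\<in>UNIV. wedge 1 k (coord b) (E (axis b 1)) v)"
    by (simp only: wedge_1_expand[OF alternating_coord altE])
      (simp add: coord_def sum_distrib_left sum.swap[of _ _ UNIV] mult.assoc)
  also have "\<dots> = (\<Sum>d\<in>UNIV. \<Sum>b\<in>UNIV. wedge 1 k (coord b) (wedge 1 m (C b d) (B d)) v)"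
    by (simp only: E[abs_def] wedge_sum_right) (rule sum.swap)
  also have "\<dots> = (\<Sum>d\<in>UNIV. \<Sum>b\<in>UNIV. wedge (1 + 1) m (wedge 1 1 (coord b) (C b d)) (B d) v)"
    unfolding Suc using wedge_assoc[OF alternating_coord C B] by simp
  also have "\<dots> = 0"
    by (simp only: wedge_sum_left[symmetric] zero) simp
  finally show ?thesis by (simp add: E_def)
qed simp

text \<open>Differentiating the coefficients of \<open>F\<close> gives the right-hand side.
  Differentiating the arguments gives terms with second derivatives of \<phi>, which
  \<open>symmetric_terms_cancel\<close> removes.\<close>

lemma ext_d_pull:
  assumes U: "open U" and V: "open V" and \<phi>: "smooth_on U \<phi>" "\<phi> ` U \<subseteq> V"
    and F: "form_on k V F" and x: "x \<in> U"
  shows "ext_d k (\<lambda>y. pull (frechet_derivative \<phi> (at y)) (F (\<phi> y))) x =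
    pull (frechet_derivative \<phi> (at x)) (ext_d k F (\<phi> x))"
proof
  fix v
  define L where "L = (\<lambda>y. frechet_derivative \<phi> (at y))"
  define S where "S = (\<lambda>w u. frechet_derivative (\<lambda>y. L y u) (at x) w)"
  have Lv: "frechet_derivative \<phi> (at y) = L y" for y by (simp add: L_def)
  have phi: "\<phi> x \<in> V" using \<phi>(2) x by auto
  have L: "(\<phi> has_derivative L y) (at y)" if "y \<in> U" for y
    unfolding L_def by (rule smooth_on_has_derivative[OF U \<phi>(1) that])
  have Lu: "((\<lambda>y. L y u) has_derivative (\<lambda>w. S w u)) (at x)" for u
    unfolding L_def S_def by (rule smooth_on_has_derivative[OF U smooth_on_derivative[OF \<phi>(1)] x])
  \<comment> \<open>Symmetry of second derivatives was proved for real functions, hence the passage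
    to the components of \<phi>.\<close>
  have sym: "S u w = S w u" for u w
  proof (subst vec_eq_iff, intro allI)
    fix d
    have vn: "bounded_linear (\<lambda>z :: real ^ 6. z $ d)" by (rule bounded_linear_vec_nth)
    have comp: "frechet_derivative (\<lambda>z. \<phi> z $ d) (at y) = (\<lambda>u. L y u $ d)" if "y \<in> U" for y
      by (rule frechet_derivative_eq[OF bounded_linear.has_derivative[OF vn L[OF that]]])
    have "frechet_derivative (\<lambda>y. frechet_derivative (\<lambda>z. \<phi> z $ d) (at y) u) (at x) = (\<lambda>w. S w u $ d)" for u
    proof -
      have "frechet_derivative (\<lambda>y. frechet_derivative (\<lambda>z. \<phi> z $ d) (at y) u) (at x) =
          frechet_derivative (\<lambda>y. L y u $ d) (at x)"
        by (rule frechet_derivative_transform[OF U x]) (simp add: comp)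
      also have "\<dots> = (\<lambda>w. S w u $ d)"
        by (rule frechet_derivative_eq[OF bounded_linear.has_derivative[OF vn Lu]])
      finally show ?thesis .
    qed
    then show "S u w $ d = S w u $ d"
      using symmetric_second_derivative[OF U smooth_onD[OF smooth_on_bounded_linear[OF vn U \<phi>(1)]] x, of w u]
      by simp
  qed
  have der: "frechet_derivative (\<lambda>y. F (\<phi> y) (\<lambda>s. L y (u s))) (at x) w =
      frechet_derivative (\<lambda>z. F z (\<lambda>s. L x (u s))) (at (\<phi> x)) (L x w) +
        (\<Sum>s<k. F (\<phi> x) ((\<lambda>s. L x (u s))(s := S w (u s))))" for u w
    by (subst frechet_derivative_eq[OF has_derivative_multilinear[where M = "\<lambda>y s. L y (u s)" and M' = "\<lambda>s w. S w (u s)", OF V phi L[OF x] F Lu]]) (rule refl)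
  have linS: "linear (S w)" for w
    using has_derivative_linear[OF Lu[of w]] by (simp add: sym[of _ w])
  have drop: "drop_at i (\<lambda>i. L x (v i)) = (\<lambda>s. L x (drop_at i v s))" for i
    by (auto simp: drop_at_def)
  have "ext_d k (\<lambda>y. pull (L y) (F (\<phi> y))) x v =
      (\<Sum>i\<le>k. (-1) ^ i * frechet_derivative (\<lambda>z. F z (\<lambda>s. L x (drop_at i v s))) (at (\<phi> x)) (L x (v i))) +
      (\<Sum>i\<le>k. (-1) ^ i * (\<Sum>s<k. F (\<phi> x) ((\<lambda>s. L x (drop_at i v s))(s := S (v i) (drop_at i v s)))))"
    unfolding ext_d_eq_drop_at pull_def der by (simp add: distrib_left sum.distrib)
  also have "(\<Sum>i\<le>k. (-1) ^ i * (\<Sum>s<k. F (\<phi> x) ((\<lambda>s. L x (drop_at i v s))(s := S (v i) (drop_at i v s))))) = 0"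
    by (rule symmetric_terms_cancel[OF form_on_alternating[OF F phi] has_derivative_linear[OF L[OF x]] linS sym])
  finally show "ext_d k (\<lambda>y. pull (frechet_derivative \<phi> (at y)) (F (\<phi> y))) x v =
    pull (frechet_derivative \<phi> (at x)) (ext_d k F (\<phi> x)) v"
    by (simp add: ext_d_eq_drop_at pull_def drop Lv)
qed

section \<open>Smooth dependence of the inner product and the star on the point\<close>

lemma smooth_on_det:
  fixes A :: "'a::real_normed_vector \<Rightarrow> real ^ 'n ^ 'n"
  assumes "open V" "\<And>i j. smooth_on V (\<lambda>x. A x $ i $ j)"
  shows "smooth_on V (\<lambda>x. det (A x))"
  unfolding det_def by (intro smooth_on_sum smooth_on_mult smooth_on_prod smooth_on_const assms)

text \<open>Cramer's rule writes an entry of the inverse Gram matrix as a quotient of determinants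
  with smooth entries.\<close>

lemma smooth_on_cometric:
  assumes V: "open V" and g: "\<And>x. x \<in> V \<Longrightarrow> inner_form (g x)" "\<And>x. x \<in> V \<Longrightarrow> \<exists>fs. orthoframe (g x) fs"
    and smooth: "\<And>u v. smooth_on V (\<lambda>x. g x u v)"
  shows "smooth_on V (\<lambda>x. cometric (g x) $ i $ j)"
proof -
  let ?G = "\<lambda>x. \<chi> i j. g x (axis i 1) (axis j 1)"
  \<comment> \<open>The Gram matrix with column \<open>i\<close> replaced by the unit vector
    \<open>axis j 1\<close>.\<close>
  let ?H = "\<lambda>x. \<chi> k l. if l = i then axis j 1 $ k else ?G x $ k $ l"
  have inv: "?G x ** cometric (g x) = mat 1" if "x \<in> V" for x
    using cometric_frame(2) g that by blast
  have det: "det (?G x) \<noteq> 0" if "x \<in> V" for x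
    using arg_cong[OF inv[OF that], of det] by (auto simp: det_mul)
  have "det (?H x) / det (?G x) = cometric (g x) $ i $ j" if "x \<in> V" for x
  proof -
    have "?G x *v column j (cometric (g x)) = column j (?G x ** cometric (g x))"
      by (simp add: column_def matrix_matrix_mult_def matrix_vector_mult_def vec_eq_iff)
    also have "\<dots> = axis j 1"
      unfolding inv[OF that] by (simp add: column_def mat_def axis_def vec_eq_iff eq_commute)
    finally have "column j (cometric (g x)) =
        (\<chi> k. det (\<chi> a b. if b = k then axis j 1 $ a else ?G x $ a $ b) / det (?G x))"
      using cramer[OF det[OF that]] by blast
    then have "column j (cometric (g x)) $ i = det (?H x) / det (?G x)" by simp
    then show ?thesis by (simp add: column_def)
  qed
  moreover have "smooth_on V (\<lambda>x. det (?H x) / det (?G x))"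
  proof (intro smooth_on_divide smooth_on_det V det)
    show "smooth_on V (\<lambda>x. ?H x $ k $ l)" for k l
      by (cases "l = i") (simp_all add: smooth smooth_on_const[OF V])
  qed (simp_all add: smooth)
  ultimately show ?thesis
    using smooth_on_cong[OF V, of "\<lambda>x. det (?H x) / det (?G x)" "\<lambda>x. cometric (g x) $ i $ j"] by blast
qed

lemma smooth_on_form_inner:
  assumes V: "open V" and g: "\<And>x. x \<in> V \<Longrightarrow> inner_form (g x)" "\<And>x. x \<in> V \<Longrightarrow> \<exists>fs. orthoframe (g x) fs"
    and smooth: "\<And>u v. smooth_on V (\<lambda>x. g x u v)"
    and a: "\<And>v. smooth_on V (\<lambda>x. a x v)" and b: "\<And>v. smooth_on V (\<lambda>x. b x v)"
  shows "smooth_on V (\<lambda>x. form_inner (g x) k (a x) (b x))"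
  unfolding form_inner_def
  by (intro smooth_on_divide_const smooth_on_sum smooth_on_mult smooth_on_prod V a b
      smooth_on_cometric[OF V g smooth]) auto

lemma form_on_hodge_pt:
  assumes V: "open V" and g: "\<And>x. x \<in> V \<Longrightarrow> inner_form (g x)" "\<And>x. x \<in> V \<Longrightarrow> \<exists>fs. orthoframe (g x) fs"
    and smooth: "\<And>u v. smooth_on V (\<lambda>x. g x u v)"
    and w: "form_on 6 V w" "\<And>x. x \<in> V \<Longrightarrow> \<exists>e. w x e \<noteq> 0"
    and k: "k \<le> 6" and b: "form_on k V b"
  shows "form_on (6 - k) V (\<lambda>x. hodge_pt (g x) (w x) k (b x))"
  unfolding form_on_def
proof (intro conjI ballI allI)
  fix x assume x: "x \<in> V"
  obtain fs e where "orthoframe (g x) fs" "w x e \<noteq> 0" using g(2)[OF x] w(2)[OF x] by auto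
  then show "alternating (6 - k) (hodge_pt (g x) (w x) k (b x))"
    by (rule alternating_hodge_pt[OF g(1)[OF x] _ form_on_alternating[OF w(1) x] _ k form_on_alternating[OF b x]])
next
  fix v
  have "form_inner (g x) k (b x) (\<lambda>u. w x (\<lambda>i. if i < k then u i else v (i - k))) =
      hodge_pt (g x) (w x) k (b x) v" if x: "x \<in> V" for x
  proof -
    obtain fs e where fs: "orthoframe (g x) fs" and e: "w x e \<noteq> 0" using g(2)[OF x] w(2)[OF x] by auto
    show ?thesis
      by (rule hodge_pt_append[OF g(1)[OF x] fs form_on_alternating[OF w(1) x] e k form_on_alternating[OF b x], symmetric])
  qed
  moreover have "smooth_on V (\<lambda>x. form_inner (g x) k (b x) (\<lambda>u. w x (\<lambda>i. if i < k then u i else v (i - k))))"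
    by (rule smooth_on_form_inner[OF V g smooth form_on_smooth[OF b] form_on_smooth[OF w(1)]])
  ultimately show "smooth_on V (\<lambda>x. hodge_pt (g x) (w x) k (b x) v)"
    using smooth_on_cong[OF V, of "\<lambda>x. form_inner (g x) k (b x) (\<lambda>u. w x (\<lambda>i. if i < k then u i else v (i - k)))"
        "\<lambda>x. hodge_pt (g x) (w x) k (b x) v"] by blast
qed

section \<open>SU(3)-structures on a vector space\<close>

lemma iota_apply: "iota u a v = a (u ## v)"
  by (simp add: iota_def)

lemma pull_apply: "pull L a (u ## v) = a (L u ## (\<lambda>i. L (v i)))"
  by (simp add: pull_def vcons_comp)

lemma alternating_minus_2:
  "alternating (Suc (Suc k)) a \<Longrightarrow> a (x ## (- u) ## v) = - a (x ## u ## v)"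
  using alternating_minus[OF alternating_iota, of k a x u v] by (simp add: iota_def)

lemma alternating_sort:
  fixes f :: "int \<Rightarrow> real ^ 6"
  shows "alternating (Suc (Suc k)) a \<Longrightarrow> j < i \<Longrightarrow> a (f i ## f j ## v) = - a (f j ## f i ## v)"
  by (rule alternating_swap)

text \<open>\<open>Op\<close> and \<open>Om\<close> are the real and imaginary part of \<open>\<Omega>\<close>, whose value on \<open>f\<^sub>0, f\<^sub>2, f\<^sub>4\<close> is \<open>p + i q\<close>.
  The frame is indexed by integers because degrees, which are natural numbers, have to be rewritten to
  successor terms.\<close>

locale su3_frame =
  fixes g :: "real ^ 6 \<Rightarrow> real ^ 6 \<Rightarrow> real" and J :: "real ^ 6 \<Rightarrow> real ^ 6"
    and Op Om :: "real mform" and f :: "int \<Rightarrow> real ^ 6" and p q :: real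
  assumes g: "inner_form g" and J: "linear J" and J_J: "\<And>v. J (J v) = - v"
    and g_J: "\<And>u v. g (J u) (J v) = g u v"
    and g_f: "\<And>i j. i \<in> {0..5} \<Longrightarrow> j \<in> {0..5} \<Longrightarrow> g (f i) (f j) = (if i = j then 1 else 0)"
    and Jf: "J (f 0) = f 1" "J (f 2) = f 3" "J (f 4) = f 5"
    and Op: "alternating 3 Op" and Om: "alternating 3 Om"
    and Op_J: "\<And>u v. Op (J u ## v) = - Om (u ## v)"
    and Om_J: "\<And>u v. Om (J u ## v) = Op (u ## v)"
    and Op_024: "\<And>v. Op (f 0 ## f 2 ## f 4 ## v) = p"
    and Om_024: "\<And>v. Om (f 0 ## f 2 ## f 4 ## v) = q"
begin

abbreviation "fs \<equiv> [f 0, f 1, f 2, f 3, f 4, f 5]"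

lemma frame: "orthoframe g fs"
  unfolding orthoframe_def
proof (intro conjI allI impI)
  have *: "fs ! i = f (int i)" if "i < 6" for i
  proof -
    have "i \<in> {0, 1, 2, 3, 4, 5}" using that by auto
    then show ?thesis by (elim insertE) auto
  qed
  fix i j :: nat assume "i < 6" "j < 6"
  then show "g (fs ! i) (fs ! j) = (if i = j then 1 else 0)"
    using g_f[of "int i" "int j"] * by simp
qed simp

definition om :: "real mform" where "om v = g (J (v 0)) (v 1)"
definition om2 :: "real mform" where "om2 = wedge 2 2 om om"
definition vol :: "real mform" where "vol v = wedge 4 2 om2 om v / 6"

abbreviation "star \<equiv> hodge_pt g vol"

lemma Jf': "J (f 1) = - f 0" "J (f 3) = - f 2" "J (f 5) = - f 4"
  using J_J[of "f 0"] J_J[of "f 2"] J_J[of "f 4"] by (simp_all add: Jf)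

lemma J_0 [simp]: "J 0 = 0"
  by (rule linear_0[OF J])

lemmas Op3 = Op[unfolded numeral_3_eq_3] and Om3 = Om[unfolded numeral_3_eq_3]

text \<open>\<Omega> is complex linear in its first slot by assumption and, being alternating, in
  the other two as well.\<close>

lemma Op_J': "Op (u ## J v ## y) = - Om (u ## v ## y)" "Op (u ## v ## J w ## x) = - Om (u ## v ## w ## x)"
  and Om_J': "Om (u ## J v ## y) = Op (u ## v ## y)" "Om (u ## v ## J w ## x) = Op (u ## v ## w ## x)"
proof -
  have 1: "Op (u ## J v ## w) = - Om (u ## v ## w)" "Om (u ## J v ## w) = Op (u ## v ## w)" for u v w
    using alternating_swap[OF Op3, of u "J v" w] alternating_swap[OF Om3, of u "J v" w]
      alternating_swap[OF Op3, of u "v" w] alternating_swap[OF Om3, of u "v" w]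
    by (simp_all add: Op_J Om_J)
  then show "Op (u ## J v ## y) = - Om (u ## v ## y)" "Om (u ## J v ## y) = Op (u ## v ## y)" by auto
  show "Op (u ## v ## J w ## x) = - Om (u ## v ## w ## x)" "Om (u ## v ## J w ## x) = Op (u ## v ## w ## x)"
    using alternating_swap[OF alternating_iota[OF Op3], of u v "J w" x]
      alternating_swap[OF alternating_iota[OF Om3], of u v "J w" x]
      alternating_swap[OF alternating_iota[OF Op3], of u v "w" x]
      alternating_swap[OF alternating_iota[OF Om3], of u v "w" x]
    by (simp_all add: iota_def 1)
qed

lemma Op_repeat: "Op (u ## u ## x) = 0" "Op (u ## v ## v ## w) = 0"
  and Om_repeat: "Om (u ## u ## x) = 0" "Om (u ## v ## v ## w) = 0"
  using alternating_repeat[OF Op3] alternating_repeat[OF Om3]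
    alternating_repeat[OF alternating_iota[OF Op3]] alternating_repeat[OF alternating_iota[OF Om3]]
  by (simp_all add: iota_def)

text \<open>The components of the real part of (p + i q) dz1 \<and> dz2 \<and> dz3. Odd frame
  vectors are rewritten as \<open>J\<close> of the preceding even ones, each contributing a factor
  i; if both members of such a pair occur, the value is 0.\<close>

lemma Op_f: "Op (f 0 ## f 1 ## f 2 ## v) = 0"
    "Op (f 0 ## f 1 ## f 3 ## v) = 0"
    "Op (f 0 ## f 1 ## f 4 ## v) = 0"
    "Op (f 0 ## f 1 ## f 5 ## v) = 0"
    "Op (f 0 ## f 2 ## f 3 ## v) = 0"
    "Op (f 0 ## f 2 ## f 4 ## v) = p"
    "Op (f 0 ## f 2 ## f 5 ## v) = - q"
    "Op (f 0 ## f 3 ## f 4 ## v) = - q"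
    "Op (f 0 ## f 3 ## f 5 ## v) = - p"
    "Op (f 0 ## f 4 ## f 5 ## v) = 0"
    "Op (f 1 ## f 2 ## f 3 ## v) = 0"
    "Op (f 1 ## f 2 ## f 4 ## v) = - q"
    "Op (f 1 ## f 2 ## f 5 ## v) = - p"
    "Op (f 1 ## f 3 ## f 4 ## v) = - p"
    "Op (f 1 ## f 3 ## f 5 ## v) = q"
    "Op (f 1 ## f 4 ## f 5 ## v) = 0"
    "Op (f 2 ## f 3 ## f 4 ## v) = 0"
    "Op (f 2 ## f 3 ## f 5 ## v) = 0"
    "Op (f 2 ## f 4 ## f 5 ## v) = 0"
    "Op (f 3 ## f 4 ## f 5 ## v) = 0"
  by (simp_all add: Op_J Om_J Op_J' Om_J' Op_repeat Om_repeat Op_024 Om_024 flip: Jf)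

lemma Om_f: "Om (f 0 ## f 1 ## f 2 ## v) = 0"
    "Om (f 0 ## f 1 ## f 3 ## v) = 0"
    "Om (f 0 ## f 1 ## f 4 ## v) = 0"
    "Om (f 0 ## f 1 ## f 5 ## v) = 0"
    "Om (f 0 ## f 2 ## f 3 ## v) = 0"
    "Om (f 0 ## f 2 ## f 4 ## v) = q"
    "Om (f 0 ## f 2 ## f 5 ## v) = p"
    "Om (f 0 ## f 3 ## f 4 ## v) = p"
    "Om (f 0 ## f 3 ## f 5 ## v) = - q"
    "Om (f 0 ## f 4 ## f 5 ## v) = 0"
    "Om (f 1 ## f 2 ## f 3 ## v) = 0"
    "Om (f 1 ## f 2 ## f 4 ## v) = p"
    "Om (f 1 ## f 2 ## f 5 ## v) = - q"
    "Om (f 1 ## f 3 ## f 4 ## v) = - q"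
    "Om (f 1 ## f 3 ## f 5 ## v) = - p"
    "Om (f 1 ## f 4 ## f 5 ## v) = 0"
    "Om (f 2 ## f 3 ## f 4 ## v) = 0"
    "Om (f 2 ## f 3 ## f 5 ## v) = 0"
    "Om (f 2 ## f 4 ## f 5 ## v) = 0"
    "Om (f 3 ## f 4 ## f 5 ## v) = 0"
  by (simp_all add: Op_J Om_J Op_J' Om_J' Op_repeat Om_repeat Op_024 Om_024 flip: Jf)

lemma alternating_om: "alternating 2 om"
  unfolding numeral_2_eq_2
proof (intro alternatingI_Suc)
  have bil: "bilinear g" and sym: "\<And>u v. g u v = g v u" using g by (auto simp: inner_form_def)
  show "linear (\<lambda>u. om (u ## v))" for v
    using linear_compose[OF J, of "\<lambda>u. g u (v 0)"] bil by (simp add: om_def bilinear_def o_def)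
  show "linear (\<lambda>ua. iota u om (ua ## v))" for u v
    using bil by (simp add: om_def iota_def bilinear_def)
  show "alternating 0 (iota u (iota v om))" for u v
    by (simp add: alternating_0_iff om_def iota_def)
  show "om (u ## u ## v) = 0" for u v
  proof -
    have "g (J u) u = g (J (J u)) (J u)" by (simp add: g_J)
    also have "\<dots> = - g (J u) u" by (simp add: J_J bilinear_lneg[OF bil] sym[of u])
    finally show ?thesis by (simp add: om_def)
  qed
qed auto

lemmas om22 = alternating_om[unfolded numeral_2_eq_2]

lemma om_f: "om (f 0 ## f 1 ## v) = 1"
    "om (f 0 ## f 2 ## v) = 0"
    "om (f 0 ## f 3 ## v) = 0"
    "om (f 0 ## f 4 ## v) = 0"
    "om (f 0 ## f 5 ## v) = 0"
    "om (f 1 ## f 2 ## v) = 0"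
    "om (f 1 ## f 3 ## v) = 0"
    "om (f 1 ## f 4 ## v) = 0"
    "om (f 1 ## f 5 ## v) = 0"
    "om (f 2 ## f 3 ## v) = 1"
    "om (f 2 ## f 4 ## v) = 0"
    "om (f 2 ## f 5 ## v) = 0"
    "om (f 3 ## f 4 ## v) = 0"
    "om (f 3 ## f 5 ## v) = 0"
    "om (f 4 ## f 5 ## v) = 1"
  by (simp_all add: om_def Jf Jf' g_f bilinear_lneg[of g] g[unfolded inner_form_def])

lemmas wedge_ev = wedge_iota_Suc wedge_0_left wedge_0_right alternating_iota iota_apply

lemma om2_f: "om2 (f 0 ## f 1 ## f 2 ## f 3 ## v) = 2"
    "om2 (f 0 ## f 1 ## f 2 ## f 4 ## v) = 0"
    "om2 (f 0 ## f 1 ## f 2 ## f 5 ## v) = 0"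
    "om2 (f 0 ## f 1 ## f 3 ## f 4 ## v) = 0"
    "om2 (f 0 ## f 1 ## f 3 ## f 5 ## v) = 0"
    "om2 (f 0 ## f 1 ## f 4 ## f 5 ## v) = 2"
    "om2 (f 0 ## f 2 ## f 3 ## f 4 ## v) = 0"
    "om2 (f 0 ## f 2 ## f 3 ## f 5 ## v) = 0"
    "om2 (f 0 ## f 2 ## f 4 ## f 5 ## v) = 0"
    "om2 (f 0 ## f 3 ## f 4 ## f 5 ## v) = 0"
    "om2 (f 1 ## f 2 ## f 3 ## f 4 ## v) = 0"
    "om2 (f 1 ## f 2 ## f 3 ## f 5 ## v) = 0"
    "om2 (f 1 ## f 2 ## f 4 ## f 5 ## v) = 0"
    "om2 (f 1 ## f 3 ## f 4 ## f 5 ## v) = 0"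
    "om2 (f 2 ## f 3 ## f 4 ## f 5 ## v) = 2"
  unfolding om2_def numeral_2_eq_2
  by (simp_all add: wedge_ev om22 om_f)


lemma alternating_om2: "alternating 4 om2"
  unfolding om2_def by (rule alternating_wedge'[OF alternating_om alternating_om]) simp

lemmas om2_4 = alternating_om2[simplified numeral_eq_Suc pred_numeral_simps BitM.simps, simplified]

lemma alternating_vol: "alternating 6 vol"
  unfolding vol_def[abs_def]
  by (rule alternating_divide, rule alternating_wedge'[OF alternating_om2 alternating_om]) simp

lemmas vol_6 = alternating_vol[simplified numeral_eq_Suc pred_numeral_simps BitM.simps, simplified]

lemma vol_f: "vol (f 0 ## f 1 ## f 2 ## f 3 ## f 4 ## f 5 ## v) = 1"
  unfolding vol_def by (simp add: numeral_eq_Suc wedge_ev om22 om2_4 om_f om2_f)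

text \<open>Together with \<open>vol_f\<close>, the normalisation 2 \<omega>^3 = 3 \<Omega>^+ \<and>
  \<Omega>^- reads 12 = 12 (p^2 + q^2) on the frame, so p + i q is a phase.\<close>

lemma wedge_Op_Om: "wedge 3 3 Op Om (f 0 ## f 1 ## f 2 ## f 3 ## f 4 ## f 5 ## v) = 4 * (p * p + q * q)"
  by (simp add: numeral_eq_Suc wedge_ev Op3 Om3 Op_f Om_f)

lemma vol_repeat:
  "vol (f i ## f i ## v) = 0" "vol (a ## f i ## f i ## v) = 0" "vol (a ## b ## f i ## f i ## v) = 0"
  "vol (a ## b ## c ## f i ## f i ## v) = 0" "vol (a ## b ## c ## d ## f i ## f i ## v) = 0"
  using alternating_repeat[OF vol_6] alternating_repeat[OF alternating_iota[OF vol_6]]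
    alternating_repeat[OF alternating_iota[OF alternating_iota[OF vol_6]]]
    alternating_repeat[OF alternating_iota[OF alternating_iota[OF alternating_iota[OF vol_6]]]]
    alternating_repeat[OF alternating_iota[OF alternating_iota[OF alternating_iota[OF alternating_iota[OF vol_6]]]]]
  by (simp_all add: iota_def)

text \<open>Sorting of arguments by conditional rewriting: the condition \<open>j < i\<close> is
  decided on literals and prevents looping. The result is settled by \<open>vol_repeat\<close> or
  \<open>vol_f\<close>.\<close>

lemma vol_sort:
  assumes "j < i"
  shows "vol (f i ## f j ## v) = - vol (f j ## f i ## v)"
    "vol (a ## f i ## f j ## v) = - vol (a ## f j ## f i ## v)"
    "vol (a ## b ## f i ## f j ## v) = - vol (a ## b ## f j ## f i ## v)"
    "vol (a ## b ## c ## f i ## f j ## v) = - vol (a ## b ## c ## f j ## f i ## v)"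
    "vol (a ## b ## c ## d ## f i ## f j ## v) = - vol (a ## b ## c ## d ## f j ## f i ## v)"
  using alternating_sort[OF vol_6 assms] alternating_sort[OF alternating_iota[OF vol_6] assms]
    alternating_sort[OF alternating_iota[OF alternating_iota[OF vol_6]] assms]
    alternating_sort[OF alternating_iota[OF alternating_iota[OF alternating_iota[OF vol_6]]] assms]
    alternating_sort[OF alternating_iota[OF alternating_iota[OF alternating_iota[OF alternating_iota[OF vol_6]]]] assms]
  by (simp_all add: iota_def)

lemmas vol_ev = vol_sort vol_repeat vol_f

lemma vol_nz: "vol (f 0 ## f 1 ## f 2 ## f 3 ## f 4 ## f 5 ## zs) \<noteq> 0"
  by (simp add: vol_f)

section \<open>Values of the star on the frame\<close>

lemma star_scontr: "k \<le> 6 \<Longrightarrow> alternating k b \<Longrightarrow> star k b = scontr fs k b vol"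
  by (rule hodge_pt_scontr[OF g frame alternating_vol vol_nz])

lemma star_1:
  assumes b: "alternating 1 b"
  shows "star 1 b (f 0 ## f 1 ## f 2 ## f 3 ## f 4 ## v) = - b (f 5 ## zs)"
    "star 1 b (f 0 ## f 1 ## f 2 ## f 3 ## f 5 ## v) = b (f 4 ## zs)"
    "star 1 b (f 0 ## f 1 ## f 2 ## f 4 ## f 5 ## v) = - b (f 3 ## zs)"
    "star 1 b (f 0 ## f 1 ## f 3 ## f 4 ## f 5 ## v) = b (f 2 ## zs)"
    "star 1 b (f 0 ## f 2 ## f 3 ## f 4 ## f 5 ## v) = - b (f 1 ## zs)"
    "star 1 b (f 1 ## f 2 ## f 3 ## f 4 ## f 5 ## v) = b (f 0 ## zs)"
  by (simp_all add: star_scontr[OF _ b] iota_apply vol_ev del: One_nat_def)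

lemma star_3:
  assumes b: "alternating 3 b"
  shows "star 3 b (f 0 ## f 1 ## f 2 ## v) = - b (f 3 ## f 4 ## f 5 ## zs)"
    "star 3 b (f 0 ## f 1 ## f 3 ## v) = b (f 2 ## f 4 ## f 5 ## zs)"
    "star 3 b (f 0 ## f 1 ## f 4 ## v) = - b (f 2 ## f 3 ## f 5 ## zs)"
    "star 3 b (f 0 ## f 1 ## f 5 ## v) = b (f 2 ## f 3 ## f 4 ## zs)"
    "star 3 b (f 0 ## f 2 ## f 3 ## v) = - b (f 1 ## f 4 ## f 5 ## zs)"
    "star 3 b (f 0 ## f 2 ## f 4 ## v) = b (f 1 ## f 3 ## f 5 ## zs)"
    "star 3 b (f 0 ## f 2 ## f 5 ## v) = - b (f 1 ## f 3 ## f 4 ## zs)"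
    "star 3 b (f 0 ## f 3 ## f 4 ## v) = - b (f 1 ## f 2 ## f 5 ## zs)"
    "star 3 b (f 0 ## f 3 ## f 5 ## v) = b (f 1 ## f 2 ## f 4 ## zs)"
    "star 3 b (f 0 ## f 4 ## f 5 ## v) = - b (f 1 ## f 2 ## f 3 ## zs)"
    "star 3 b (f 1 ## f 2 ## f 3 ## v) = b (f 0 ## f 4 ## f 5 ## zs)"
    "star 3 b (f 1 ## f 2 ## f 4 ## v) = - b (f 0 ## f 3 ## f 5 ## zs)"
    "star 3 b (f 1 ## f 2 ## f 5 ## v) = b (f 0 ## f 3 ## f 4 ## zs)"
    "star 3 b (f 1 ## f 3 ## f 4 ## v) = b (f 0 ## f 2 ## f 5 ## zs)"
    "star 3 b (f 1 ## f 3 ## f 5 ## v) = - b (f 0 ## f 2 ## f 4 ## zs)"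
    "star 3 b (f 1 ## f 4 ## f 5 ## v) = b (f 0 ## f 2 ## f 3 ## zs)"
    "star 3 b (f 2 ## f 3 ## f 4 ## v) = - b (f 0 ## f 1 ## f 5 ## zs)"
    "star 3 b (f 2 ## f 3 ## f 5 ## v) = b (f 0 ## f 1 ## f 4 ## zs)"
    "star 3 b (f 2 ## f 4 ## f 5 ## v) = - b (f 0 ## f 1 ## f 3 ## zs)"
    "star 3 b (f 3 ## f 4 ## f 5 ## v) = b (f 0 ## f 1 ## f 2 ## zs)"
  by (simp_all add: star_scontr[OF _ b] iota_apply vol_ev del: One_nat_def)

lemma star_4:
  assumes b: "alternating 4 b"
  shows "star 4 b (f 0 ## f 1 ## v) = b (f 2 ## f 3 ## f 4 ## f 5 ## zs)"
    "star 4 b (f 0 ## f 2 ## v) = - b (f 1 ## f 3 ## f 4 ## f 5 ## zs)"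
    "star 4 b (f 0 ## f 3 ## v) = b (f 1 ## f 2 ## f 4 ## f 5 ## zs)"
    "star 4 b (f 0 ## f 4 ## v) = - b (f 1 ## f 2 ## f 3 ## f 5 ## zs)"
    "star 4 b (f 0 ## f 5 ## v) = b (f 1 ## f 2 ## f 3 ## f 4 ## zs)"
    "star 4 b (f 1 ## f 2 ## v) = b (f 0 ## f 3 ## f 4 ## f 5 ## zs)"
    "star 4 b (f 1 ## f 3 ## v) = - b (f 0 ## f 2 ## f 4 ## f 5 ## zs)"
    "star 4 b (f 1 ## f 4 ## v) = b (f 0 ## f 2 ## f 3 ## f 5 ## zs)"
    "star 4 b (f 1 ## f 5 ## v) = - b (f 0 ## f 2 ## f 3 ## f 4 ## zs)"
    "star 4 b (f 2 ## f 3 ## v) = b (f 0 ## f 1 ## f 4 ## f 5 ## zs)"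
    "star 4 b (f 2 ## f 4 ## v) = - b (f 0 ## f 1 ## f 3 ## f 5 ## zs)"
    "star 4 b (f 2 ## f 5 ## v) = b (f 0 ## f 1 ## f 3 ## f 4 ## zs)"
    "star 4 b (f 3 ## f 4 ## v) = b (f 0 ## f 1 ## f 2 ## f 5 ## zs)"
    "star 4 b (f 3 ## f 5 ## v) = - b (f 0 ## f 1 ## f 2 ## f 4 ## zs)"
    "star 4 b (f 4 ## f 5 ## v) = b (f 0 ## f 1 ## f 2 ## f 3 ## zs)"
  by (simp_all add: star_scontr[OF _ b] iota_apply vol_ev del: One_nat_def)

lemma star_5:
  assumes b: "alternating 5 b"
  shows "star 5 b (f 0 ## v) = - b (f 1 ## f 2 ## f 3 ## f 4 ## f 5 ## zs)"
    "star 5 b (f 1 ## v) = b (f 0 ## f 2 ## f 3 ## f 4 ## f 5 ## zs)"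
    "star 5 b (f 2 ## v) = - b (f 0 ## f 1 ## f 3 ## f 4 ## f 5 ## zs)"
    "star 5 b (f 3 ## v) = b (f 0 ## f 1 ## f 2 ## f 4 ## f 5 ## zs)"
    "star 5 b (f 4 ## v) = - b (f 0 ## f 1 ## f 2 ## f 3 ## f 5 ## zs)"
    "star 5 b (f 5 ## v) = b (f 0 ## f 1 ## f 2 ## f 3 ## f 4 ## zs)"
  by (simp_all add: star_scontr[OF _ b] iota_apply vol_ev del: One_nat_def)

lemma star_6:
  assumes b: "alternating 6 b"
  shows "star 6 b (v) = b (f 0 ## f 1 ## f 2 ## f 3 ## f 4 ## f 5 ## zs)"
  by (simp_all add: star_scontr[OF _ b] iota_apply vol_ev del: One_nat_def)


lemmas span_frame = orthoframe_span[OF g frame]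

lemma alternating_star: "k \<le> 6 \<Longrightarrow> alternating k b \<Longrightarrow> alternating (6 - k) (star k b)"
  by (rule alternating_hodge_pt[OF g frame alternating_vol vol_nz])

lemma alternating_star':
  "alternating 1 a \<Longrightarrow> alternating 5 (star 1 a)" "alternating 3 a \<Longrightarrow> alternating 3 (star 3 a)"
  "alternating 4 a \<Longrightarrow> alternating 2 (star 4 a)" "alternating 5 a \<Longrightarrow> alternating 1 (star 5 a)"
  "alternating 6 a \<Longrightarrow> alternating 0 (star 6 a)"
  using alternating_star[of 1 a] alternating_star[of 3 a] alternating_star[of 4 a]
    alternating_star[of 5 a] alternating_star[of 6 a] by simp_all

lemma alternating_wedge_numerals:
  "alternating 1 a \<Longrightarrow> alternating 2 b \<Longrightarrow> alternating 3 (wedge 1 2 a b)"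
  "alternating 1 a \<Longrightarrow> alternating 3 b \<Longrightarrow> alternating 4 (wedge 1 3 a b)"
  "alternating 1 a \<Longrightarrow> alternating 4 b \<Longrightarrow> alternating 5 (wedge 1 4 a b)"
  "alternating 2 a \<Longrightarrow> alternating 2 b \<Longrightarrow> alternating 4 (wedge 2 2 a b)"
  "alternating 2 a \<Longrightarrow> alternating 3 b \<Longrightarrow> alternating 5 (wedge 2 3 a b)"
  "alternating 2 a \<Longrightarrow> alternating 4 b \<Longrightarrow> alternating 6 (wedge 2 4 a b)"
  "alternating 3 a \<Longrightarrow> alternating 2 b \<Longrightarrow> alternating 5 (wedge 3 2 a b)"
  "alternating 3 a \<Longrightarrow> alternating 3 b \<Longrightarrow> alternating 6 (wedge 3 3 a b)"
  by (auto intro: alternating_wedge')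

lemmas alts = alternating_wedge_numerals alternating_star' alternating_pull[OF J] Op Om alternating_om
  alternating_om2 alternating_vol alternating_plus alternating_diff alternating_cmult alternating_uminus

lemma eqI: "alternating k a \<Longrightarrow> alternating k b \<Longrightarrow> agree fs k a b \<Longrightarrow> a = b"
  using agree_eq[OF span_frame] .

lemma comp_J [simp]: "(\<lambda>i. J ((u ## v) i)) = J u ## (\<lambda>i. J (v i))"
  by (rule vcons_comp)

lemma linear_1: "alternating 1 a \<Longrightarrow> a ((- u) ## v) = - a (u ## v)"
  using alternating_minus[of 0 a] by simp

lemma star_J:
  assumes a: "alternating 1 a"
  shows "star 1 (pull J a) = (\<lambda>v. (1/2) * wedge 1 4 a om2 v)"
proof (rule eqI[of 5])
  have a': "alternating (Suc 0) a" using a by simp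
  have "wedge (Suc 0) (Suc (Suc (Suc (Suc 0)))) a om2 = wedge 1 4 a om2"
    by (simp add: numeral_eq_Suc)
  show "agree fs 5 (star 1 (pull J a)) (\<lambda>v. (1/2) * wedge 1 4 a om2 v)"
    by (simp add: iota_apply star_1[OF alternating_pull[OF J a], unfolded One_nat_def] pull_apply Jf Jf' linear_1[OF a])
      (simp add: numeral_eq_Suc wedge_ev a' om2_4 om2_f)
qed (intro alts a)+

abbreviation sigma :: "real mform \<Rightarrow> real mform" where
  "sigma a \<equiv> star 4 (wedge 1 3 a Om)"



end

text \<open>The phase is normalised to 1, as \<open>p\<close> and \<open>q\<close> would otherwise
  enter all component formulas below.\<close>

locale su3 = su3_frame g J Op Om f 1 0 for g J Op Om f
begin

section \<open>Products of \<sigma> with the structure forms\<close>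

lemma sigma_f:
  assumes a: "alternating 1 a"
  shows "sigma a (f 0 ## f 1 ## v) = 0"
    "sigma a (f 0 ## f 2 ## v) = a (f 4 ## zs)"
    "sigma a (f 0 ## f 3 ## v) = - a (f 5 ## zs)"
    "sigma a (f 0 ## f 4 ## v) = - a (f 2 ## zs)"
    "sigma a (f 0 ## f 5 ## v) = a (f 3 ## zs)"
    "sigma a (f 1 ## f 2 ## v) = - a (f 5 ## zs)"
    "sigma a (f 1 ## f 3 ## v) = - a (f 4 ## zs)"
    "sigma a (f 1 ## f 4 ## v) = a (f 3 ## zs)"
    "sigma a (f 1 ## f 5 ## v) = a (f 2 ## zs)"
    "sigma a (f 2 ## f 3 ## v) = 0"
    "sigma a (f 2 ## f 4 ## v) = a (f 0 ## zs)"
    "sigma a (f 2 ## f 5 ## v) = - a (f 1 ## zs)"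
    "sigma a (f 3 ## f 4 ## v) = - a (f 1 ## zs)"
    "sigma a (f 3 ## f 5 ## v) = - a (f 0 ## zs)"
    "sigma a (f 4 ## f 5 ## v) = 0"
  unfolding star_4[OF alternating_wedge_numerals(2)[OF a Om]]
  by (simp_all add: numeral_eq_Suc wedge_ev a[unfolded One_nat_def] Om3 Om_f)

text \<open>The form of the middle term in the expression for d\<alpha>. Its components coincide
  with those of \<open>sigma\<close>, which reflects J^* b \<and> \<Omega>^+ = b \<and>
  \<Omega>^-.\<close>

abbreviation eta :: "real mform \<Rightarrow> real mform" where
  "eta b \<equiv> star 4 (wedge 1 3 (pull J b) Op)"

lemma eta_f:
  assumes b: "alternating 1 b"
  shows "eta b (f 0 ## f 1 ## v) = 0"
    "eta b (f 0 ## f 2 ## v) = b (f 4 ## zs)"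
    "eta b (f 0 ## f 3 ## v) = - b (f 5 ## zs)"
    "eta b (f 0 ## f 4 ## v) = - b (f 2 ## zs)"
    "eta b (f 0 ## f 5 ## v) = b (f 3 ## zs)"
    "eta b (f 1 ## f 2 ## v) = - b (f 5 ## zs)"
    "eta b (f 1 ## f 3 ## v) = - b (f 4 ## zs)"
    "eta b (f 1 ## f 4 ## v) = b (f 3 ## zs)"
    "eta b (f 1 ## f 5 ## v) = b (f 2 ## zs)"
    "eta b (f 2 ## f 3 ## v) = 0"
    "eta b (f 2 ## f 4 ## v) = b (f 0 ## zs)"
    "eta b (f 2 ## f 5 ## v) = - b (f 1 ## zs)"
    "eta b (f 3 ## f 4 ## v) = - b (f 1 ## zs)"
    "eta b (f 3 ## f 5 ## v) = - b (f 0 ## zs)"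
    "eta b (f 4 ## f 5 ## v) = 0"
  unfolding star_4[OF alternating_wedge_numerals(2)[OF alternating_pull[OF J b] Op]]
  by (simp_all add: numeral_eq_Suc wedge_ev alternating_pull[OF J b, unfolded One_nat_def] Op3 Op_f)
    (simp_all add: pull_apply Jf Jf' linear_1[OF b])

lemma star_wedge_Om_f:
  assumes t: "alternating 2 t"
  shows "star 5 (wedge 2 3 t Om) (f 0 ## v) = - t (f 2 ## f 4 ## zs) + t (f 3 ## f 5 ## zs)"
    "star 5 (wedge 2 3 t Om) (f 1 ## v) = t (f 2 ## f 5 ## zs) + t (f 3 ## f 4 ## zs)"
    "star 5 (wedge 2 3 t Om) (f 2 ## v) = t (f 0 ## f 4 ## zs) - t (f 1 ## f 5 ## zs)"
    "star 5 (wedge 2 3 t Om) (f 3 ## v) = - t (f 0 ## f 5 ## zs) - t (f 1 ## f 4 ## zs)"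
    "star 5 (wedge 2 3 t Om) (f 4 ## v) = - t (f 0 ## f 2 ## zs) + t (f 1 ## f 3 ## zs)"
    "star 5 (wedge 2 3 t Om) (f 5 ## v) = t (f 0 ## f 3 ## zs) + t (f 1 ## f 2 ## zs)"
  unfolding star_5[OF alternating_wedge_numerals(5)[OF t Om]]
  by (simp_all add: numeral_eq_Suc wedge_ev t[unfolded numeral_2_eq_2] Om3 Om_f)

lemma sigma_om:
  assumes a: "alternating 1 a"
  shows "wedge 2 2 (sigma a) om = wedge 1 3 a Om"
proof (rule eqI[of 4])
  have a': "alternating (Suc 0) a" using a by simp
  have s: "alternating (Suc (Suc 0)) (sigma a)"
    using alternating_star'(3)[OF alternating_wedge_numerals(2)[OF a Om]] by (simp add: numeral_2_eq_2)
  have 22: "wedge 2 2 (sigma a) om = wedge (Suc (Suc 0)) (Suc (Suc 0)) (sigma a) om" by (simp add: numeral_2_eq_2)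
  show "agree fs 4 (wedge 2 2 (sigma a) om) (wedge 1 3 a Om)"
    unfolding 22 by (simp add: iota_apply wedge_ev s om22 om_f sigma_f[OF a] del: One_nat_def)
      (simp add: numeral_3_eq_3 wedge_ev a' Om3 Om_f)
qed (intro alts a)+

lemma sigma_Om:
  assumes a: "alternating 1 a"
  shows "wedge 2 3 (sigma a) Om = (\<lambda>v. 2 * star 1 a v)"
proof (rule eqI[of 5])
  have s: "alternating (Suc (Suc 0)) (sigma a)"
    using alternating_star'(3)[OF alternating_wedge_numerals(2)[OF a Om]] by (simp add: numeral_2_eq_2)
  have 23: "wedge 2 3 (sigma a) Om = wedge (Suc (Suc 0)) (Suc (Suc (Suc 0))) (sigma a) Om"
    by (simp add: numeral_2_eq_2 numeral_3_eq_3)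
  show "agree fs 5 (wedge 2 3 (sigma a) Om) (\<lambda>v. 2 * star 1 a v)"
    unfolding 23 by (simp add: iota_apply wedge_ev s Om3 Om_f sigma_f[OF a] star_1[OF a] del: One_nat_def)
qed (intro alts a)+

lemma sigma_Op:
  assumes a: "alternating 1 a"
  shows "wedge 2 3 (sigma a) Op = (\<lambda>v. 2 * star 1 (pull J a) v)"
proof (rule eqI[of 5])
  have s: "alternating (Suc (Suc 0)) (sigma a)"
    using alternating_star'(3)[OF alternating_wedge_numerals(2)[OF a Om]] by (simp add: numeral_2_eq_2)
  have 23: "wedge 2 3 (sigma a) Op = wedge (Suc (Suc 0)) (Suc (Suc (Suc 0))) (sigma a) Op"
    by (simp add: numeral_2_eq_2 numeral_3_eq_3)
  show "agree fs 5 (wedge 2 3 (sigma a) Op) (\<lambda>v. 2 * star 1 (pull J a) v)"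
    unfolding 23 by (simp add: iota_apply wedge_ev s Op3 Op_f sigma_f[OF a]
      star_1[OF alternating_pull[OF J a]] pull_apply Jf Jf' linear_1[OF a] del: One_nat_def)
qed (intro alts a)+

text \<open>This is the real part of (b - i J^* b) \<and> \<Omega>. The first factor is complex
  linear, so the product has type (4, 0) and vanishes in complex dimension 3. It is used to show
  that \<Omega> is closed.\<close>

lemma Op_plus_J_Om:
  assumes b: "alternating 1 b"
  shows "wedge 1 3 b Op v + wedge 1 3 (pull J b) Om v = 0"
proof -
  have b1: "alternating (Suc 0) b" using b by simp
  have b2: "alternating (Suc 0) (pull J b)" using alternating_pull[OF J b] by simp
  have "(\<lambda>v. wedge 1 3 b Op v + wedge 1 3 (pull J b) Om v) = (\<lambda>v. 0)"
  proof (rule eqI[of 4])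
    show "agree fs 4 (\<lambda>v. wedge 1 3 b Op v + wedge 1 3 (pull J b) Om v) (\<lambda>v. 0)"
      by (simp add: iota_apply numeral_eq_Suc wedge_ev b1 b2 Op3 Op_f Om3 Om_f)
        (simp add: pull_apply Jf Jf' linear_1[OF b])
  qed (intro alts b alternating_zero)+
  then show ?thesis by (rule fun_cong)
qed

section \<open>Decomposition of 2-forms and 3-forms\<close>

definition W2 :: "real mform set" where
  "W2 = {s. alternating 2 s \<and> pull J s = s \<and> wedge 2 4 s om2 = (\<lambda>v. 0)}"

definition W3 :: "real mform set" where
  "W3 = {r. alternating 3 r \<and> wedge 3 2 r om = (\<lambda>v. 0) \<and>
     wedge 3 3 r Op = (\<lambda>v. 0) \<and> wedge 3 3 r Om = (\<lambda>v. 0)}"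

lemma J_2:
  assumes t: "alternating 2 t"
  shows "t (u ## (- v) ## w) = - t (u ## v ## w)" "t ((- u) ## w) = - t (u ## w)"
    "j < i \<Longrightarrow> t (f i ## f j ## w) = - t (f j ## f i ## w)"
  using alternating_minus_2[of 0 t] alternating_minus[of 1 t] alternating_sort[of 0 t] t
  by (simp_all add: numeral_2_eq_2)

lemma wedge_om2_f:
  assumes t: "alternating 2 t"
  shows "wedge 2 4 t om2 (f 0 ## f 1 ## f 2 ## f 3 ## f 4 ## f 5 ## zs) =
    2 * (t (f 0 ## f 1 ## zs) + t (f 2 ## f 3 ## zs) + t (f 4 ## f 5 ## zs))"
proof -
  have t': "alternating (Suc (Suc 0)) t" using t by (simp add: numeral_2_eq_2)
  show ?thesis
    by (simp add: numeral_eq_Suc wedge_ev t' om2_4 om2_f)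
qed

text \<open>The linear conditions solved for 7 of the 15 components; the other 8 stay free.\<close>

lemma W2_f:
  assumes "s \<in> W2"
  shows "s (f 1 ## f 3 ## zs) = s (f 0 ## f 2 ## zs)"
    "s (f 1 ## f 2 ## zs) = - s (f 0 ## f 3 ## zs)"
    "s (f 1 ## f 5 ## zs) = s (f 0 ## f 4 ## zs)"
    "s (f 1 ## f 4 ## zs) = - s (f 0 ## f 5 ## zs)"
    "s (f 3 ## f 5 ## zs) = s (f 2 ## f 4 ## zs)"
    "s (f 3 ## f 4 ## zs) = - s (f 2 ## f 5 ## zs)"
    "s (f 4 ## f 5 ## zs) = - s (f 0 ## f 1 ## zs) - s (f 2 ## f 3 ## zs)"
proof -
  have s: "alternating 2 s" "pull J s v = s v" "wedge 2 4 s om2 v = 0" for v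
    using assms by (auto simp: W2_def)
  have *: "s (J u ## J v ## zs) = s (u ## v ## zs)" for u v
    using s(2)[of "u ## v ## zs"] by (simp add: pull_apply)
  note J_2[OF s(1), simp]
  show "s (f 1 ## f 3 ## zs) = s (f 0 ## f 2 ## zs)"
    "s (f 1 ## f 2 ## zs) = - s (f 0 ## f 3 ## zs)"
    "s (f 1 ## f 5 ## zs) = s (f 0 ## f 4 ## zs)"
    "s (f 1 ## f 4 ## zs) = - s (f 0 ## f 5 ## zs)"
    "s (f 3 ## f 5 ## zs) = s (f 2 ## f 4 ## zs)"
    "s (f 3 ## f 4 ## zs) = - s (f 2 ## f 5 ## zs)"
    using *[of "f 0" "f 2"] *[of "f 0" "f 3"] *[of "f 0" "f 4"] *[of "f 0" "f 5"] *[of "f 2" "f 4"] *[of "f 2" "f 5"]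
    by (simp_all add: Jf Jf')
  show "s (f 4 ## f 5 ## zs) = - s (f 0 ## f 1 ## zs) - s (f 2 ## f 3 ## zs)"
    using s(3) wedge_om2_f[OF s(1)] by simp
qed

text \<open>One has \<omega> \<and> \<omega>^2 = 6 vol and \<star>(eta b \<and> \<Omega>^-) = -2 b,
  which the coefficients 1/6 and -1/2 invert. The product with \<omega>^2 kills \<open>eta\<close>,
  and the product with \<Omega>^- kills \<omega>, so both products of the remainder vanish. This
  places it in \<open>W2\<close>, and the part split off is orthogonal to \<open>W2\<close>.\<close>

lemma decomposition_2:
  assumes t: "alternating 2 t"
  shows "t v = (1/6) * star 6 (wedge 2 4 t om2) v * om v
    - (1/2) * eta (star 5 (wedge 2 3 t Om)) v + orth_proj g 2 W2 t v"
proof -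
  define b where "b = star 5 (wedge 2 3 t Om)"
  define c where "c = (1/3) * (t (f 0 ## f 1 ## zs) + t (f 2 ## f 3 ## zs) + t (f 4 ## f 5 ## zs))"
  define t8 where "t8 = (\<lambda>v. t v - (c * om v - (1/2) * eta b v))"
  have b: "alternating 1 b" unfolding b_def by (intro alts t)
  have t8: "alternating 2 t8" unfolding t8_def by (intro alts t b)
  have alt: "alternating 2 (\<lambda>v. c * om v - (1/2) * eta b v)" by (intro alts b)
  have s6: "star 6 (wedge 2 4 t om2) v = 6 * c" for v
    using star_6[OF alternating_wedge_numerals(6)[OF t alternating_om2]] by (simp add: wedge_om2_f[OF t] c_def)
  note eta = eta_f[OF b]
  note bf = star_wedge_Om_f[OF t, folded b_def]
  have "t8 \<in> W2"
    unfolding W2_def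
  proof (intro CollectI conjI)
    \<comment> \<open>Up to sign, the six components of \<open>b\<close> in
      \<open>star_wedge_Om_f\<close> measure the failure of \<open>t\<close> to be invariant under
      \<open>J\<close>; the \<open>eta\<close> term cancels them.\<close>
    show "pull J t8 = t8"
    proof (rule eqI[of 2])
      show "agree fs 2 (pull J t8) t8"
        by (simp add: iota_apply pull_apply Jf Jf' J_2[OF t8])
         (simp add: t8_def om_f eta bf field_simps del: One_nat_def)
    qed (intro alts t8)+
    show "wedge 2 4 t8 om2 = (\<lambda>v. 0)"
    proof (rule eqI[of 6])
      show "agree fs 6 (wedge 2 4 t8 om2) (\<lambda>v. 0)"
        by (simp add: iota_apply wedge_om2_f[OF t8]) (simp add: t8_def om_f eta c_def algebra_simps del: One_nat_def)
    qed (intro alts t8 alternating_zero)+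
  qed (rule t8)
  moreover have "form_inner g 2 (\<lambda>v. t v - t8 v) w = 0" if w: "w \<in> W2" for w
  proof -
    have w2: "alternating 2 w" using w by (simp add: W2_def)
    have "form_inner g 2 (\<lambda>v. t v - t8 v) w = form_inner g 2 (\<lambda>v. c * om v - (1/2) * eta b v) w"
      by (simp add: t8_def)
    also have "\<dots> = 0"
      unfolding form_inner_scontr[OF g frame alt w2]
      by (simp add: iota_apply om_f eta W2_f[OF w] algebra_simps del: One_nat_def)
    finally show ?thesis .
  qed
  moreover have "(\<lambda>v. s v - u v) \<in> W2" if "s \<in> W2" "u \<in> W2" for s u
    using that by (auto simp: W2_def pull_def fun_eq_iff wedge_diff_left intro: alternating_diff)
  ultimately have "orth_proj g 2 W2 t = t8"
    by (intro orth_proj_eqI[OF g frame]) (auto simp: W2_def)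
  then show ?thesis by (simp add: s6 t8_def b_def)
qed


lemma wedge_3_f:
  assumes r: "alternating 3 r"
  shows "wedge 3 2 r om (f 0 ## f 1 ## f 2 ## f 3 ## f 4 ## zs) = r (f 0 ## f 1 ## f 4 ## zs) + r (f 2 ## f 3 ## f 4 ## zs)"
    "wedge 3 2 r om (f 0 ## f 1 ## f 2 ## f 3 ## f 5 ## zs) = r (f 0 ## f 1 ## f 5 ## zs) + r (f 2 ## f 3 ## f 5 ## zs)"
    "wedge 3 2 r om (f 0 ## f 1 ## f 2 ## f 4 ## f 5 ## zs) = r (f 0 ## f 1 ## f 2 ## zs) + r (f 2 ## f 4 ## f 5 ## zs)"
    "wedge 3 2 r om (f 0 ## f 1 ## f 3 ## f 4 ## f 5 ## zs) = r (f 0 ## f 1 ## f 3 ## zs) + r (f 3 ## f 4 ## f 5 ## zs)"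
    "wedge 3 2 r om (f 0 ## f 2 ## f 3 ## f 4 ## f 5 ## zs) = r (f 0 ## f 2 ## f 3 ## zs) + r (f 0 ## f 4 ## f 5 ## zs)"
    "wedge 3 2 r om (f 1 ## f 2 ## f 3 ## f 4 ## f 5 ## zs) = r (f 1 ## f 2 ## f 3 ## zs) + r (f 1 ## f 4 ## f 5 ## zs)"
    "wedge 3 3 r Op (f 0 ## f 1 ## f 2 ## f 3 ## f 4 ## f 5 ## zs) = - r (f 0 ## f 2 ## f 5 ## zs) - r (f 0 ## f 3 ## f 4 ## zs) - r (f 1 ## f 2 ## f 4 ## zs) + r (f 1 ## f 3 ## f 5 ## zs)"
    "wedge 3 3 r Om (f 0 ## f 1 ## f 2 ## f 3 ## f 4 ## f 5 ## zs) = r (f 0 ## f 2 ## f 4 ## zs) - r (f 0 ## f 3 ## f 5 ## zs) - r (f 1 ## f 2 ## f 5 ## zs) - r (f 1 ## f 3 ## f 4 ## zs)"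
  by (simp_all add: numeral_eq_Suc wedge_ev r[unfolded numeral_3_eq_3] om22 Op3 Om3 om_f Op_f Om_f)

lemma star_wedge_om_f:
  assumes r: "alternating 3 r"
  shows "star 5 (wedge 3 2 r om) (f 0 ## v) = - r (f 1 ## f 2 ## f 3 ## zs) - r (f 1 ## f 4 ## f 5 ## zs)"
    "star 5 (wedge 3 2 r om) (f 1 ## v) = r (f 0 ## f 2 ## f 3 ## zs) + r (f 0 ## f 4 ## f 5 ## zs)"
    "star 5 (wedge 3 2 r om) (f 2 ## v) = - r (f 0 ## f 1 ## f 3 ## zs) - r (f 3 ## f 4 ## f 5 ## zs)"
    "star 5 (wedge 3 2 r om) (f 3 ## v) = r (f 0 ## f 1 ## f 2 ## zs) + r (f 2 ## f 4 ## f 5 ## zs)"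
    "star 5 (wedge 3 2 r om) (f 4 ## v) = - r (f 0 ## f 1 ## f 5 ## zs) - r (f 2 ## f 3 ## f 5 ## zs)"
    "star 5 (wedge 3 2 r om) (f 5 ## v) = r (f 0 ## f 1 ## f 4 ## zs) + r (f 2 ## f 3 ## f 4 ## zs)"
  unfolding star_5[OF alternating_wedge_numerals(7)[OF r alternating_om]] by (simp_all add: wedge_3_f[OF r])

lemma wedge_J_om_f:
  assumes e: "alternating 1 e"
  shows "wedge 1 2 (pull J e) om (f 0 ## f 1 ## f 2 ## zs) = e (f 3 ## zs)"
    "wedge 1 2 (pull J e) om (f 0 ## f 1 ## f 3 ## zs) = - e (f 2 ## zs)"
    "wedge 1 2 (pull J e) om (f 0 ## f 1 ## f 4 ## zs) = e (f 5 ## zs)"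
    "wedge 1 2 (pull J e) om (f 0 ## f 1 ## f 5 ## zs) = - e (f 4 ## zs)"
    "wedge 1 2 (pull J e) om (f 0 ## f 2 ## f 3 ## zs) = e (f 1 ## zs)"
    "wedge 1 2 (pull J e) om (f 0 ## f 2 ## f 4 ## zs) = 0"
    "wedge 1 2 (pull J e) om (f 0 ## f 2 ## f 5 ## zs) = 0"
    "wedge 1 2 (pull J e) om (f 0 ## f 3 ## f 4 ## zs) = 0"
    "wedge 1 2 (pull J e) om (f 0 ## f 3 ## f 5 ## zs) = 0"
    "wedge 1 2 (pull J e) om (f 0 ## f 4 ## f 5 ## zs) = e (f 1 ## zs)"
    "wedge 1 2 (pull J e) om (f 1 ## f 2 ## f 3 ## zs) = - e (f 0 ## zs)"
    "wedge 1 2 (pull J e) om (f 1 ## f 2 ## f 4 ## zs) = 0"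
    "wedge 1 2 (pull J e) om (f 1 ## f 2 ## f 5 ## zs) = 0"
    "wedge 1 2 (pull J e) om (f 1 ## f 3 ## f 4 ## zs) = 0"
    "wedge 1 2 (pull J e) om (f 1 ## f 3 ## f 5 ## zs) = 0"
    "wedge 1 2 (pull J e) om (f 1 ## f 4 ## f 5 ## zs) = - e (f 0 ## zs)"
    "wedge 1 2 (pull J e) om (f 2 ## f 3 ## f 4 ## zs) = e (f 5 ## zs)"
    "wedge 1 2 (pull J e) om (f 2 ## f 3 ## f 5 ## zs) = - e (f 4 ## zs)"
    "wedge 1 2 (pull J e) om (f 2 ## f 4 ## f 5 ## zs) = e (f 3 ## zs)"
    "wedge 1 2 (pull J e) om (f 3 ## f 4 ## f 5 ## zs) = - e (f 2 ## zs)"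
  by (simp_all add: numeral_eq_Suc wedge_ev alternating_pull[OF J e, unfolded One_nat_def] om22 om_f)
    (simp_all add: pull_apply Jf Jf' linear_1[OF e])

lemma W3D:
  assumes "w \<in> W3"
  shows "wedge 3 2 w om v = 0" "wedge 3 3 w Op v = 0" "wedge 3 3 w Om v = 0" "alternating 3 w"
  using assms by (auto simp: W3_def)

text \<open>Eight linear equations between the 20 components, which leave 12 free.\<close>

lemma W3_f:
  assumes "w \<in> W3"
  shows "w (f 2 ## f 3 ## f 4 ## zs) = - w (f 0 ## f 1 ## f 4 ## zs)"
    "w (f 2 ## f 3 ## f 5 ## zs) = - w (f 0 ## f 1 ## f 5 ## zs)"
    "w (f 2 ## f 4 ## f 5 ## zs) = - w (f 0 ## f 1 ## f 2 ## zs)"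
    "w (f 3 ## f 4 ## f 5 ## zs) = - w (f 0 ## f 1 ## f 3 ## zs)"
    "w (f 0 ## f 4 ## f 5 ## zs) = - w (f 0 ## f 2 ## f 3 ## zs)"
    "w (f 1 ## f 4 ## f 5 ## zs) = - w (f 1 ## f 2 ## f 3 ## zs)"
    "w (f 1 ## f 3 ## f 5 ## zs) = w (f 0 ## f 2 ## f 5 ## zs) + w (f 0 ## f 3 ## f 4 ## zs) + w (f 1 ## f 2 ## f 4 ## zs)"
    "w (f 1 ## f 3 ## f 4 ## zs) = w (f 0 ## f 2 ## f 4 ## zs) - w (f 0 ## f 3 ## f 5 ## zs) - w (f 1 ## f 2 ## f 5 ## zs)"
  using wedge_3_f[OF W3D(4)[OF assms], unfolded W3D(1-3)[OF assms]] by linarith+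

text \<open>The constants invert \<Omega>^+ \<and> \<Omega>^- = 4 vol = - \<Omega>^- \<and>
  \<Omega>^+ and \<star>(J^* x \<and> \<omega>^2) = 2 x. The projection is applied to -\<star>r
  because \<open>d6_12\<close> projects a codifferential, which is -\<star>d\<star>; the outer star
  undoes this, as \<star>\<star> = -1 on 3-forms.\<close>

lemma decomposition_3:
  assumes r: "alternating 3 r"
  shows "r v = (1/4) * star 6 (wedge 3 3 r Om) v * Op v - (1/4) * star 6 (wedge 3 3 r Op) v * Om v
    + (1/2) * wedge 1 2 (pull J (star 5 (wedge 3 2 r om))) om v
    + star 3 (orth_proj g 3 W3 (\<lambda>v. - star 3 r v)) v"
proof -
  let ?z = "f 0 ## f 1 ## f 2 ## f 3 ## f 4 ## f 5 ## zs"
  define e where "e = star 5 (wedge 3 2 r om)"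
  define x where "x = (\<lambda>v. (1/4) * wedge 3 3 r Om ?z * Op v - (1/4) * wedge 3 3 r Op ?z * Om v
    + (1/2) * wedge 1 2 (pull J e) om v)"
  define y where "y = (\<lambda>v. r v - x v)"
  \<comment> \<open>The candidate for the projection. Passing to -\<star> takes the splitting r = x
    + y to one of -\<star>r, with -\<star>x orthogonal to \<open>W3\<close>.\<close>
  define t where "t = (\<lambda>v. - star 3 y v)"
  have tv: "t v = - star 3 y v" and yv: "y v = r v - x v" for v by (simp_all add: t_def y_def)
  have xv: "x v = (1/4) * wedge 3 3 r Om ?z * Op v - (1/4) * wedge 3 3 r Op ?z * Om v
    + (1/2) * wedge 1 2 (pull J e) om v" for v by (simp add: x_def)
  have e: "alternating 1 e" unfolding e_def by (intro alts r)
  have x: "alternating 3 x" unfolding x_def by (intro alts e)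
  have y: "alternating 3 y" unfolding y_def by (intro alts r x)
  have t: "alternating 3 t" unfolding t_def by (intro alts y)
  have s6: "star 6 (wedge 3 3 r Op) v = wedge 3 3 r Op ?z" "star 6 (wedge 3 3 r Om) v = wedge 3 3 r Om ?z" for v
    using star_6[OF alternating_wedge_numerals(8)[OF r Op]] star_6[OF alternating_wedge_numerals(8)[OF r Om]]
    by simp_all
  note xf = wedge_3_f[OF r] wedge_J_om_f[OF e] star_wedge_om_f[OF r, folded e_def]
  note tf = star_3[OF y]
  have star_t: "star 3 t = y"
  proof (rule eqI[of 3])
    show "agree fs 3 (star 3 t) y"
      by (simp add: iota_apply star_3[OF t]) (simp add: tv tf)
  qed (intro alts t y)+
  have "t \<in> W3"
    unfolding W3_def
  proof (intro CollectI conjI)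
    show "wedge 3 2 t om = (\<lambda>v. 0)"
    proof (rule eqI[of 5])
      show "agree fs 5 (wedge 3 2 t om) (\<lambda>v. 0)"
        by (simp add: iota_apply wedge_3_f[OF t])
          (simp add: tv tf yv xv Op_f Om_f xf field_simps del: One_nat_def)
    qed (intro alts t alternating_zero)+
    show "wedge 3 3 t Op = (\<lambda>v. 0)"
    proof (rule eqI[of 6])
      show "agree fs 6 (wedge 3 3 t Op) (\<lambda>v. 0)"
        by (simp add: iota_apply wedge_3_f[OF t])
          (simp add: tv tf yv xv Op_f Om_f xf field_simps del: One_nat_def)
    qed (intro alts t alternating_zero)+
    show "wedge 3 3 t Om = (\<lambda>v. 0)"
    proof (rule eqI[of 6])
      show "agree fs 6 (wedge 3 3 t Om) (\<lambda>v. 0)"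
        by (simp add: iota_apply wedge_3_f[OF t])
          (simp add: tv tf yv xv Op_f Om_f xf field_simps del: One_nat_def)
    qed (intro alts t alternating_zero)+
  qed (rule t)
  moreover have "form_inner g 3 (\<lambda>v. - star 3 r v - t v) w = 0" if w: "w \<in> W3" for w
  proof -
    have w3: "alternating 3 w" using w by (simp add: W3_def)
    have alt: "alternating 3 (\<lambda>v. - star 3 r v - t v)" by (intro alts r t)
    show ?thesis
      unfolding form_inner_scontr[OF g frame alt w3]
      by (simp add: iota_apply tv tf star_3[OF r])
        (simp add: yv xv Op_f Om_f wedge_J_om_f[OF e] W3_f[OF w] field_simps del: One_nat_def)
  qed
  moreover have "(\<lambda>v. s v - u v) \<in> W3" if "s \<in> W3" "u \<in> W3" for s u
    using that by (auto simp: W3_def fun_eq_iff wedge_diff_left intro: alternating_diff)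
  ultimately have "orth_proj g 3 W3 (\<lambda>v. - star 3 r v) = t"
    by (intro orth_proj_eqI[OF g frame]) (auto simp: W3_def)
  then show ?thesis by (simp add: s6 star_t yv xv e_def)
qed

lemma star_6_vol:
  assumes k: "alternating 6 k"
  shows "star 6 k u * vol v = k v"
proof -
  have "(\<lambda>v. star 6 k u * vol v) = k"
  proof (rule eqI[of 6])
    show "agree fs 6 (\<lambda>v. star 6 k u * vol v) k"
      by (simp add: iota_apply star_6[OF k] vol_f)
  qed (intro alts k)+
  then show ?thesis by (rule fun_cong)
qed

end

section \<open>Existence of an adapted frame\<close>

lemma exists_unit_orthogonal:
  assumes g: "inner_form g" and xs: "length xs < 6"
  shows "\<exists>u. g u u = 1 \<and> (\<forall>x\<in>set xs. g u x = 0)"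
proof -
  have bil: "bilinear g" and sym: "\<And>u v. g u v = g v u" and pos: "\<And>u. u \<noteq> 0 \<Longrightarrow> g u u > 0"
    using g unfolding inner_form_def by blast+
  \<comment> \<open>The range of \<open>T\<close> lies in the span of fewer than six vectors, so
    \<open>T\<close> has a kernel. For \<open>w\<close> in the kernel, 0 = g(w, T w) is the sum of
    the squares g(w, x)^2.\<close>
  define T where "T = (\<lambda>u. \<Sum>x\<leftarrow>xs. g u x *\<^sub>R x)"
  have comp: "(\<Sum>x\<leftarrow>ys. g u x *\<^sub>R x) \<in> span S" if "set ys \<subseteq> S" for u ys S
    using that by (induction ys) (auto intro: span_zero span_add span_scale span_base)
  have lin: "linear (\<lambda>u. \<Sum>x\<leftarrow>ys. g u x *\<^sub>R x)" for ys
  proof (induction ys)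
    case (Cons y ys)
    have "linear (\<lambda>u. g u y *\<^sub>R y)"
      by (rule linearI) (simp_all add: bilinear_ladd[OF bil] bilinear_lmul[OF bil] scaleR_add_left)
    from linear_compose_add[OF this Cons] show ?case by simp
  qed (simp add: linear_zero)
  have "\<not> inj T"
  proof
    assume "inj T"
    then have "surj T" using linear_injective_imp_surjective lin T_def by blast
    have "y \<in> span (set xs)" for y
    proof -
      obtain u where "y = T u" using \<open>surj T\<close> by (rule surjE)
      then show ?thesis using comp[of xs "set xs" u] by (simp add: T_def)
    qed
    then have "UNIV \<subseteq> span (set xs)" by blast
    then have "dim (UNIV :: (real ^ 6) set) \<le> card (set xs)" by (intro dim_le_card) auto
    then show False using xs card_length[of xs] by simp
  qed
  then obtain w where w: "w \<noteq> 0" "T w = 0"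
    using linear_injective_0[of T] lin unfolding T_def by blast
  have "g w (\<Sum>x\<leftarrow>ys. g w x *\<^sub>R x) = (\<Sum>x\<leftarrow>ys. g w x * g w x)" for ys
    by (induction ys) (simp_all add: bilinear_radd[OF bil] bilinear_rmul[OF bil] bilinear_rzero[OF bil])
  from this[of xs] w(2) have "(\<Sum>x\<leftarrow>xs. g w x * g w x) = 0"
    by (simp add: T_def bilinear_rzero[OF bil])
  then have z: "g w x = 0" if "x \<in> set xs" for x
    using that by (subst (asm) sum_list_nonneg_eq_0_iff) auto
  define u where "u = (1 / sqrt (g w w)) *\<^sub>R w"
  have "g u u = 1"
    using pos[OF w(1)] by (simp add: u_def bilinear_lmul[OF bil] bilinear_rmul[OF bil] real_div_sqrt)
  moreover have "\<forall>x\<in>set xs. g u x = 0"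
    using z by (simp add: u_def bilinear_lmul[OF bil])
  ultimately show ?thesis by blast
qed

definition frame_of :: "(real ^ 6 \<Rightarrow> real ^ 6) \<Rightarrow> real ^ 6 \<Rightarrow> real ^ 6 \<Rightarrow> real ^ 6 \<Rightarrow> int \<Rightarrow> real ^ 6" where
  "frame_of J u v w i = (if i = 0 then u else if i = 1 then J u else if i = 2 then v
     else if i = 3 then J v else if i = 4 then w else J w)"

lemma frame_of_orthonormal:
  assumes g: "inner_form g" and J_J: "\<And>v. J (J v) = - v" and g_J: "\<And>u v. g (J u) (J v) = g u v"
    and n: "g u u = 1" "g v v = 1" "g w w = 1"
    and o: "g u v = 0" "g u (J v) = 0" "g u w = 0" "g u (J w) = 0" "g v w = 0" "g v (J w) = 0"
    and ij: "i \<in> {0..5}" "j \<in> {0..5}"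
  shows "g (frame_of J u v w i) (frame_of J u v w j) = (if i = j then 1 else 0)"
proof -
  have bil: "bilinear g" and sym: "\<And>u v. g u v = g v u"
    using g unfolding inner_form_def by blast+
  have J1: "g (J x) y = - g x (J y)" for x y
    using g_J[of "J x" y] by (simp add: J_J bilinear_lneg[OF bil])
  have J0: "g x (J x) = 0" for x
    using J1[of x x] sym[of x "J x"] by simp
  have cases: "k = 0 \<or> k = 1 \<or> k = 2 \<or> k = 3 \<or> k = 4 \<or> k = 5" if "k \<in> {0..5}" for k :: int
    using that by auto
  show ?thesis
    using cases[OF ij(1)] cases[OF ij(2)]
    by (elim disjE) (simp_all add: frame_of_def n o J0 J1 J_J bilinear_rneg[OF bil] bilinear_lneg[OF bil]
      sym[of v u] sym[of w u] sym[of w v] sym[of v "J u"] sym[of w "J u"] sym[of w "J v"])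
qed

text \<open>Unit vectors are chosen orthogonally to the complex lines of the previous ones. The
  normalisation of \<Omega> makes its value on them a phase, which is removed by rotating the last
  complex line.\<close>

lemma su3_frame_exists:
  assumes g: "inner_form g" and J: "linear J" and J_J: "\<And>v. J (J v) = - v"
    and g_J: "\<And>u v. g (J u) (J v) = g u v"
    and Op: "alternating 3 Op" and Om: "alternating 3 Om"
    and Op_J: "\<And>u v. Op (J u ## v) = - Om (u ## v)" and Om_J: "\<And>u v. Om (J u ## v) = Op (u ## v)"
    and om: "\<And>v. om v = g (J (v 0)) (v 1)"
    and norm: "\<And>v. 2 * wedge 4 2 (wedge 2 2 om om) om v = 3 * wedge 3 3 Op Om v"
  shows "\<exists>f. su3 g J Op Om f"
proof -
  have bil: "bilinear g" and sym: "\<And>u v. g u v = g v u"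
    using g unfolding inner_form_def by blast+
  have J1: "g x (J y) = - g (J x) y" for x y
    using g_J[of "J x" y] by (simp add: J_J bilinear_lneg[OF bil])
  obtain u where u: "g u u = 1" using exists_unit_orthogonal[OF g, of "[]"] by auto
  obtain v where v: "g v v = 1" "g v u = 0" "g v (J u) = 0"
    using exists_unit_orthogonal[OF g, of "[u, J u]"] by auto
  obtain w where w: "g w w = 1" "g w u = 0" "g w (J u) = 0" "g w v = 0" "g w (J v) = 0"
    using exists_unit_orthogonal[OF g, of "[u, J u, v, J v]"] by auto
  have o: "g u v = 0" "g u (J v) = 0" "g v w = 0" "g v (J w) = 0" "g u w = 0" "g u (J w) = 0"
    using v w J1[of v u] J1[of w u] J1[of w v] sym[of u v] sym[of v w] sym[of u w]
      sym[of u "J v"] sym[of v "J w"] sym[of u "J w"] by simp_all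
  have const: "a (x ## y ## z ## t) = a (x ## y ## z ## zs)" if "alternating 3 a" for a x y z t
    by (rule alternating_cong[OF that]) (auto simp: vcons_def numeral_3_eq_3 less_Suc_eq)
  \<comment> \<open>The last vector is left arbitrary: \<open>w\<close> is used to learn that the
    phase has modulus 1, and the rotated \<open>w'\<close> for the final frame.\<close>
  have frame: "su3_frame g J Op Om (frame_of J u v w')
      (Op (u ## v ## w' ## zs)) (Om (u ## v ## w' ## zs))"
    if w': "g w' w' = 1" "g v w' = 0" "g v (J w') = 0" "g u w' = 0" "g u (J w') = 0" for w'
  proof (unfold_locales; (fact assms)?)
    show "g (frame_of J u v w' i) (frame_of J u v w' j) = (if i = j then 1 else 0)"
      if "i \<in> {0..5}" "j \<in> {0..5}" for i j
      by (rule frame_of_orthonormal[OF g J_J g_J u v(1) w'(1) o(1,2) w'(4,5,2,3) that])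
    show "Op (frame_of J u v w' 0 ## frame_of J u v w' 2 ## frame_of J u v w' 4 ## t) = Op (u ## v ## w' ## zs)"
      "Om (frame_of J u v w' 0 ## frame_of J u v w' 2 ## frame_of J u v w' 4 ## t) = Om (u ## v ## w' ## zs)" for t
      using const[OF Op, of u v w' t] const[OF Om, of u v w' t] by (simp_all add: frame_of_def)
  qed (simp_all add: frame_of_def linear_add[OF J] linear_cmul[OF J])
  define p where "p = Op (u ## v ## w ## zs)"
  define q where "q = Om (u ## v ## w ## zs)"
  interpret F: su3_frame g J Op Om "frame_of J u v w" p q
    unfolding p_def q_def by (rule frame) (use w o in auto)
  have om: "om = F.om" by (auto simp: om F.om_def)
  have pq: "p * p + q * q = 1"
    using norm[of "frame_of J u v w 0 ## frame_of J u v w 1 ## frame_of J u v w 2 ## frame_of J u v w 3 ##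
        frame_of J u v w 4 ## frame_of J u v w 5 ## zs"] F.vol_f[of "\<lambda>_. 0"] F.wedge_Op_Om[of "\<lambda>_. 0"]
    by (simp add: om F.vol_def flip: F.om2_def)
  \<comment> \<open>Multiplication of \<open>w\<close> by the conjugate phase p - i q, with
    \<open>J\<close> acting as i; complex linearity of \<Omega> then yields the value p^2 + q^2 =
    1.\<close>
  define w' where "w' = p *\<^sub>R w - q *\<^sub>R J w"
  have Jw': "J w' = p *\<^sub>R J w + q *\<^sub>R w"
    by (simp add: w'_def linear_diff[OF J] linear_cmul[OF J] J_J)
  have wJw: "g w (J w) = 0" using J1[of w w] sym[of w "J w"] by simp
  note bl = bilinear_lsub[OF bil] bilinear_rsub[OF bil] bilinear_lmul[OF bil] bilinear_rmul[OF bil]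
    bilinear_radd[OF bil]
  have "g w' w' = 1"
    using pq by (simp add: w'_def bl w(1) wJw g_J sym[of "J w" w])
  moreover have "g v w' = 0" "g v (J w') = 0" "g u w' = 0" "g u (J w') = 0"
    using o by (simp_all add: Jw') (simp_all add: w'_def bl o)
  ultimately have F': "su3_frame g J Op Om (frame_of J u v w')
      (Op (u ## v ## w' ## zs)) (Om (u ## v ## w' ## zs))"
    by (rule frame)
  have lin: "linear (\<lambda>x. a (u ## v ## x ## zs))" if "alternating 3 a" for a
    using alternating_linear[OF alternating_iota[OF alternating_iota[OF that[unfolded numeral_3_eq_3]]], of v u "\<lambda>_. 0"]
    by (simp add: iota_def)
  have "Op (u ## v ## w' ## zs) = p * p + q * q" "Om (u ## v ## w' ## zs) = 0"
    unfolding w'_def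
    by (simp_all add: linear_diff[OF lin[OF Op]] linear_diff[OF lin[OF Om]] linear_cmul[OF lin[OF Op]]
        linear_cmul[OF lin[OF Om]] F.Op_J' F.Om_J' flip: p_def q_def)
  then have "su3 g J Op Om (frame_of J u v w')"
    using F' pq by (simp add: su3_def)
  then show ?thesis by blast
qed

section \<open>Integration by parts and bump functions\<close>

lemma set_integrable_compact_support:
  fixes F :: "'a::euclidean_space \<Rightarrow> real"
  assumes "continuous_on V F" "compact K" "K \<subseteq> V" "\<And>x. x \<in> V \<Longrightarrow> x \<notin> K \<Longrightarrow> F x = 0"
  shows "set_integrable lborel V F"
proof -
  have "integrable lborel (\<lambda>x. indicator K x *\<^sub>R F x)"
    by (rule borel_integrable_compact[OF assms(2) continuous_on_subset[OF assms(1,3)]])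
  moreover have "(\<lambda>x. indicator K x *\<^sub>R F x) = (\<lambda>x. indicator V x *\<^sub>R F x)"
    using assms(3,4) by (auto simp: fun_eq_iff indicator_def)
  ultimately show ?thesis unfolding set_integrable_def by simp
qed

text \<open>The integral of \<open>h\<close> is translation invariant, so the derivative of its translates integrates to 0.\<close>

lemma integral_directional_derivative_0:
  fixes h :: "'a::euclidean_space \<Rightarrow> real"
  assumes K: "compact K" "\<And>x. x \<notin> K \<Longrightarrow> h x = 0"
    and h: "\<And>x. (h has_derivative h' x) (at x)" and cont: "continuous_on UNIV (\<lambda>x. h' x e)"
  shows "(LINT x|lborel. h' x e) = 0"
proof -
  have hcont: "continuous_on UNIV h"
    using h has_derivative_continuous continuous_at_imp_continuous_on by blast
  have int: "integrable lborel h"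
    using set_integrable_compact_support[OF hcont K(1)] K(2) by (simp add: set_integrable_def)
  define T where "T = (\<lambda>n. inverse (real (Suc n)))"
  define Q where "Q = (\<lambda>n x. (h (T n *\<^sub>R e + x) - h x) / T n)"
  have T: "0 < T n" "T n \<le> 1" for n by (auto simp: T_def field_simps)
  have shift: "integrable lborel (\<lambda>x. h (c + x))" "(LINT x|lborel. h (c + x)) = (LINT x|lborel. h x)" for c
  proof -
    have "(LINT x|lborel. h x) = (LINT x|distr lborel borel ((+) c). h x)"
      by (simp only: lborel_distr_plus)
    also have "\<dots> = (LINT x|lborel. h (c + x))"
      using borel_measurable_continuous_onI[OF hcont] by (intro integral_distr) auto
    finally show "(LINT x|lborel. h (c + x)) = (LINT x|lborel. h x)" by simp
    have "integrable (distr lborel borel ((+) c)) h"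
      using int by (simp only: lborel_distr_plus)
    then show "integrable lborel (\<lambda>x. h (c + x))"
      using borel_measurable_continuous_onI[OF hcont] by (subst (asm) integrable_distr_eq) auto
  qed
  have Q0: "(LINT x|lborel. Q n x) = 0" for n
    unfolding Q_def using shift[of "T n *\<^sub>R e"] int by simp
  \<comment> \<open>Contains the supports of all difference quotients, as the increments
    \<open>T n\<close> are positive and at most 1. With the bound from the mean value theorem this
    gives the dominating function.\<close>
  define K' where "K' = (\<lambda>(k, t). k - t *\<^sub>R e) ` (K \<times> {0..1::real})"
  have K': "compact K'"
    unfolding K'_def
    by (intro compact_continuous_image compact_Times K(1) compact_Icc) (auto intro!: continuous_intros simp: case_prod_unfold)
  define Z where "Z = (\<lambda>x. h' x e)"
  have Z0: "Z x = 0" if "x \<notin> K" for x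
  proof -
    have "open (- K)" using K(1) compact_imp_closed by blast
    then have "((\<lambda>x. 0) has_derivative h' x) (at x)"
      using has_derivative_transform_within_open[OF h[of x], of "- K" "\<lambda>x. 0"] that K(2) by auto
    then have "h' x = (\<lambda>_. 0)"
      using has_derivative_unique[OF _ has_derivative_const] by blast
    then show ?thesis by (simp add: Z_def)
  qed
  have "compact (Z ` K)"
    by (rule compact_continuous_image[OF _ K(1)]) (use cont continuous_on_subset Z_def in blast)
  then have "bounded (Z ` K)" by (rule compact_imp_bounded)
  then obtain M where M: "\<And>x. x \<in> K \<Longrightarrow> \<bar>Z x\<bar> \<le> M"
    unfolding bounded_iff by auto
  define M' where "M' = max M 0"
  have M': "\<bar>Z x\<bar> \<le> M'" for x
    using M[of x] Z0[of x] by (cases "x \<in> K") (auto simp: M'_def)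
  have der: "((\<lambda>t. h (t *\<^sub>R e + x)) has_real_derivative Z (t *\<^sub>R e + x)) (at t)" for t x
  proof -
    have "((\<lambda>t. t *\<^sub>R e + x) has_derivative (\<lambda>r. r *\<^sub>R e)) (at t)"
      by (auto intro!: derivative_eq_intros)
    from has_derivative_compose[OF this h]
    have "((\<lambda>t. h (t *\<^sub>R e + x)) has_derivative (\<lambda>r. h' (t *\<^sub>R e + x) (r *\<^sub>R e))) (at t)" .
    moreover have "h' y (r *\<^sub>R e) = h' y e * r" for y r
      using linear_cmul[OF has_derivative_linear[OF h[of y]], of r e] by simp
    ultimately show ?thesis by (simp add: has_field_derivative_def Z_def)
  qed
  have bound: "\<bar>Q n x\<bar> \<le> M' * indicator K' x" for n x
  proof (cases "x \<in> K'")
    case True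
    obtain t where "0 < t" "t < T n"
      "h (T n *\<^sub>R e + x) - h (0 *\<^sub>R e + x) = (T n - 0) * Z (t *\<^sub>R e + x)"
      using MVT2[OF T(1)[of n], of "\<lambda>t. h (t *\<^sub>R e + x)" "\<lambda>t. Z (t *\<^sub>R e + x)"] der by blast
    then have "Q n x = Z (t *\<^sub>R e + x)" using T(1)[of n] by (simp add: Q_def)
    then show ?thesis using M' True by simp
  next
    case False
    have "x \<notin> K"
    proof
      assume "x \<in> K"
      then have "x = (\<lambda>(k, t). k - t *\<^sub>R e) (x, 0)" "(x, 0::real) \<in> K \<times> {0..1}" by auto
      then show False using False unfolding K'_def by blast
    qed
    moreover have "T n *\<^sub>R e + x \<notin> K"
    proof
      assume "T n *\<^sub>R e + x \<in> K"
      then have "x = (\<lambda>(k, t). k - t *\<^sub>R e) (T n *\<^sub>R e + x, T n)" "(T n *\<^sub>R e + x, T n) \<in> K \<times> {0..1}"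
        using T[of n] by auto
      then show False using False unfolding K'_def by blast
    qed
    ultimately show ?thesis by (simp add: Q_def K(2) False)
  qed
  have lim: "(\<lambda>n. Q n x) \<longlonglongrightarrow> Z x" for x
  proof -
    have "((\<lambda>t. (h ((0 + t) *\<^sub>R e + x) - h (0 *\<^sub>R e + x)) / t) \<longlongrightarrow> Z x) (at 0)"
      using der[of x 0] unfolding DERIV_def by simp
    moreover have "filterlim T (at 0) sequentially"
      unfolding filterlim_at T_def using LIMSEQ_inverse_real_of_nat by auto
    ultimately show ?thesis
      using filterlim_compose[of "\<lambda>t. (h ((0 + t) *\<^sub>R e + x) - h (0 *\<^sub>R e + x)) / t" "nhds (Z x)" "at 0" T sequentially]
      by (simp add: Q_def)
  qed
  have meas: "Q n \<in> borel_measurable lborel" for n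
    unfolding Q_def using borel_measurable_integrable[OF int] borel_measurable_integrable[OF shift(1)] by simp
  have "(\<lambda>n. LINT x|lborel. Q n x) \<longlonglongrightarrow> (LINT x|lborel. Z x)"
  proof (rule integral_dominated_convergence)
    show "integrable lborel (\<lambda>x. M' * indicator K' x)"
      using borel_integrable_compact[OF K', of "\<lambda>x. 1 :: real"] by (intro integrable_mult_right) simp
    show "Z \<in> borel_measurable lborel"
      using cont borel_measurable_continuous_onI by (simp add: Z_def)
  qed (use lim bound meas in auto)
  then show ?thesis
    by (simp add: Q0 Z_def LIMSEQ_const_iff)
qed

text \<open>\<open>sgn (p x)\<close> stands for the orientation of a chart. It is locally constant,
  since \<open>p\<close> is continuous without zeros, so it passes through the derivative. Extension
  by 0 then gives a function on the whole space.\<close>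

lemma integral_signed_derivative_0:
  fixes f :: "'a::euclidean_space \<Rightarrow> real"
  assumes V: "open V" and K: "compact K" "K \<subseteq> V" "\<And>x. x \<in> V \<Longrightarrow> x \<notin> K \<Longrightarrow> f x = 0"
    and f: "smooth_on V f" and p: "continuous_on V p" "\<And>x. x \<in> V \<Longrightarrow> p x \<noteq> (0::real)"
  shows "set_integrable lborel V (\<lambda>x. sgn (p x) * frechet_derivative f (at x) e)"
    "(LINT x:V|lborel. sgn (p x) * frechet_derivative f (at x) e) = 0"
proof -
  have oK: "open (- K)" using K(1) compact_imp_closed by blast
  have fd: "(f has_derivative frechet_derivative f (at x)) (at x)" if "x \<in> V" for x
    by (rule smooth_on_has_derivative[OF V f that])
  define h where "h = (\<lambda>x. if x \<in> V then sgn (p x) * f x else 0)"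
  define h' where "h' = (\<lambda>x w. if x \<in> V then sgn (p x) * frechet_derivative f (at x) w else 0)"
  have h0: "h x = 0" if "x \<notin> K" for x using that K(3) by (auto simp: h_def)
  have dh: "(h has_derivative h' x) (at x)" for x
  proof (cases "x \<in> V")
    case True
    \<comment> \<open>The neighbourhood on which the sign is constant.\<close>
    define U where "U = {y \<in> V. sgn (p y) = sgn (p x)}"
    have "open U"
    proof (cases "p x > 0")
      case True
      then have "U = V \<inter> p -` {0<..}" by (auto simp: U_def sgn_if split: if_splits)
      then show ?thesis using continuous_open_preimage[OF p(1) V, of "{0<..}"] by simp
    next
      case False
      then have "U = V \<inter> p -` {..<0}"
        using p(2)[OF \<open>x \<in> V\<close>] by (auto simp: U_def sgn_if split: if_splits)
      then show ?thesis using continuous_open_preimage[OF p(1) V, of "{..<0}"] by simp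
    qed
    have "x \<in> U" using True by (simp add: U_def)
    have "((\<lambda>y. sgn (p x) * f y) has_derivative h' x) (at x)"
      using has_derivative_mult_right[OF fd[OF True], of "sgn (p x)"] True by (simp add: h'_def)
    moreover have "sgn (p x) * f y = h y" if "y \<in> U" for y using that by (simp add: U_def h_def)
    ultimately show ?thesis
      using has_derivative_transform_within_open[OF _ \<open>open U\<close> \<open>x \<in> U\<close>] by blast
  next
    case False
    then have "x \<in> - K" using K(2) by auto
    moreover have "h' x = (\<lambda>_. 0)" using False by (auto simp: h'_def)
    ultimately show ?thesis
      using has_derivative_transform_within_open[OF has_derivative_const[of 0] oK, of x h] h0 by auto
  qed
  have der0: "h' x e = 0" if "x \<notin> K" for x
  proof -
    have "((\<lambda>x. 0) has_derivative h' x) (at x)"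
      using has_derivative_transform_within_open[OF dh[of x] oK, of "\<lambda>x. 0"] that h0 by auto
    then have "h' x = (\<lambda>_. 0)"
      using has_derivative_unique[OF _ has_derivative_const] by blast
    then show ?thesis by simp
  qed
  have contV: "continuous_on V (\<lambda>x. sgn (p x) * frechet_derivative f (at x) e)"
    by (intro continuous_intros p smooth_on_imp_continuous_on smooth_on_derivative f) (use p in auto)
  have cont: "continuous_on UNIV (\<lambda>x. h' x e)"
  proof -
    have "continuous_on (V \<union> - K) (\<lambda>x. h' x e)"
    proof (rule continuous_on_open_Un[OF V oK])
      show "continuous_on V (\<lambda>x. h' x e)"
        by (rule continuous_on_eq[OF contV]) (simp add: h'_def)
      show "continuous_on (- K) (\<lambda>x. h' x e)"
        by (rule continuous_on_eq[OF continuous_on_const[of _ 0]]) (simp add: der0)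
    qed
    moreover have "V \<union> - K = UNIV" using K(2) by auto
    ultimately show ?thesis by simp
  qed
  show "set_integrable lborel V (\<lambda>x. sgn (p x) * frechet_derivative f (at x) e)"
  proof (rule set_integrable_compact_support[OF contV K(1,2)])
    fix x assume "x \<in> V" "x \<notin> K"
    then show "sgn (p x) * frechet_derivative f (at x) e = 0"
      using der0[of x] by (simp add: h'_def)
  qed
  have "(LINT x:V|lborel. sgn (p x) * frechet_derivative f (at x) e) = (LINT x|lborel. h' x e)"
    unfolding set_lebesgue_integral_def by (intro Bochner_Integration.integral_cong) (auto simp: h'_def)
  also have "\<dots> = 0"
    by (rule integral_directional_derivative_0[OF K(1) h0 dh cont])
  finally show "(LINT x:V|lborel. sgn (p x) * frechet_derivative f (at x) e) = 0" .
qed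

lemma integral_signed_ext_d_0:
  assumes V: "open V" and K: "compact K" "K \<subseteq> V" "\<And>x v. x \<in> V \<Longrightarrow> x \<notin> K \<Longrightarrow> a x v = 0"
    and a: "form_on k V a" and p: "continuous_on V p" "\<And>x. x \<in> V \<Longrightarrow> p x \<noteq> (0::real)"
  shows "(LINT x:V|lborel. sgn (p x) * ext_d k a x v) = 0"
proof -
  note * = integral_signed_derivative_0[OF V K(1,2) K(3) form_on_smooth[OF a] p]
  have "(LINT x:V|lborel. sgn (p x) * ext_d k a x v) =
      (LINT x:V|lborel. \<Sum>i\<le>k. (-1) ^ i * (sgn (p x) * frechet_derivative (\<lambda>y. a y (drop_at i v)) (at x) (v i)))"
    by (simp add: ext_d_eq_drop_at sum_distrib_left mult.left_commute)
  also have "\<dots> = (\<Sum>i\<le>k. LINT x:V|lborel. (-1) ^ i * (sgn (p x) * frechet_derivative (\<lambda>y. a y (drop_at i v)) (at x) (v i)))"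
    unfolding set_lebesgue_integral_def scaleR_sum_right
    by (rule Bochner_Integration.integral_sum)
      (use set_integrable_mult_right[OF *(1)] in \<open>simp add: set_integrable_def\<close>)
  also have "\<dots> = 0"
    by (simp add: *)
  finally show ?thesis .
qed

text \<open>The derivatives of \<open>exp (-1/t)\<close> are linear combinations of these functions.\<close>

definition flat :: "nat \<Rightarrow> real \<Rightarrow> real" where
  "flat m t = (if t > 0 then exp (- inverse t) * inverse t ^ m else 0)"

lemma flat_tendsto: "((\<lambda>t. flat m t) \<longlongrightarrow> 0) (at 0)"
proof -
  have "((\<lambda>t. inverse t ^ m / exp (inverse t)) \<longlongrightarrow> (0::real)) (at_right 0)"
    by (rule filterlim_compose[OF tendsto_power_div_exp_0 filterlim_inverse_at_top_right])
  then have "((\<lambda>t. flat m t) \<longlongrightarrow> 0) (at_right 0)"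
    by (rule Lim_transform_eventually)
      (auto simp: eventually_at_right_field flat_def exp_minus field_simps intro!: exI[of _ 1])
  moreover have "((\<lambda>t. flat m t) \<longlongrightarrow> 0) (at_left 0)"
    by (rule Lim_transform_eventually[OF tendsto_const])
      (auto simp: eventually_at_left_field flat_def intro!: exI[of _ "-1"])
  ultimately show ?thesis by (simp add: filterlim_split_at)
qed

lemma flat_derivative: "(flat m has_real_derivative (flat (m + 2) t - m * flat (m + 1) t)) (at t)"
proof (cases "t > 0" "t < 0" rule: bool.exhaust[case_product bool.exhaust])
  case True_True
  then show ?thesis by simp
next
  case True_False
  then have t: "t > 0" by simp
  have "((\<lambda>t. exp (- inverse t) * inverse t ^ m) has_real_derivative
      exp (- inverse t) * (inverse t)\<^sup>2 * inverse t ^ m -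
      exp (- inverse t) * (m * inverse t ^ (m - 1) * (inverse t)\<^sup>2)) (at t)"
    using t by (auto intro!: derivative_eq_intros simp: power2_eq_square)
  also have "m * inverse t ^ (m - 1) * (inverse t)\<^sup>2 = m * inverse t ^ (m + 1)"
    by (cases m) (auto simp: power2_eq_square)
  finally have "((\<lambda>t. exp (- inverse t) * inverse t ^ m) has_real_derivative
      (flat (m + 2) t - m * flat (m + 1) t)) (at t)"
    using t by (simp add: flat_def power_add mult_ac power2_eq_square)
  then show ?thesis
    by (rule has_field_derivative_transform_within_open[of _ _ _ "{0<..}"]) (use t in \<open>auto simp: flat_def\<close>)
next
  case False_True
  have "((\<lambda>t. 0) has_real_derivative 0) (at t)" by simp
  then have "(flat m has_real_derivative 0) (at t)"
    by (rule has_field_derivative_transform_within_open[of _ _ _ "{..<0}"]) (use False_True in \<open>auto simp: flat_def\<close>)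
  then show ?thesis using False_True by (simp add: flat_def)
next
  case False_False
  then have t: "t = 0" by simp
  \<comment> \<open>The difference quotient of \<open>flat m\<close> at 0 is
    \<open>flat (m + 1)\<close>.\<close>
  have "((\<lambda>t. flat m (0 + t) / t) \<longlongrightarrow> 0) (at 0)"
    using flat_tendsto[of "m + 1"]
    by (rule Lim_transform_eventually) (auto simp: eventually_at_filter flat_def field_simps)
  then have "(flat m has_real_derivative 0) (at 0)"
    unfolding DERIV_def by (simp add: flat_def[of m 0])
  then show ?thesis using t by (simp add: flat_def)
qed

lemma Ck_on_flat:
  fixes q :: "'a::real_normed_vector \<Rightarrow> real"
  assumes S: "open S" and q: "\<And>n. Ck_on n S q"
  shows "Ck_on n S (\<lambda>x. flat m (q x))"
proof (induction n arbitrary: m)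
  case 0
  have "continuous_on UNIV (flat m)"
    using flat_derivative DERIV_isCont continuous_at_imp_continuous_on by blast
  then show ?case
    using continuous_on_compose2[OF _ Ck_on_continuous[OF q]] by auto
next
  case (Suc n)
  show ?case
  proof (rule Ck_on_SucI[OF S])
    fix x assume x: "x \<in> S"
    note dq = Ck_on_SucE(1)[OF S q x]
    show "((\<lambda>x. flat m (q x)) has_derivative
        (\<lambda>w. (flat (m + 2) (q x) + (- real m) * flat (m + 1) (q x)) * frechet_derivative q (at x) w)) (at x)"
      using has_derivative_compose[OF dq flat_derivative[of m "q x", unfolded has_field_derivative_def]] by simp
  next
    show "Ck_on n S (\<lambda>x. (flat (m + 2) (q x) + (- real m) * flat (m + 1) (q x)) * frechet_derivative q (at x) v)" for v
      by (intro Ck_on_mult Ck_on_add Ck_on_const S Suc.IH Ck_on_SucE(2)[OF S q])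
  qed
qed

text \<open>exp(-1/t) is evaluated at t = r^2 - |x - x0|^2. The squared distance is written in
  coordinates so that the closure rules for sums and products apply.\<close>

lemma exists_bump:
  fixes x0 :: "'a::euclidean_space"
  assumes "r > 0"
  obtains \<psi> :: "'a \<Rightarrow> real" where "\<And>V. open V \<Longrightarrow> smooth_on V \<psi>" "\<And>x. \<psi> x \<ge> 0" "\<psi> x0 > 0"
    "\<And>x. x \<notin> cball x0 r \<Longrightarrow> \<psi> x = 0"
proof
  let ?q = "\<lambda>x. r\<^sup>2 + (\<Sum>b\<in>Basis. (-1) * (((x \<bullet> b) + (- (x0 \<bullet> b))) * ((x \<bullet> b) + (- (x0 \<bullet> b)))))"
  let ?f = "\<lambda>x. flat 0 (?q x)"
  have q: "?q x = r\<^sup>2 - (dist x0 x)\<^sup>2" for x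
  proof -
    have "(dist x0 x)\<^sup>2 = (\<Sum>b\<in>Basis. ((x - x0) \<bullet> b) * ((x - x0) \<bullet> b))"
      unfolding dist_commute[of x0 x] unfolding dist_norm power2_norm_eq_inner by (rule euclidean_inner)
    then show ?thesis by (simp add: inner_diff_left sum_negf)
  qed
  show "smooth_on V ?f" if "open V" for V
  proof -
    have id: "Ck_on n V (\<lambda>x. x)" for n
    proof (cases n)
      case (Suc n)
      then show ?thesis
        by (auto intro!: Ck_on_SucI[where f' = "\<lambda>_ v. v"] that Ck_on_const)
    qed (simp add: continuous_on_id)
    have "smooth_on V ?q"
      by (intro smooth_on_add smooth_on_const smooth_on_sum smooth_on_mult that
          smooth_on_bounded_linear[OF bounded_linear_inner_left])
        (simp_all add: smooth_on_def id)
    then show ?thesis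
      unfolding smooth_on_def using Ck_on_flat[OF that, of ?q] by blast
  qed
  show "?f x \<ge> 0" for x by (simp add: flat_def)
  show "?f x0 > 0" using assms unfolding q by (simp add: flat_def)
  show "?f x = 0" if "x \<notin> cball x0 r" for x
  proof -
    have "r\<^sup>2 < (dist x0 x)\<^sup>2" using that assms by (intro power_strict_mono) auto
    then show ?thesis unfolding q by (simp add: flat_def)
  qed
qed

text \<open>A nonnegative continuous function with integral 0 is nonzero only on an open null set,
  and such a set is empty.\<close>

lemma integral_0_imp_0:
  fixes F :: "'a::euclidean_space \<Rightarrow> real"
  assumes V: "open V" and F: "continuous_on V F" "\<And>x. x \<in> V \<Longrightarrow> F x \<ge> 0"
    and K: "compact K" "K \<subseteq> V" "\<And>x. x \<in> V \<Longrightarrow> x \<notin> K \<Longrightarrow> F x = 0"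
    and int: "(LINT x:V|lborel. F x) = 0" and x: "x \<in> V"
  shows "F x = 0"
proof -
  have "integrable lborel (\<lambda>x. indicator V x *\<^sub>R F x)"
    using set_integrable_compact_support[OF F(1) K] by (simp add: set_integrable_def)
  then have "AE x in lborel. indicator V x *\<^sub>R F x = 0"
    using integral_nonneg_eq_0_iff_AE[of lborel "\<lambda>x. indicator V x *\<^sub>R F x"] int F(2)
    by (auto simp: set_lebesgue_integral_def indicator_def)
  then have "AE x in lborel. x \<notin> V \<inter> F -` (- {0})"
    by eventually_elim (auto simp: indicator_def)
  moreover have "open (V \<inter> F -` (- {0}))"
    by (rule continuous_open_preimage[OF F(1) V]) auto
  ultimately have "V \<inter> F -` (- {0}) \<in> null_sets lborel"
    by (subst (asm) AE_iff_null_sets[symmetric]) auto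
  then have "negligible (V \<inter> F -` (- {0}))"
    by (simp add: negligible_iff_null_sets null_sets_completionI)
  then have "V \<inter> F -` (- {0}) = {}"
    using open_not_negligible \<open>open (V \<inter> F -` (- {0}))\<close> by blast
  then show ?thesis using x by auto
qed

section \<open>Forms on the manifold\<close>

text \<open>\<open>wedge_iota\<close> concerns real forms, whereas \<open>dz123\<close> is complex;
  its sums over permutations of two and three letters are unrolled with this recursion.\<close>

lemma sum_sign_permutes_Suc:
  fixes F :: "(nat \<Rightarrow> nat) \<Rightarrow> 'b::comm_ring_1"
  shows "(\<Sum>\<sigma> | \<sigma> permutes {..<Suc n}. of_int (sign \<sigma>) * F \<sigma>) =
    (\<Sum>j\<le>n. \<Sum>\<tau> | \<tau> permutes {..<n}. of_int (sign \<tau>) * ((-1) ^ j * F (lift_perm \<tau> \<circ> cyc j)))"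
  unfolding sum_permutes_Suc
  by (intro sum.cong refl) (simp add: sign_lift_cyc mult_ac)

lemma J_std_components: "J_std v $ 1 = - v $ 2" "J_std v $ 2 = v $ 1" "J_std v $ 3 = - v $ 4"
  "J_std v $ 4 = v $ 3" "J_std v $ 5 = - v $ 6" "J_std v $ 6 = v $ 5"
  by (simp_all add: J_std_def vector_def)

text \<open>\<open>dz123\<close> is the 3 by 3 determinant of the complex coordinates of its
  arguments, and each coordinate satisfies z(J x) = i z(x).\<close>

lemma dz123_J_std: "dz123 (J_std u ## v) = \<i> * dz123 (u ## v)"
proof -
  define \<zeta> :: "nat \<Rightarrow> real ^ 6 \<Rightarrow> complex" where
    "\<zeta> k x = (if k = 1 then Complex (x $ 1) (x $ 2) else if k = 2 then Complex (x $ 3) (x $ 4) else Complex (x $ 5) (x $ 6))" for k x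
  have dz: "dz1 w = \<zeta> 1 (w 0)" "dz2 w = \<zeta> 2 (w 0)" "dz3 w = \<zeta> 3 (w 0)" for w
    by (simp_all add: dz1_def dz2_def dz3_def \<zeta>_def)
  have J: "\<zeta> k (J_std x) = \<i> * \<zeta> k x" for k x
    by (simp add: \<zeta>_def J_std_components complex_eq_iff)
  have w2: "wedge 1 1 dz2 dz3 w = \<zeta> 2 (w 0) * \<zeta> 3 (w 1) - \<zeta> 2 (w 1) * \<zeta> 3 (w 0)" for w
    unfolding wedge_def
    by (simp add: mult.assoc numeral_2_eq_2 sum_sign_permutes_Suc dz lift_perm_def cyc_def)
  have w3: "dz123 w = \<zeta> 1 (w 0) * (\<zeta> 2 (w 1) * \<zeta> 3 (w 2) - \<zeta> 2 (w 2) * \<zeta> 3 (w 1))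
    - \<zeta> 1 (w 1) * (\<zeta> 2 (w 0) * \<zeta> 3 (w 2) - \<zeta> 2 (w 2) * \<zeta> 3 (w 0))
    + \<zeta> 1 (w 2) * (\<zeta> 2 (w 0) * \<zeta> 3 (w 1) - \<zeta> 2 (w 1) * \<zeta> 3 (w 0))" for w
    unfolding dz123_def wedge_def[of 1 2]
    by (simp add: mult.assoc numeral_2_eq_2 numeral_3_eq_3 sum_sign_permutes_Suc w2 del: One_nat_def)
      (simp add: dz lift_perm_def cyc_def algebra_simps)
  show ?thesis
    by (simp add: w3 J numeral_2_eq_2 algebra_simps)
qed

lemma dz123_J_std_Re: "Re (c * dz123 (J_std u ## v)) = - Im (c * dz123 (u ## v))"
  and dz123_J_std_Im: "Im (c * dz123 (J_std u ## v)) = Re (c * dz123 (u ## v))"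
  by (simp_all add: dz123_J_std)

definition basis_seq :: "nat \<Rightarrow> real ^ 6" where
  "basis_seq = (\<lambda>i. axis (of_nat (Suc i)) 1)"

text \<open>A nonzero top form cannot vanish on a basis. In a chart this makes the volume density
  positive and provides the function whose sign is the orientation.\<close>

lemma alternating_6_basis_nonzero:
  assumes w: "alternating 6 w" "w e \<noteq> 0"
  shows "w basis_seq \<noteq> 0"
proof
  assume 0: "w basis_seq = 0"
  let ?fs = "map basis_seq [0, 1, 2, 3, 4, 5]"
  let ?v = "basis_seq 0 ## basis_seq 1 ## basis_seq 2 ## basis_seq 3 ## basis_seq 4 ## basis_seq 5 ## zs"
  \<comment> \<open>In the index type 6 equals 0, so the representatives 1 to 6 cover all
    elements.\<close>
  have six: "\<exists>i\<in>set [0, 1, 2, 3, 4, 5 :: nat]. k = (of_nat (Suc i) :: 6)" for k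
  proof (cases k rule: bit0_cases)
    case (of_int z)
    then have "z \<in> {0, 1, 2, 3, 4, 5}" by auto
    then show ?thesis using of_int(1) by (elim insertE emptyE) simp_all
  qed
  have ax: "axis k 1 \<in> set ?fs" for k
  proof -
    obtain i where i: "i \<in> set [0, 1, 2, 3, 4, 5 :: nat]" "k = of_nat (Suc i)" using six by blast
    have "axis k 1 = basis_seq i" by (simp only: basis_seq_def i(2))
    then show ?thesis using i(1) unfolding set_map by (rule image_eqI)
  qed
  have "x \<in> span (set ?fs)" for x :: "real ^ 6"
  proof -
    have "(\<Sum>i\<in>UNIV. x $ i *\<^sub>R axis i 1) \<in> span (set ?fs)"
      by (intro span_sum span_scale span_base ax)
    then show ?thesis
      using basis_expansion[of x] by (simp only: scalar_mult_eq_scaleR)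
  qed
  then have sp: "span (set ?fs) = UNIV" by blast
  have "w ?v = w basis_seq"
  proof (rule alternating_cong[OF w(1)])
    fix i :: nat assume "i < 6"
    then have "i = 0 \<or> i = Suc 0 \<or> i = Suc (Suc 0) \<or> i = Suc (Suc (Suc 0)) \<or>
        i = Suc (Suc (Suc (Suc 0))) \<or> i = Suc (Suc (Suc (Suc (Suc 0))))" by linarith
    then show "?v i = basis_seq i"
      by (elim disjE) (simp_all add: numeral_eq_Suc)
  qed
  then have "agree ?fs 6 w (\<lambda>v. 0)" using 0 by (simp add: iota_def del: One_nat_def)
  from agree_eq[OF sp w(1) alternating_zero this] show False using w(2) by simp
qed

locale cy =
  fixes N :: "'m::{t2_space, second_countable_topology} cy_data"
  assumes cy: "calabi_yau6 N"
begin

lemma chart: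
  assumes "c \<in> Atlas N"
  shows open_cimg: "open (cimg c)" and inj_chart: "inj_on (snd c) (fst c)"
    and open_dom: "open (fst c)"
    and chart_homeo: "homeomorphism (fst c) (cimg c) (snd c) (inv_into (fst c) (snd c))"
proof -
  show 1: "open (cimg c)" "open (fst c)"
    "homeomorphism (fst c) (cimg c) (snd c) (inv_into (fst c) (snd c))"
    using cy assms unfolding calabi_yau6_def smooth_atlas_def by blast+
  from 1(3) show "inj_on (snd c) (fst c)"
    by (intro inj_on_inverseI[where g = "inv_into (fst c) (snd c)"]) (auto simp: homeomorphism_def)
qed

lemma open_overlap:
  assumes "c \<in> Atlas N" "d \<in> Atlas N"
  shows "open (overlap c d)"
proof -
  have "openin (top_of_set (cimg c)) (snd c ` (fst c \<inter> fst d))"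
    by (rule homeomorphism_imp_open_map[OF chart_homeo[OF assms(1)]])
      (use open_dom[OF assms(2)] in \<open>auto simp: openin_open\<close>)
  then show ?thesis
    using open_cimg[OF assms(1)] openin_open_eq unfolding overlap_def by blast
qed

lemma overlap_subset: "overlap c d \<subseteq> cimg c"
  by (auto simp: overlap_def cimg_def)

lemma transition_in:
  assumes "c \<in> Atlas N" "x \<in> overlap c d"
  shows "transition c d x \<in> cimg d"
  using assms inj_chart[OF assms(1)] by (auto simp: overlap_def transition_def cimg_def)

lemma smooth_transition: "c \<in> Atlas N \<Longrightarrow> d \<in> Atlas N \<Longrightarrow> smooth_on (overlap c d) (transition c d)"
  using cy by (auto simp: calabi_yau6_def smooth_atlas_def)

lemma linear_dtransition:
  assumes "c \<in> Atlas N" "d \<in> Atlas N" "x \<in> overlap c d"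
  shows "linear (dtransition c d x)"
  unfolding dtransition_def
  using smooth_on_has_derivative[OF open_overlap smooth_transition] assms has_derivative_linear by blast

lemma holomorphic_chart_at:
  assumes "x \<in> cimg c"
  obtains d where "d \<in> Atlas N" "holomorphic_chart N d" "x \<in> overlap c d"
proof -
  obtain p where p: "p \<in> fst c" "x = snd c p" using assms by (auto simp: cimg_def)
  obtain d where d: "holomorphic_chart N d" "p \<in> fst d"
    using cy unfolding calabi_yau6_def complex_structure_def by blast
  show ?thesis
    by (rule that[of d]) (use d p in \<open>auto simp: holomorphic_chart_def overlap_def\<close>)
qed

lemma J_linear: "c \<in> Atlas N \<Longrightarrow> x \<in> cimg c \<Longrightarrow> linear (Jcx N c x)"
  and J_J: "c \<in> Atlas N \<Longrightarrow> x \<in> cimg c \<Longrightarrow> Jcx N c x (Jcx N c x v) = - v"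
  and smooth_J: "c \<in> Atlas N \<Longrightarrow> smooth_on (cimg c) (\<lambda>x. Jcx N c x v)"
  and J_transition: "c \<in> Atlas N \<Longrightarrow> d \<in> Atlas N \<Longrightarrow> x \<in> overlap c d \<Longrightarrow>
    dtransition c d x (Jcx N c x v) = Jcx N d (transition c d x) (dtransition c d x v)"
  using cy by (auto simp: calabi_yau6_def complex_structure_def endomorphism_field_def)

lemma Met_inner: "c \<in> Atlas N \<Longrightarrow> x \<in> cimg c \<Longrightarrow> inner_form (Met N c x)"
  and Met_J: "c \<in> Atlas N \<Longrightarrow> x \<in> cimg c \<Longrightarrow> Met N c x (Jcx N c x u) (Jcx N c x v) = Met N c x u v"
  and smooth_Met: "c \<in> Atlas N \<Longrightarrow> smooth_on (cimg c) (\<lambda>x. Met N c x u v)"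
  and Met_transition: "c \<in> Atlas N \<Longrightarrow> d \<in> Atlas N \<Longrightarrow> x \<in> overlap c d \<Longrightarrow>
    Met N c x u v = Met N d (transition c d x) (dtransition c d x u) (dtransition c d x v)"
  using cy by (auto simp: calabi_yau6_def kaehler_def riemannian_metric_def inner_form_def)

text \<open>\<open>Forms\<close> without the convention that representatives vanish outside the
  charts, which pointwise operations such as \<open>hodge\<close> do not address.\<close>

definition fieldform :: "nat \<Rightarrow> ('m, real) field_form \<Rightarrow> bool" where
  "fieldform k a \<longleftrightarrow> (\<forall>c\<in>Atlas N. form_on k (cimg c) (a c)) \<and>
     (\<forall>c\<in>Atlas N. \<forall>d\<in>Atlas N. \<forall>x\<in>overlap c d.
        a c x = pull (dtransition c d x) (a d (transition c d x)))"

lemma fieldform_form_on: "fieldform k a \<Longrightarrow> c \<in> Atlas N \<Longrightarrow> form_on k (cimg c) (a c)"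
  by (simp add: fieldform_def)

lemma fieldform_alternating: "fieldform k a \<Longrightarrow> c \<in> Atlas N \<Longrightarrow> x \<in> cimg c \<Longrightarrow> alternating k (a c x)"
  by (auto simp: fieldform_def form_on_def)

lemma fieldform_transition: "fieldform k a \<Longrightarrow> c \<in> Atlas N \<Longrightarrow> d \<in> Atlas N \<Longrightarrow> x \<in> overlap c d \<Longrightarrow>
    a c x = pull (dtransition c d x) (a d (transition c d x))"
  by (simp add: fieldform_def)

lemma Forms_fieldform: "a \<in> Forms (Atlas N) k \<Longrightarrow> fieldform k a"
  by (auto simp: Forms_def fieldform_def form_on_def)

text \<open>Restores that convention, so that the result is an admissible value of the definite
  description in \<open>codiff\<close>.\<close>

definition restr :: "('m, real) field_form \<Rightarrow> ('m, real) field_form" where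
  "restr a = (\<lambda>c x. if c \<in> Atlas N \<and> x \<in> cimg c then a c x else (\<lambda>v. 0))"

lemma restr_Forms:
  assumes "fieldform k a"
  shows "restr a \<in> Forms (Atlas N) k"
  unfolding Forms_def
proof (intro CollectI conjI ballI allI impI)
  fix c x assume c: "c \<in> Atlas N" and x: "x \<in> cimg c"
  then show "alternating k (restr a c x)"
    using fieldform_alternating[OF assms] by (simp add: restr_def)
next
  fix c v assume c: "c \<in> Atlas N"
  have "smooth_on (cimg c) (\<lambda>x. restr a c x v) \<longleftrightarrow> smooth_on (cimg c) (\<lambda>x. a c x v)"
    using c by (intro smooth_on_cong open_cimg) (auto simp: restr_def)
  then show "smooth_on (cimg c) (\<lambda>x. restr a c x v)"
    using form_on_smooth[OF fieldform_form_on[OF assms c]] by simp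
next
  fix c d x assume "c \<in> Atlas N" "d \<in> Atlas N" "x \<in> overlap c d"
  then show "restr a c x = pull (dtransition c d x) (restr a d (transition c d x))"
    using fieldform_transition[OF assms, of c d x] overlap_subset[of c d] transition_in[of c x d]
    by (simp add: restr_def subset_iff)
qed (auto simp: restr_def)

lemma fieldform_wedge:
  assumes a: "fieldform p a" and b: "fieldform q b" and n: "p + q = n"
  shows "fieldform n (wedgeF p q a b)"
  unfolding fieldform_def
proof (intro conjI ballI)
  fix c assume c: "c \<in> Atlas N"
  show "form_on n (cimg c) (wedgeF p q a b c)"
    using form_on_wedge[OF open_cimg[OF c] fieldform_form_on[OF a c] fieldform_form_on[OF b c] n]
    by (simp add: wedgeF_def[abs_def])
next
  fix c d x assume *: "c \<in> Atlas N" "d \<in> Atlas N" "x \<in> overlap c d"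
  show "wedgeF p q a b c x = pull (dtransition c d x) (wedgeF p q a b d (transition c d x))"
    by (simp only: wedgeF_def fieldform_transition[OF a *] fieldform_transition[OF b *] wedge_pull)
qed

lemma fieldform_dF:
  assumes a: "fieldform k a"
  shows "fieldform (Suc k) (dF k a)"
  unfolding fieldform_def dF_def
proof (intro conjI ballI)
  fix c assume c: "c \<in> Atlas N"
  show "form_on (Suc k) (cimg c) (ext_d k (a c))"
    by (rule form_on_ext_d[OF open_cimg[OF c] fieldform_form_on[OF a c]])
next
  fix c d x assume *: "c \<in> Atlas N" "d \<in> Atlas N" "x \<in> overlap c d"
  have "ext_d k (a c) x = ext_d k (\<lambda>y. pull (frechet_derivative (transition c d) (at y)) (a d (transition c d y))) x"
    by (rule ext_d_cong[OF open_overlap[OF *(1,2)] *(3)])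
      (use fieldform_transition[OF a *(1,2)] in \<open>simp add: dtransition_def\<close>)
  also have "\<dots> = pull (frechet_derivative (transition c d) (at x)) (ext_d k (a d) (transition c d x))"
    by (rule ext_d_pull[OF open_overlap[OF *(1,2)] open_cimg[OF *(2)] smooth_transition[OF *(1,2)] _
      fieldform_form_on[OF a *(2)] *(3)]) (intro image_subsetI transition_in[OF *(1)])
  finally show "ext_d k (a c) x = pull (dtransition c d x) (ext_d k (a d) (transition c d x))"
    by (simp add: dtransition_def)
qed

lemma fieldform_kform: "fieldform 2 (kform N)"
  unfolding fieldform_def
proof (intro conjI ballI)
  fix c assume c: "c \<in> Atlas N"
  note oc = open_cimg[OF c]
  have bil: "bilinear (Met N c x)" if "x \<in> cimg c" for x
    using Met_inner[OF c that] by (simp add: inner_form_def)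
  show "form_on 2 (cimg c) (kform N c)"
    unfolding form_on_def
  proof (intro conjI ballI allI)
    fix v :: "nat \<Rightarrow> real ^ 6"
    \<comment> \<open>The metric is smooth for fixed arguments only, so the moving vector J v is
      expanded in coordinates.\<close>
    have "smooth_on (cimg c) (\<lambda>x. \<Sum>b\<in>UNIV. Jcx N c x (v 0) $ b * Met N c x (axis b 1) (v 1))"
      by (intro smooth_on_sum smooth_on_mult oc smooth_Met[OF c]
        smooth_on_bounded_linear[OF bounded_linear_vec_nth oc smooth_J[OF c]])
    moreover have "(\<Sum>b\<in>UNIV. Jcx N c x (v 0) $ b * Met N c x (axis b 1) (v 1)) = kform N c x v" if "x \<in> cimg c" for x
      using linear_expand_axis[of "\<lambda>u. Met N c x u (v 1)" "Jcx N c x (v 0)"] bil[OF that]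
      by (simp add: kform_def bilinear_def)
    ultimately show "smooth_on (cimg c) (\<lambda>x. kform N c x v)"
      using smooth_on_cong[OF oc, of "\<lambda>x. \<Sum>b\<in>UNIV. Jcx N c x (v 0) $ b * Met N c x (axis b 1) (v 1)" "\<lambda>x. kform N c x v"]
      by blast
  next
    fix x assume x: "x \<in> cimg c"
    have sym: "Met N c x u v = Met N c x v u" for u v
      using Met_inner[OF c x] by (simp add: inner_form_def)
    show "alternating 2 (kform N c x)"
      unfolding numeral_2_eq_2
    proof (intro alternatingI_Suc)
      show "linear (\<lambda>u. kform N c x (u ## v))" for v
        using linear_compose[OF J_linear[OF c x], of "\<lambda>u. Met N c x u (v 0)"] bil[OF x]
        by (simp add: kform_def bilinear_def o_def)
      show "linear (\<lambda>ua. iota u (kform N c x) (ua ## v))" for u v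
        using bil[OF x] by (simp add: kform_def iota_def bilinear_def)
      show "alternating 0 (iota u (iota v (kform N c x)))" for u v
        by (simp add: alternating_0_iff kform_def iota_def)
      show "kform N c x (u ## u ## v) = 0" for u v
        using Met_J[OF c x, of "Jcx N c x u" u] J_J[OF c x, of u] sym[of u "Jcx N c x u"]
        by (simp add: kform_def bilinear_lneg[OF bil[OF x]])
    qed auto
  qed
next
  fix c d x assume *: "c \<in> Atlas N" "d \<in> Atlas N" "x \<in> overlap c d"
  show "kform N c x = pull (dtransition c d x) (kform N d (transition c d x))"
    by (simp add: fun_eq_iff kform_def pull_def Met_transition[OF *] J_transition[OF *])
qed

lemma fieldform_kform2: "fieldform 4 (kform2 N)"
  unfolding kform2_def by (rule fieldform_wedge[OF fieldform_kform fieldform_kform]) simp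

lemma fieldform_cmult:
  assumes "fieldform k a"
  shows "fieldform k (\<lambda>c x v. r * a c x v)"
  unfolding fieldform_def
proof (intro conjI ballI)
  show "form_on k (cimg c) (\<lambda>x v. r * a c x v)" if "c \<in> Atlas N" for c
    by (rule form_on_cmult[OF open_cimg[OF that] fieldform_form_on[OF assms that]])
next
  fix c d x assume *: "c \<in> Atlas N" "d \<in> Atlas N" "x \<in> overlap c d"
  show "(\<lambda>v. r * a c x v) = pull (dtransition c d x) (\<lambda>v. r * a d (transition c d x) v)"
    by (simp add: fieldform_transition[OF assms *] pull_def)
qed

lemma fieldform_volF: "fieldform 6 (volF N)"
proof -
  have "fieldform 6 (kform3 N)"
    unfolding kform3_def by (rule fieldform_wedge[OF fieldform_kform2 fieldform_kform]) simp
  from fieldform_cmult[OF this, of "1/6"] show ?thesis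
    by (simp add: volF_def[abs_def])
qed

lemma fieldform_Om: "fieldform 3 (Om_re N)" "fieldform 3 (Om_im N)"
  using cy by (auto simp: calabi_yau6_def holomorphic_volume_form_def intro: Forms_fieldform)

lemma fieldform_Jstar:
  assumes a: "fieldform 1 a"
  shows "fieldform 1 (Jstar N a)"
  unfolding fieldform_def
proof (intro conjI ballI)
  fix c assume c: "c \<in> Atlas N"
  note oc = open_cimg[OF c]
  show "form_on 1 (cimg c) (Jstar N a c)"
    unfolding form_on_def
  proof (intro conjI ballI allI)
    show "alternating 1 (Jstar N a c x)" if "x \<in> cimg c" for x
      unfolding Jstar_def by (rule alternating_pull[OF J_linear[OF c that] fieldform_alternating[OF a c that]])
    fix v
    have "(\<Sum>b\<in>UNIV. Jcx N c x (v 0) $ b * a c x (axis b 1 ## zs)) = Jstar N a c x v" if x: "x \<in> cimg c" for x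
    proof -
      have alt: "alternating (Suc 0) (a c x)" using fieldform_alternating[OF a c x] by simp
      have "Jstar N a c x v = a c x (Jcx N c x (v 0) ## zs)"
        unfolding Jstar_def pull_def by (rule alternating_cong[OF alt]) simp
      then show ?thesis
        using linear_expand_axis[OF alternating_linear[OF alt, of "\<lambda>_. 0"], of "Jcx N c x (v 0)"] by simp
    qed
    moreover have "smooth_on (cimg c) (\<lambda>x. \<Sum>b\<in>UNIV. Jcx N c x (v 0) $ b * a c x (axis b 1 ## zs))"
      by (intro smooth_on_sum smooth_on_mult oc form_on_smooth[OF fieldform_form_on[OF a c]]
        smooth_on_bounded_linear[OF bounded_linear_vec_nth oc smooth_J[OF c]])
    ultimately show "smooth_on (cimg c) (\<lambda>x. Jstar N a c x v)"
      using smooth_on_cong[OF oc, of "\<lambda>x. \<Sum>b\<in>UNIV. Jcx N c x (v 0) $ b * a c x (axis b 1 ## zs)" "\<lambda>x. Jstar N a c x v"]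
      by blast
  qed
next
  fix c d x assume *: "c \<in> Atlas N" "d \<in> Atlas N" "x \<in> overlap c d"
  show "Jstar N a c x = pull (dtransition c d x) (Jstar N a d (transition c d x))"
    by (simp add: fun_eq_iff Jstar_def pull_def fieldform_transition[OF a *] J_transition[OF *])
qed


text \<open>In a holomorphic chart \<Omega> is a multiple of \<open>dz123\<close>. The identity
  carries over to other charts because the derivatives of transition maps commute with
  \<open>J\<close>.\<close>

lemma Om_J_at:
  assumes c: "c \<in> Atlas N" and x: "x \<in> cimg c"
  shows "Om_re N c x (Jcx N c x u ## v) = - Om_im N c x (u ## v)"
    "Om_im N c x (Jcx N c x u ## v) = Om_re N c x (u ## v)"
proof -
  obtain d where d: "d \<in> Atlas N" "holomorphic_chart N d" "x \<in> overlap c d"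
    using holomorphic_chart_at[OF x] by blast
  let ?y = "transition c d x" and ?L = "dtransition c d x"
  have y: "?y \<in> cimg d" by (rule transition_in[OF c d(3)])
  obtain f where f: "\<And>v. Omega N d ?y v = f ?y * dz123 v"
    using cy d(2) y unfolding calabi_yau6_def holomorphic_volume_form_def by blast
  have J: "Jcx N d ?y = J_std" using d(2) y by (simp add: holomorphic_chart_def)
  note tr = fieldform_transition[OF fieldform_Om(1) c d(1,3)] fieldform_transition[OF fieldform_Om(2) c d(1,3)]
  show "Om_re N c x (Jcx N c x u ## v) = - Om_im N c x (u ## v)"
    "Om_im N c x (Jcx N c x u ## v) = Om_re N c x (u ## v)"
    unfolding tr pull_apply J_transition[OF c d(1,3)] J
    by (simp_all only: Om_re_def Om_im_def f dz123_J_std_Re dz123_J_std_Im)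
qed

text \<open>\<open>om\<close>, \<open>om2\<close> and \<open>vol\<close> of the locale do not depend
  on the frame and agree with the fields at the point, so the pointwise results transfer to the
  manifold.\<close>

lemma su3_at:
  assumes c: "c \<in> Atlas N" and x: "x \<in> cimg c"
  obtains f where "su3 (Met N c x) (Jcx N c x) (Om_re N c x) (Om_im N c x) f"
    "su3_frame.om (Met N c x) (Jcx N c x) = kform N c x"
    "su3_frame.om2 (Met N c x) (Jcx N c x) = kform2 N c x"
    "su3_frame.vol (Met N c x) (Jcx N c x) = volF N c x"
proof -
  have "\<exists>f. su3 (Met N c x) (Jcx N c x) (Om_re N c x) (Om_im N c x) f"
  proof (rule su3_frame_exists[where om = "kform N c x"])
    show "2 * wedge 4 2 (wedge 2 2 (kform N c x) (kform N c x)) (kform N c x) v =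
        3 * wedge 3 3 (Om_re N c x) (Om_im N c x) v" for v
      using cy c x by (simp add: calabi_yau6_def kform3_def kform2_def wedgeF_def)
  qed (simp_all add: Met_inner[OF c x] J_linear[OF c x] J_J[OF c x] Met_J[OF c x] Om_J_at[OF c x]
      fieldform_alternating[OF fieldform_Om(1) c x] fieldform_alternating[OF fieldform_Om(2) c x] kform_def)
  then obtain f where f: "su3 (Met N c x) (Jcx N c x) (Om_re N c x) (Om_im N c x) f" by blast
  then interpret P: su3 "Met N c x" "Jcx N c x" "Om_re N c x" "Om_im N c x" f .
  have 1: "P.om = kform N c x" by (simp add: fun_eq_iff P.om_def kform_def)
  have 2: "P.om2 = kform2 N c x" by (simp add: P.om2_def 1 kform2_def wedgeF_def)
  have 3: "P.vol = volF N c x" by (simp add: fun_eq_iff P.vol_def 1 2 volF_def kform3_def wedgeF_def)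
  show ?thesis by (rule that[OF f 1 2 3])
qed

lemma frame_at:
  assumes c: "c \<in> Atlas N" and x: "x \<in> cimg c"
  obtains fs e where "orthoframe (Met N c x) fs" "volF N c x e \<noteq> 0"
proof -
  obtain f where f: "su3 (Met N c x) (Jcx N c x) (Om_re N c x) (Om_im N c x) f"
    "su3_frame.om (Met N c x) (Jcx N c x) = kform N c x"
    "su3_frame.om2 (Met N c x) (Jcx N c x) = kform2 N c x"
    "su3_frame.vol (Met N c x) (Jcx N c x) = volF N c x"
    using su3_at[OF c x] by blast
  interpret P: su3 "Met N c x" "Jcx N c x" "Om_re N c x" "Om_im N c x" f by (rule f)
  show ?thesis by (rule that[OF P.frame P.vol_nz[unfolded f(4)]])
qed

lemma volF_basis_nonzero: "c \<in> Atlas N \<Longrightarrow> x \<in> cimg c \<Longrightarrow> volF N c x basis_seq \<noteq> 0"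
  using frame_at alternating_6_basis_nonzero[OF fieldform_alternating[OF fieldform_volF]] by metis

lemma fieldform_hodge:
  assumes a: "fieldform k a" and k: "k \<le> 6" "6 - k = m"
  shows "fieldform m (hodge N k a)"
  unfolding fieldform_def
proof (intro conjI ballI)
  fix c assume c: "c \<in> Atlas N"
  have "form_on (6 - k) (cimg c) (\<lambda>x. hodge_pt (Met N c x) (volF N c x) k (a c x))"
    by (rule form_on_hodge_pt[OF open_cimg[OF c] Met_inner[OF c] _ smooth_Met[OF c]
      fieldform_form_on[OF fieldform_volF c] _ k(1) fieldform_form_on[OF a c]])
      (use frame_at[OF c] in metis)+
  then show "form_on m (cimg c) (hodge N k a c)"
    using k(2) by (simp add: hodge_def[abs_def])
next
  fix c d x assume *: "c \<in> Atlas N" "d \<in> Atlas N" "x \<in> overlap c d"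
  have x: "x \<in> cimg c" using overlap_subset *(3) by blast
  have y: "transition c d x \<in> cimg d" by (rule transition_in[OF *(1,3)])
  note vol = fieldform_transition[OF fieldform_volF *]
  obtain fs e where fs: "orthoframe (Met N c x) fs" and e: "volF N c x e \<noteq> 0"
    using frame_at[OF *(1) x] by blast
  obtain e' where e': "volF N d (transition c d x) e' \<noteq> 0" using frame_at[OF *(2) y] by blast
  show "hodge N k a c x = pull (dtransition c d x) (hodge N k a d (transition c d x))"
    unfolding hodge_def vol fieldform_transition[OF a *]
    by (rule hodge_pt_pull[OF Met_inner[OF *(1) x] fs Met_inner[OF *(2) y]
      fieldform_alternating[OF fieldform_volF *(2) y] e' e[unfolded vol] k(1)
      fieldform_alternating[OF a *(2) y] linear_dtransition[OF *] Met_transition[OF *]])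
qed

section \<open>Closedness of the structure forms\<close>

lemma d_kform: "c \<in> Atlas N \<Longrightarrow> x \<in> cimg c \<Longrightarrow> ext_d 2 (kform N c) x = (\<lambda>v. 0)"
  using cy by (simp add: calabi_yau6_def kaehler_def dF_def)

lemma d_kform2:
  assumes c: "c \<in> Atlas N" and x: "x \<in> cimg c"
  shows "ext_d 4 (kform2 N c) x = (\<lambda>v. 0)"
proof
  fix v
  have w: "form_on 2 (cimg c) (kform N c)" by (rule fieldform_form_on[OF fieldform_kform c])
  show "ext_d 4 (kform2 N c) x v = 0"
    using ext_d_Leibniz[OF open_cimg[OF c] w w x, of v]
    by (simp add: kform2_def wedgeF_def[abs_def] d_kform[OF c x])
qed

text \<open>From \<Omega> = f dz1 \<and> dz2 \<and> dz3 one gets d\<Omega> = df \<and> dz1 \<and>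
  dz2 \<and> dz3. As f is holomorphic, df is complex linear, and \<open>Op_plus_J_Om\<close> applied
  to its real and imaginary parts gives df \<and> \<Omega> = 0.\<close>

lemma d_Om_holomorphic:
  assumes d: "d \<in> Atlas N" "holomorphic_chart N d" and y: "y \<in> cimg d"
  shows "ext_d 3 (Om_re N d) y v = 0" "ext_d 3 (Om_im N d) y v = 0"
proof -
  note od = open_cimg[OF d(1)]
  obtain f where f: "holomorphic_on_J (cimg d) f" "\<And>x. x \<in> cimg d \<Longrightarrow> f x \<noteq> 0"
    "\<And>x v. x \<in> cimg d \<Longrightarrow> Omega N d x v = f x * dz123 v"
    using cy d(2) unfolding calabi_yau6_def holomorphic_volume_form_def by blast
  have J: "Jcx N d y = J_std" using d(2) y by (simp add: holomorphic_chart_def)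
  define D where "D = frechet_derivative f (at y)"
  have D: "(f has_derivative D) (at y)"
    using f(1) y unfolding holomorphic_on_J_def D_def frechet_derivative_works by blast
  have DJ: "D (J_std u) = \<i> * D u" for u
    using f(1) y by (simp add: holomorphic_on_J_def D_def)
  have linD: "linear D" by (rule has_derivative_linear[OF D])
  define R where "R = (\<lambda>v. Re (dz123 v))"
  define I where "I = (\<lambda>v. Im (dz123 v))"
  define b :: "real mform" where "b = (\<lambda>v. Re (D (v 0)))"
  define e :: "real mform" where "e = (\<lambda>v. Im (D (v 0)))"
  have linRe: "linear (\<lambda>u. Re (D u))" and linIm: "linear (\<lambda>u. Im (D u))"
    by (auto intro!: linearI simp: linear_add[OF linD] linear_cmul[OF linD])
  have alt_b: "alternating 1 b" and alt_e: "alternating 1 e"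
    unfolding b_def e_def by (rule alternating_linear_form, fact linRe, rule alternating_linear_form, fact linIm)
  have Om: "Om_re N d x v = Re (f x) * R v - Im (f x) * I v"
    "Om_im N d x v = Re (f x) * I v + Im (f x) * R v" if "x \<in> cimg d" for x v
    using f(3)[OF that] by (simp_all add: Om_re_def Om_im_def R_def I_def)
  have dRe: "((\<lambda>x. Re (f x)) has_derivative (\<lambda>u. Re (D u))) (at y)"
    and dIm: "((\<lambda>x. Im (f x)) has_derivative (\<lambda>u. Im (D u))) (at y)"
    by (rule bounded_linear.has_derivative[OF bounded_linear_Re D],
        rule bounded_linear.has_derivative[OF bounded_linear_Im D])
  have dirRe: "dirD k (Om_re N d) y = (\<lambda>v. Re (D (axis k 1)) * R v - Im (D (axis k 1)) * I v)" for k
  proof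
    fix v
    have "((\<lambda>x. Re (f x) * R v - Im (f x) * I v) has_derivative (\<lambda>u. Re (D u) * R v - Im (D u) * I v)) (at y)"
      by (intro has_derivative_diff has_derivative_mult_left dRe dIm)
    then have "frechet_derivative (\<lambda>x. Om_re N d x v) (at y) = (\<lambda>u. Re (D u) * R v - Im (D u) * I v)"
      using has_derivative_cong_open[OF od y, of "\<lambda>x. Om_re N d x v" "\<lambda>x. Re (f x) * R v - Im (f x) * I v"] Om(1)
      by (intro frechet_derivative_eq) simp
    then show "dirD k (Om_re N d) y v = Re (D (axis k 1)) * R v - Im (D (axis k 1)) * I v"
      by (simp add: dirD_def)
  qed
  have dirIm: "dirD k (Om_im N d) y = (\<lambda>v. Re (D (axis k 1)) * I v + Im (D (axis k 1)) * R v)" for k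
  proof
    fix v
    have "((\<lambda>x. Re (f x) * I v + Im (f x) * R v) has_derivative (\<lambda>u. Re (D u) * I v + Im (D u) * R v)) (at y)"
      by (intro has_derivative_add has_derivative_mult_left dRe dIm)
    then have "frechet_derivative (\<lambda>x. Om_im N d x v) (at y) = (\<lambda>u. Re (D u) * I v + Im (D u) * R v)"
      using has_derivative_cong_open[OF od y, of "\<lambda>x. Om_im N d x v" "\<lambda>x. Re (f x) * I v + Im (f x) * R v"] Om(2)
      by (intro frechet_derivative_eq) simp
    then show "dirD k (Om_im N d) y v = Re (D (axis k 1)) * I v + Im (D (axis k 1)) * R v"
      by (simp add: dirD_def)
  qed
  have coords: "(\<Sum>k\<in>UNIV. Re (D (axis k 1)) * wedge 1 3 (coord k) X v) = wedge 1 3 b X v"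
    "(\<Sum>k\<in>UNIV. Im (D (axis k 1)) * wedge 1 3 (coord k) X v) = wedge 1 3 e X v" for X v
  proof -
    have "b = (\<lambda>v. \<Sum>k\<in>UNIV. Re (D (axis k 1)) * coord k v)" "e = (\<lambda>v. \<Sum>k\<in>UNIV. Im (D (axis k 1)) * coord k v)"
      unfolding b_def e_def coord_def
      using linear_expand_axis[OF linRe] linear_expand_axis[OF linIm] by (simp_all add: mult.commute)
    then show "(\<Sum>k\<in>UNIV. Re (D (axis k 1)) * wedge 1 3 (coord k) X v) = wedge 1 3 b X v"
      "(\<Sum>k\<in>UNIV. Im (D (axis k 1)) * wedge 1 3 (coord k) X v) = wedge 1 3 e X v"
      by (simp_all only: wedge_sum_left wedge_cmult_left)
  qed
  have 1: "ext_d 3 (Om_re N d) y v = wedge 1 3 b R v - wedge 1 3 e I v"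
    unfolding ext_d_wedge[OF od fieldform_form_on[OF fieldform_Om(1) d(1)] y] dirRe
    by (simp only: wedge_diff_right wedge_cmult_right sum_subtractf coords)
  have 2: "ext_d 3 (Om_im N d) y v = wedge 1 3 b I v + wedge 1 3 e R v"
    unfolding ext_d_wedge[OF od fieldform_form_on[OF fieldform_Om(2) d(1)] y] dirIm
    by (simp only: wedge_add_right wedge_cmult_right sum.distrib coords)
  obtain fr where "su3 (Met N d y) (Jcx N d y) (Om_re N d y) (Om_im N d y) fr"
    using su3_at[OF d(1) y] by blast
  then interpret P: su3 "Met N d y" J_std "Om_re N d y" "Om_im N d y" fr by (simp add: J)
  have Jb: "pull J_std b = (\<lambda>v. - e v)" and Je: "pull J_std e = b"
    by (simp_all add: fun_eq_iff pull_def b_def e_def DJ)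
  have 3: "wedge 1 3 b (Om_re N d y) v = wedge 1 3 e (Om_im N d y) v"
    using P.Op_plus_J_Om[OF alt_b, of v] unfolding Jb wedge_uminus_left by linarith
  have 4: "wedge 1 3 e (Om_re N d y) v = - wedge 1 3 b (Om_im N d y) v"
    using P.Op_plus_J_Om[OF alt_e, of v] unfolding Je by linarith
  define p where "p = Re (f y)"
  define q where "q = Im (f y)"
  have Om': "Om_re N d y = (\<lambda>v. p * R v - q * I v)" "Om_im N d y = (\<lambda>v. p * I v + q * R v)"
    using Om[OF y] by (auto simp: p_def q_def)
  \<comment> \<open>r + i s is the value of d\<Omega> at \<open>v\<close>. The equations
    \<open>3\<close> and \<open>4\<close> say that f(y) (r + i s) = 0, and f has no zeros.\<close>
  define r where "r = wedge 1 3 b R v - wedge 1 3 e I v"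
  define s where "s = wedge 1 3 b I v + wedge 1 3 e R v"
  have "p * r - q * s = 0" "p * s + q * r = 0"
    using 3 4 unfolding Om' wedge_add_right wedge_diff_right wedge_cmult_right r_def s_def
    by (simp_all add: algebra_simps)
  moreover have "p * (p * r - q * s) + q * (p * s + q * r) = (p * p + q * q) * r"
    "p * (p * s + q * r) - q * (p * r - q * s) = (p * p + q * q) * s"
    by (simp_all add: algebra_simps)
  moreover have "p * p + q * q \<noteq> 0"
    using f(2)[OF y] by (auto simp: p_def q_def complex_eq_iff sum_squares_eq_zero_iff)
  ultimately show "ext_d 3 (Om_re N d) y v = 0" "ext_d 3 (Om_im N d) y v = 0"
    unfolding 1 2 r_def[symmetric] s_def[symmetric] by auto
qed

lemma d_Om:
  assumes c: "c \<in> Atlas N" and x: "x \<in> cimg c"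
  shows "ext_d 3 (Om_re N c) x = (\<lambda>v. 0)" "ext_d 3 (Om_im N c) x = (\<lambda>v. 0)"
proof -
  obtain d where d: "d \<in> Atlas N" "holomorphic_chart N d" "x \<in> overlap c d"
    using holomorphic_chart_at[OF x] by blast
  note y = transition_in[OF c d(3)]
  show "ext_d 3 (Om_re N c) x = (\<lambda>v. 0)" "ext_d 3 (Om_im N c) x = (\<lambda>v. 0)"
    using fieldform_transition[OF fieldform_dF[OF fieldform_Om(1)] c d(1,3)]
      fieldform_transition[OF fieldform_dF[OF fieldform_Om(2)] c d(1,3)]
    by (simp_all add: dF_def pull_def d_Om_holomorphic[OF d(1,2) y])
qed


section \<open>The codifferential\<close>

lemma continuous_vol_density:
  assumes c: "c \<in> Atlas N"
  shows "continuous_on (cimg c) (vol_density N c)"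
proof -
  have "continuous_on (cimg c) (\<lambda>x. volF N c x basis_seq)"
    by (intro smooth_on_imp_continuous_on form_on_smooth[OF fieldform_form_on[OF fieldform_volF c]])
  then show ?thesis
    unfolding vol_density_def[abs_def] basis_seq_def by (rule continuous_on_rabs)
qed

lemma vol_density_eq: "vol_density N c x = sgn (volF N c x basis_seq) * volF N c x basis_seq"
  by (simp add: vol_density_def basis_seq_def abs_sgn mult.commute)

lemma smooth_on_pairing:
  assumes c: "c \<in> Atlas N" and a: "form_on k (cimg c) a" and b: "form_on k (cimg c) b"
  shows "smooth_on (cimg c) (\<lambda>x. form_inner (Met N c x) k (a x) (b x))"
  by (rule smooth_on_form_inner[OF open_cimg[OF c] Met_inner[OF c] _ smooth_Met[OF c]
      form_on_smooth[OF a] form_on_smooth[OF b]]) (use frame_at[OF c] in metis)+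

lemma continuous_pairing_density:
  assumes c: "c \<in> Atlas N" and a: "form_on k (cimg c) a" and b: "form_on k (cimg c) b"
  shows "continuous_on (cimg c) (\<lambda>x. form_inner (Met N c x) k (a x) (b x) * vol_density N c x)"
  by (intro continuous_on_mult smooth_on_imp_continuous_on smooth_on_pairing[OF assms]
      continuous_vol_density[OF c])

text \<open>The integral condition inside the definite description of \<open>codiff\<close>.\<close>

definition adjoint_pair :: "nat \<Rightarrow> ('m, real) field_form \<Rightarrow> ('m, real) field_form \<Rightarrow> bool" where
  "adjoint_pair k \<gamma> \<delta> \<longleftrightarrow> (\<forall>c\<in>Atlas N. \<forall>\<beta>. test_form k (cimg c) \<beta> \<longrightarrow>
     (LINT x:cimg c|lborel. form_inner (Met N c x) (Suc k) (ext_d k \<beta> x) (\<gamma> c x) * vol_density N c x) =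
     (LINT x:cimg c|lborel. form_inner (Met N c x) k (\<beta> x) (\<delta> c x) * vol_density N c x))"

lemma test_form_form_on: "test_form k V \<beta> \<Longrightarrow> form_on k V \<beta>"
  by (simp add: test_form_def form_on_def)

text \<open>The difference of the two integrands is \<open>d(\<beta> \<and> \<star>\<gamma>)\<close>, up to the sign that accounts for the
  orientation of the chart.\<close>

lemma adjoint_pairI:
  assumes \<gamma>: "fieldform (Suc k) \<gamma>" and \<delta>: "fieldform k \<delta>" and k: "k \<le> 5"
    and adj: "\<And>c x b v. c \<in> Atlas N \<Longrightarrow> x \<in> cimg c \<Longrightarrow> alternating k b \<Longrightarrow>
      form_inner (Met N c x) k b (\<delta> c x) * volF N c x v =
      - ((-1) ^ k * wedge k (6 - k) b (ext_d (5 - k) (hodge N (Suc k) \<gamma> c) x) v)"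
  shows "adjoint_pair k \<gamma> (restr \<delta>)"
  unfolding adjoint_pair_def
proof (intro ballI allI impI)
  fix c \<beta> assume c: "c \<in> Atlas N" and t: "test_form k (cimg c) \<beta>"
  let ?V = "cimg c"
  note oc = open_cimg[OF c] and \<beta> = test_form_form_on[OF t]
  note g = fieldform_form_on[OF \<gamma> c] and de = fieldform_form_on[OF \<delta> c]
  obtain K where K: "compact K" "K \<subseteq> ?V" "\<And>x. x \<notin> K \<Longrightarrow> \<beta> x = (\<lambda>v. 0)"
    using t by (auto simp: test_form_def)
  define s where "s = hodge N (Suc k) \<gamma> c"
  have s: "form_on (5 - k) ?V s"
    unfolding s_def by (rule fieldform_form_on[OF fieldform_hodge[OF \<gamma>] c]) (use k in auto)
  define \<eta> where "\<eta> = (\<lambda>x. wedge k (5 - k) (\<beta> x) (s x))"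
  have \<eta>: "form_on 5 ?V \<eta>"
    unfolding \<eta>_def by (rule form_on_wedge[OF oc \<beta> s]) (use k in auto)
  define A where "A = (\<lambda>x. form_inner (Met N c x) (Suc k) (ext_d k \<beta> x) (\<gamma> c x) * vol_density N c x)"
  define B where "B = (\<lambda>x. form_inner (Met N c x) k (\<beta> x) (\<delta> c x) * vol_density N c x)"
  \<comment> \<open>Off \<open>K\<close> the test form vanishes on an open set, hence so does its
    derivative; the integrands have compact support in the chart.\<close>
  have d0: "ext_d k \<beta> x = (\<lambda>v. 0)" if "x \<notin> K" for x
  proof -
    have "open (- K)" using K(1) compact_imp_closed by blast
    then have "ext_d k \<beta> x = ext_d k (\<lambda>x v. 0) x"
      by (rule ext_d_cong) (use that K(3) in auto)
    then show ?thesis by (simp add: ext_d_def)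
  qed
  have intA: "set_integrable lborel ?V A"
    unfolding A_def
    by (rule set_integrable_compact_support[OF continuous_pairing_density[OF c form_on_ext_d[OF oc \<beta>] g] K(1,2)])
      (simp add: d0)
  have intB: "set_integrable lborel ?V B"
    unfolding B_def
    by (rule set_integrable_compact_support[OF continuous_pairing_density[OF c \<beta> de] K(1,2)])
      (simp add: K(3))
  have diff: "A x - B x = sgn (volF N c x basis_seq) * ext_d 5 \<eta> x basis_seq" if x: "x \<in> ?V" for x
  proof -
    obtain fs e where fs: "orthoframe (Met N c x) fs" and e: "volF N c x e \<noteq> 0"
      using frame_at[OF c x] by blast
    have A: "form_inner (Met N c x) (Suc k) (ext_d k \<beta> x) (\<gamma> c x) * volF N c x v =
        wedge (Suc k) (5 - k) (ext_d k \<beta> x) (s x) v" for v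
      using wedge_hodge_pt[OF Met_inner[OF c x] fs fieldform_alternating[OF fieldform_volF c x] e _
        form_on_alternating[OF g x] alternating_ext_d[OF oc \<beta> x], of v] k
      by (simp add: s_def hodge_def)
    have B: "form_inner (Met N c x) k (\<beta> x) (\<delta> c x) * volF N c x v =
        - ((-1) ^ k * wedge k (6 - k) (\<beta> x) (ext_d (5 - k) s x) v)" for v
      using adj[OF c x form_on_alternating[OF \<beta> x]] by (simp add: s_def)
    have "ext_d (k + (5 - k)) \<eta> x v = wedge (Suc k) (5 - k) (ext_d k \<beta> x) (s x) v +
        (-1) ^ k * wedge k (Suc (5 - k)) (\<beta> x) (ext_d (5 - k) s x) v" for v
      unfolding \<eta>_def by (rule ext_d_Leibniz[OF oc \<beta> s x])
    moreover have "k + (5 - k) = 5" "Suc (5 - k) = 6 - k" using k by auto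
    ultimately have *: "ext_d 5 \<eta> x v = form_inner (Met N c x) (Suc k) (ext_d k \<beta> x) (\<gamma> c x) * volF N c x v -
        form_inner (Met N c x) k (\<beta> x) (\<delta> c x) * volF N c x v" for v
      unfolding A B by simp
    show ?thesis
      unfolding A_def B_def vol_density_eq * by (simp add: algebra_simps)
  qed
  have "(LINT x:?V|lborel. A x) - (LINT x:?V|lborel. B x) = (LINT x:?V|lborel. A x - B x)"
    by (rule set_integral_diff(2)[OF intA intB, symmetric])
  also have "\<dots> = (LINT x:?V|lborel. sgn (volF N c x basis_seq) * ext_d 5 \<eta> x basis_seq)"
    by (rule set_lebesgue_integral_cong) (use oc diff in auto)
  also have "\<dots> = 0"
  proof (rule integral_signed_ext_d_0[OF oc K(1,2) _ \<eta>])
    show "continuous_on ?V (\<lambda>x. volF N c x basis_seq)"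
      by (intro smooth_on_imp_continuous_on form_on_smooth[OF fieldform_form_on[OF fieldform_volF c]])
  qed (use volF_basis_nonzero[OF c] K(3) in \<open>simp_all add: \<eta>_def\<close>)
  finally have "(LINT x:?V|lborel. A x) = (LINT x:?V|lborel. B x)" by simp
  also have "(LINT x:?V|lborel. B x) =
      (LINT x:?V|lborel. form_inner (Met N c x) k (\<beta> x) (restr \<delta> c x) * vol_density N c x)"
    by (rule set_lebesgue_integral_cong) (use oc c in \<open>auto simp: B_def restr_def\<close>)
  finally show "(LINT x:?V|lborel. form_inner (Met N c x) (Suc k) (ext_d k \<beta> x) (\<gamma> c x) * vol_density N c x) =
      (LINT x:?V|lborel. form_inner (Met N c x) k (\<beta> x) (restr \<delta> c x) * vol_density N c x)"
    by (simp add: A_def)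
qed

lemma adjoint_pair_unique:
  assumes "\<delta> \<in> Forms (Atlas N) k" "\<delta>' \<in> Forms (Atlas N) k" "adjoint_pair k \<gamma> \<delta>" "adjoint_pair k \<gamma> \<delta>'"
  shows "\<delta> = \<delta>'"
proof (intro ext)
  fix c x v
  show "\<delta> c x v = \<delta>' c x v"
  proof (cases "c \<in> Atlas N \<and> x \<in> cimg c")
    case False
    then have "\<delta> c x = (\<lambda>v. 0)" "\<delta>' c x = (\<lambda>v. 0)"
      using assms(1,2) unfolding Forms_def by blast+
    then show ?thesis by simp
  next
    case True
    then have c: "c \<in> Atlas N" and x: "x \<in> cimg c" by auto
    let ?V = "cimg c"
    note oc = open_cimg[OF c]
    note d1 = fieldform_form_on[OF Forms_fieldform[OF assms(1)] c]
      and d2 = fieldform_form_on[OF Forms_fieldform[OF assms(2)] c]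
    define e where "e = (\<lambda>x v. \<delta> c x v - \<delta>' c x v)"
    have e: "form_on k ?V e" unfolding e_def by (rule form_on_diff[OF oc d1 d2])
    obtain r where r: "r > 0" "cball x r \<subseteq> ?V" using oc x open_contains_cball by blast
    obtain \<psi> :: "real ^ 6 \<Rightarrow> real" where psi: "\<And>V. open V \<Longrightarrow> smooth_on V \<psi>" "\<And>y. \<psi> y \<ge> 0" "\<psi> x > 0"
      "\<And>y. y \<notin> cball x r \<Longrightarrow> \<psi> y = 0"
      using exists_bump[OF r(1), of x] by blast
    \<comment> \<open>Test forms must be alternating at every point, while \<open>e\<close> is
      controlled only in the chart; hence the extension by 0.\<close>
    define \<beta> where "\<beta> = (\<lambda>y v. if y \<in> ?V then \<psi> y * e y v else 0)"
    have \<beta>: "form_on k ?V \<beta>"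
      using form_on_cong[OF oc, of \<beta> "\<lambda>y v. \<psi> y * e y v" k] form_on_scale[OF oc psi(1)[OF oc] e]
      by (simp add: \<beta>_def)
    have t: "test_form k ?V \<beta>"
      unfolding test_form_def
    proof (intro conjI allI)
      show "alternating k (\<beta> y)" for y
        using form_on_alternating[OF \<beta>, of y] by (cases "y \<in> ?V") (simp_all add: \<beta>_def)
      show "smooth_on ?V (\<lambda>y. \<beta> y v)" for v by (rule form_on_smooth[OF \<beta>])
      show "\<exists>K. compact K \<and> K \<subseteq> ?V \<and> (\<forall>y. y \<notin> K \<longrightarrow> \<beta> y = (\<lambda>v. 0))"
        by (rule exI[of _ "cball x r"]) (use r psi(4) in \<open>auto simp: \<beta>_def\<close>)
    qed
    let ?I = "\<lambda>y a. form_inner (Met N c y) k (\<beta> y) a * vol_density N c y"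
    have supp: "\<beta> y = (\<lambda>v. 0)" if "y \<notin> cball x r" for y
      using psi(4)[OF that] by (auto simp: \<beta>_def)
    have int: "set_integrable lborel ?V (\<lambda>y. ?I y (a y))" if "form_on k ?V a" for a
      by (rule set_integrable_compact_support[OF continuous_pairing_density[OF c \<beta> that] compact_cball r(2)])
        (simp add: supp)
    have "(LINT y:?V|lborel. ?I y (e y)) = (LINT y:?V|lborel. ?I y (\<delta> c y) - ?I y (\<delta>' c y))"
      by (simp add: e_def form_inner_diff_right algebra_simps)
    also have "\<dots> = (LINT y:?V|lborel. ?I y (\<delta> c y)) - (LINT y:?V|lborel. ?I y (\<delta>' c y))"
      by (rule set_integral_diff(2)[OF int[OF d1] int[OF d2]])
    also have "\<dots> = 0"
      using assms(3,4)[unfolded adjoint_pair_def, rule_format, OF c t] by linarith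
    finally have I0: "(LINT y:?V|lborel. ?I y (e y)) = 0" .
    \<comment> \<open>Up to the density the integrand is \<psi> |e|^2, so a vanishing integral
      forces e = 0 at the centre \<open>x\<close>, where \<psi> is positive.\<close>
    have Iy: "?I y (e y) = \<psi> y * form_inner (Met N c y) k (e y) (e y) * vol_density N c y" if "y \<in> ?V" for y
      using that by (simp add: \<beta>_def form_inner_cmult_left)
    have "?I x (e x) = 0"
    proof (rule integral_0_imp_0[OF oc continuous_pairing_density[OF c \<beta> e] _ compact_cball r(2) _ I0 x])
      fix y assume y: "y \<in> ?V"
      obtain fs e' where fs: "orthoframe (Met N c y) fs" "volF N c y e' \<noteq> 0" using frame_at[OF c y] by blast
      show "0 \<le> ?I y (e y)"
        unfolding Iy[OF y] using form_inner_nonneg[OF Met_inner[OF c y] fs(1) form_on_alternating[OF e y]] psi(2)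
        by (simp add: vol_density_def)
    qed (simp add: supp)
    then have "form_inner (Met N c x) k (e x) (e x) = 0"
      using Iy[OF x] psi(3) volF_basis_nonzero[OF c x] by (simp add: vol_density_def basis_seq_def)
    moreover obtain fs e' where fs: "orthoframe (Met N c x) fs" "volF N c x e' \<noteq> 0" using frame_at[OF c x] by blast
    ultimately have "e x v = 0"
      using form_inner_definite[OF Met_inner[OF c x] fs(1) form_on_alternating[OF e x]] by blast
    then show ?thesis by (simp add: e_def)
  qed
qed

lemma codiff_eqI:
  assumes "fieldform k \<delta>" "adjoint_pair k \<gamma> (restr \<delta>)"
  shows "codiff N k \<gamma> = restr \<delta>"
  unfolding codiff_def adjoint_pair_def[symmetric]
  by (rule the_equality) (use restr_Forms[OF assms(1)] assms(2) adjoint_pair_unique in auto)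

text \<open>In degree 0 the inner product is multiplication of numbers, and a 6-form is its star
  times the volume form.\<close>

lemma codiff_0:
  assumes \<gamma>: "fieldform 1 \<gamma>" and c: "c \<in> Atlas N" and x: "x \<in> cimg c"
  shows "codiff N 0 \<gamma> c x v = - hodge N 6 (dF 5 (hodge N 1 \<gamma>)) c x v"
proof -
  let ?k = "dF 5 (hodge N 1 \<gamma>)"
  define \<delta> where "\<delta> = (\<lambda>c x v. (-1) * hodge N 6 ?k c x v)"
  have k: "fieldform 6 ?k"
    using fieldform_dF[OF fieldform_hodge[OF \<gamma>, of 5]] by simp
  have \<delta>: "fieldform 0 \<delta>"
    unfolding \<delta>_def by (rule fieldform_cmult[OF fieldform_hodge[OF k]]) auto
  have "adjoint_pair 0 \<gamma> (restr \<delta>)"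
  proof (rule adjoint_pairI)
    show "fieldform (Suc 0) \<gamma>" using \<gamma> by simp
    fix c x b v assume c: "c \<in> Atlas N" and x: "x \<in> cimg c" and b: "alternating 0 b"
    obtain f where f: "su3 (Met N c x) (Jcx N c x) (Om_re N c x) (Om_im N c x) f"
      "su3_frame.om (Met N c x) (Jcx N c x) = kform N c x"
      "su3_frame.om2 (Met N c x) (Jcx N c x) = kform2 N c x"
      "su3_frame.vol (Met N c x) (Jcx N c x) = volF N c x"
      using su3_at[OF c x] by blast
    interpret P: su3 "Met N c x" "Jcx N c x" "Om_re N c x" "Om_im N c x" f by (rule f)
    have alt: "alternating 6 (?k c x)" by (rule fieldform_alternating[OF k c x])
    have "form_inner (Met N c x) 0 b (\<delta> c x) = b zs * \<delta> c x zs"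
      using form_inner_scontr[OF P.g P.frame b fieldform_alternating[OF \<delta> c x]] by simp
    then have "form_inner (Met N c x) 0 b (\<delta> c x) * volF N c x v = - (b zs * ?k c x v)"
      using P.star_6_vol[OF alt, of "\<lambda>_. 0" v] by (simp add: \<delta>_def hodge_def f(4))
    then show "form_inner (Met N c x) 0 b (\<delta> c x) * volF N c x v =
        - ((-1) ^ 0 * wedge 0 (6 - 0) b (ext_d (5 - 0) (hodge N (Suc 0) \<gamma> c) x) v)"
      using wedge_0_left[OF b alt, of v] by (simp add: dF_def)
  qed (use \<delta> in simp_all)
  from codiff_eqI[OF \<delta> this] show ?thesis
    using c x by (simp add: restr_def \<delta>_def)
qed

text \<open>The Leibniz rule contributes (-1)^3, which is compensated by \<star>\<star> = -1 on
  3-forms.\<close>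

lemma codiff_3:
  assumes \<gamma>: "fieldform 4 \<gamma>" and c: "c \<in> Atlas N" and x: "x \<in> cimg c"
  shows "codiff N 3 \<gamma> c x v = - hodge N 3 (dF 2 (hodge N 4 \<gamma>)) c x v"
proof -
  let ?k = "dF 2 (hodge N 4 \<gamma>)"
  define \<delta> where "\<delta> = (\<lambda>c x v. (-1) * hodge N 3 ?k c x v)"
  have k: "fieldform 3 ?k"
    using fieldform_dF[OF fieldform_hodge[OF \<gamma>, of 2]] by simp
  have \<delta>: "fieldform 3 \<delta>"
    unfolding \<delta>_def by (rule fieldform_cmult[OF fieldform_hodge[OF k]]) auto
  have "adjoint_pair 3 \<gamma> (restr \<delta>)"
  proof (rule adjoint_pairI)
    show "fieldform (Suc 3) \<gamma>" using \<gamma> by simp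
    fix c x b v assume c: "c \<in> Atlas N" and x: "x \<in> cimg c" and b: "alternating 3 b"
    obtain f where f: "su3 (Met N c x) (Jcx N c x) (Om_re N c x) (Om_im N c x) f"
      "su3_frame.om (Met N c x) (Jcx N c x) = kform N c x"
      "su3_frame.om2 (Met N c x) (Jcx N c x) = kform2 N c x"
      "su3_frame.vol (Met N c x) (Jcx N c x) = volF N c x"
      using su3_at[OF c x] by blast
    interpret P: su3 "Met N c x" "Jcx N c x" "Om_re N c x" "Om_im N c x" f by (rule f)
    have alt: "alternating 3 (?k c x)" by (rule fieldform_alternating[OF k c x])
    have "form_inner (Met N c x) 3 b (\<delta> c x) * volF N c x v = wedge 3 (6 - 3) b (P.star 3 (\<delta> c x)) v"
      using wedge_hodge_pt[OF P.g P.frame P.alternating_vol P.vol_nz _ fieldform_alternating[OF \<delta> c x] b, of v]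
      by (simp add: f(4))
    also have "P.star 3 (\<delta> c x) = ?k c x"
    proof (rule P.eqI[of 3])
      show "agree P.fs 3 (P.star 3 (\<delta> c x)) (?k c x)"
        by (simp add: iota_apply P.star_3[OF fieldform_alternating[OF \<delta> c x]])
          (simp add: \<delta>_def hodge_def P.star_3[OF alt, unfolded f(4)])
    qed (intro P.alts alt fieldform_alternating[OF \<delta> c x])+
    finally show "form_inner (Met N c x) 3 b (\<delta> c x) * volF N c x v =
        - ((-1) ^ 3 * wedge 3 (6 - 3) b (ext_d (5 - 3) (hodge N (Suc 3) \<gamma> c) x) v)"
      by (simp add: dF_def)
  qed (use \<delta> in simp_all)
  from codiff_eqI[OF \<delta> this] show ?thesis
    using c x by (simp add: restr_def \<delta>_def)
qed

end

section \<open>Assembly of the three identities\<close>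

theorem lemma6p3:
  fixes N :: "'m::{t2_space, second_countable_topology} cy_data"
    and \<alpha> :: "('m, real) field_form"
  assumes "calabi_yau6 N"
    and "\<alpha> \<in> Forms (Atlas N) 1"
  shows "(\<forall>c\<in>Atlas N. \<forall>x\<in>cimg c. \<forall>v.
      dF 1 \<alpha> c x v =
        - (1/3) * d6_1 N (Jstar N \<alpha>) c x v * kform N c x v
        - (1/2) * hodge N 4 (wedgeF 1 3 (Jstar N (d6_6 N \<alpha>)) (Om_re N)) c x v
        + d6_8 N \<alpha> c x v) \<and>
    (\<forall>c\<in>Atlas N. \<forall>x\<in>cimg c. \<forall>v.
      dF 2 (hodge N 4 (wedgeF 1 3 \<alpha> (Om_im N))) c x v =
        - (1/2) * d6_1 N \<alpha> c x v * Om_re N c x v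
        + (1/2) * d6_1 N (Jstar N \<alpha>) c x v * Om_im N c x v
        + (1/2) * wedgeF 1 2 (Jstar N (d6_6 N \<alpha>)) (kform N) c x v
        + hodge N 3 (d6_12 N \<alpha>) c x v) \<and>
    (\<forall>c\<in>Atlas N. \<forall>x\<in>cimg c. \<forall>v.
      d6_1 N (Jstar N \<alpha>) c x v = - hodge N 6 (dF 5 (hodge N 1 (Jstar N \<alpha>))) c x v \<and>
      - hodge N 6 (dF 5 (hodge N 1 (Jstar N \<alpha>))) c x v =
        - (1/2) * hodge N 6 (dF 5 (wedgeF 1 4 \<alpha> (kform2 N))) c x v)"
proof -
  interpret cy N by (standard; fact)
  have a: "fieldform 1 \<alpha>" by (rule Forms_fieldform[OF assms(2)])
  note Ja = fieldform_Jstar[OF a]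
  note Ore = fieldform_Om(1) and Oim = fieldform_Om(2) and w = fieldform_kform and w2 = fieldform_kform2
  let ?aO = "wedgeF 1 3 \<alpha> (Om_im N)"
  let ?s = "hodge N 4 ?aO"
  have aO: "fieldform 4 ?aO" by (rule fieldform_wedge[OF a Oim]) simp
  have s: "fieldform 2 ?s" by (rule fieldform_hodge[OF aO]) auto
  have da: "fieldform 2 (dF 1 \<alpha>)" using fieldform_dF[OF a] by (simp add: numeral_2_eq_2)
  have ds: "fieldform 3 (dF 2 ?s)" using fieldform_dF[OF s] by simp
  have ha: "fieldform 5 (hodge N 1 \<alpha>)" by (rule fieldform_hodge[OF a]) auto
  have hJa: "fieldform 5 (hodge N 1 (Jstar N \<alpha>))" by (rule fieldform_hodge[OF Ja]) auto
  have aw: "fieldform 5 (wedgeF 1 4 \<alpha> (kform2 N))" by (rule fieldform_wedge[OF a w2]) simp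
  have main: "dF 1 \<alpha> c x v =
        - (1/3) * d6_1 N (Jstar N \<alpha>) c x v * kform N c x v
        - (1/2) * hodge N 4 (wedgeF 1 3 (Jstar N (d6_6 N \<alpha>)) (Om_re N)) c x v
        + d6_8 N \<alpha> c x v" (is ?item1)
    "dF 2 ?s c x v =
        - (1/2) * d6_1 N \<alpha> c x v * Om_re N c x v
        + (1/2) * d6_1 N (Jstar N \<alpha>) c x v * Om_im N c x v
        + (1/2) * wedgeF 1 2 (Jstar N (d6_6 N \<alpha>)) (kform N) c x v
        + hodge N 3 (d6_12 N \<alpha>) c x v" (is ?item2)
    "d6_1 N (Jstar N \<alpha>) c x v = - hodge N 6 (dF 5 (hodge N 1 (Jstar N \<alpha>))) c x v \<and>
      - hodge N 6 (dF 5 (hodge N 1 (Jstar N \<alpha>))) c x v =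
        - (1/2) * hodge N 6 (dF 5 (wedgeF 1 4 \<alpha> (kform2 N))) c x v" (is ?item3)
    if c: "c \<in> Atlas N" and x: "x \<in> cimg c" for c x v
  proof -
    note oc = open_cimg[OF c]
    have at: "\<exists>f. su3 (Met N c y) (Jcx N c y) (Om_re N c y) (Om_im N c y) f \<and>
        su3_frame.om (Met N c y) (Jcx N c y) = kform N c y \<and>
        su3_frame.om2 (Met N c y) (Jcx N c y) = kform2 N c y \<and>
        su3_frame.vol (Met N c y) (Jcx N c y) = volF N c y" if "y \<in> cimg c" for y
      using su3_at[OF c that] by blast
    \<comment> \<open>These identities are differentiated below, so they are needed at every point
      of the chart, each with a frame of its own.\<close>
    have pt: "hodge N 1 (Jstar N \<alpha>) c y = (\<lambda>v. (1/2) * wedgeF 1 4 \<alpha> (kform2 N) c y v)"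
      "wedge 2 2 (?s c y) (kform N c y) = ?aO c y"
      "wedge 2 3 (?s c y) (Om_im N c y) = (\<lambda>v. 2 * hodge N 1 \<alpha> c y v)"
      "wedge 2 3 (?s c y) (Om_re N c y) = (\<lambda>v. 2 * hodge N 1 (Jstar N \<alpha>) c y v)"
      if y: "y \<in> cimg c" for y
    proof -
      obtain f where f: "su3 (Met N c y) (Jcx N c y) (Om_re N c y) (Om_im N c y) f"
        "su3_frame.om (Met N c y) (Jcx N c y) = kform N c y"
        "su3_frame.om2 (Met N c y) (Jcx N c y) = kform2 N c y"
        "su3_frame.vol (Met N c y) (Jcx N c y) = volF N c y"
        using at[OF y] by blast
      interpret P: su3 "Met N c y" "Jcx N c y" "Om_re N c y" "Om_im N c y" f by (rule f)
      note ay = fieldform_alternating[OF a c y]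
      show "hodge N 1 (Jstar N \<alpha>) c y = (\<lambda>v. (1/2) * wedgeF 1 4 \<alpha> (kform2 N) c y v)"
        "wedge 2 2 (?s c y) (kform N c y) = ?aO c y"
        "wedge 2 3 (?s c y) (Om_im N c y) = (\<lambda>v. 2 * hodge N 1 \<alpha> c y v)"
        "wedge 2 3 (?s c y) (Om_re N c y) = (\<lambda>v. 2 * hodge N 1 (Jstar N \<alpha>) c y v)"
        using P.star_J[OF ay] P.sigma_om[OF ay] P.sigma_Om[OF ay] P.sigma_Op[OF ay]
        by (simp_all only: f(2-4) hodge_def Jstar_def wedgeF_def)
    qed
    obtain f where f: "su3 (Met N c x) (Jcx N c x) (Om_re N c x) (Om_im N c x) f"
      "su3_frame.om (Met N c x) (Jcx N c x) = kform N c x"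
      "su3_frame.om2 (Met N c x) (Jcx N c x) = kform2 N c x"
      "su3_frame.vol (Met N c x) (Jcx N c x) = volF N c x"
      using at[OF x] by blast
    interpret P: su3 "Met N c x" "Jcx N c x" "Om_re N c x" "Om_im N c x" f by (rule f)
    have closed_right: "ext_d (p + q) (wedgeF p q b u c) x = wedge (Suc p) q (ext_d p (b c) x) (u c x)"
      if "fieldform p b" "fieldform q u" "ext_d q (u c) x = (\<lambda>v. 0)" for p q b u
      using ext_d_Leibniz[OF oc fieldform_form_on[OF that(1) c] fieldform_form_on[OF that(2) c] x] that(3)
      by (auto simp: wedgeF_def[abs_def])
    have e1: "dF 5 (wedgeF 1 4 \<alpha> (kform2 N)) c x = wedge 2 4 (dF 1 \<alpha> c x) (kform2 N c x)"
      using closed_right[OF a w2 d_kform2[OF c x]] by (simp add: dF_def numeral_2_eq_2)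
    have e2: "dF 4 ?aO c x = wedge 2 3 (dF 1 \<alpha> c x) (Om_im N c x)"
      using closed_right[OF a Oim d_Om(2)[OF c x]] by (simp add: dF_def numeral_2_eq_2)
    \<comment> \<open>The same 5-form as in \<open>e2\<close>, now read as d(\<sigma> \<and>
      \<omega>): this is why \<open>d6_6 N \<alpha>\<close> occurs in both decompositions.\<close>
    have e3: "dF 4 ?aO c x = wedge 3 2 (dF 2 ?s c x) (kform N c x)"
    proof -
      have "dF 4 ?aO c x = ext_d 4 (wedgeF 2 2 ?s (kform N) c) x"
        unfolding dF_def by (rule ext_d_cong[OF oc x]) (simp only: wedgeF_def[of 2 2] pt(2))
      then show ?thesis
        using closed_right[OF s w d_kform[OF c x]] by (simp add: dF_def)
    qed
    have e4: "wedge 3 3 (dF 2 ?s c x) (Om_im N c x) = (\<lambda>v. 2 * dF 5 (hodge N 1 \<alpha>) c x v)"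
    proof -
      have "ext_d 5 (wedgeF 2 3 ?s (Om_im N) c) x = ext_d 5 (\<lambda>y v. 2 * hodge N 1 \<alpha> c y v) x"
        by (rule ext_d_cong[OF oc x]) (simp only: wedgeF_def[of 2 3] pt(3))
      then show ?thesis
        using closed_right[OF s Oim d_Om(2)[OF c x]] ext_d_cmult[OF oc fieldform_form_on[OF ha c] x, of 2]
        by (simp add: dF_def fun_eq_iff)
    qed
    have e5: "wedge 3 3 (dF 2 ?s c x) (Om_re N c x) = (\<lambda>v. 2 * dF 5 (hodge N 1 (Jstar N \<alpha>)) c x v)"
    proof -
      have "ext_d 5 (wedgeF 2 3 ?s (Om_re N) c) x = ext_d 5 (\<lambda>y v. 2 * hodge N 1 (Jstar N \<alpha>) c y v) x"
        by (rule ext_d_cong[OF oc x]) (simp only: wedgeF_def[of 2 3] pt(4))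
      then show ?thesis
        using closed_right[OF s Ore d_Om(1)[OF c x]] ext_d_cmult[OF oc fieldform_form_on[OF hJa c] x, of 2]
        by (simp add: dF_def fun_eq_iff)
    qed
    have e6: "dF 5 (hodge N 1 (Jstar N \<alpha>)) c x = (\<lambda>v. (1/2) * dF 5 (wedgeF 1 4 \<alpha> (kform2 N)) c x v)"
    proof -
      have "ext_d 5 (hodge N 1 (Jstar N \<alpha>) c) x = ext_d 5 (\<lambda>y v. (1/2) * wedgeF 1 4 \<alpha> (kform2 N) c y v) x"
        by (rule ext_d_cong[OF oc x]) (rule pt(1))
      then show ?thesis
        using ext_d_cmult[OF oc fieldform_form_on[OF aw c] x, of "1/2"] by (simp add: dF_def fun_eq_iff)
    qed
    have star6: "hodge_pt (Met N c x) (volF N c x) 6 (\<lambda>v. r * k v) u = r * hodge_pt (Met N c x) (volF N c x) 6 k u"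
      if k: "alternating 6 k" for r k u
      using P.star_6[OF k] P.star_6[OF alternating_cmult[OF k]] by (simp add: f(4))
    have d0: "d6_1 N (Jstar N \<alpha>) c x v = - hodge N 6 (dF 5 (hodge N 1 (Jstar N \<alpha>))) c x v"
      "d6_1 N \<alpha> c x v = - hodge N 6 (dF 5 (hodge N 1 \<alpha>)) c x v" for v
      unfolding d6_1_def by (rule codiff_0[OF Ja c x], rule codiff_0[OF a c x])
    have alt1: "alternating 6 (dF 5 (wedgeF 1 4 \<alpha> (kform2 N)) c x)"
      "alternating 6 (dF 5 (hodge N 1 \<alpha>) c x)" "alternating 6 (dF 5 (hodge N 1 (Jstar N \<alpha>)) c x)"
      using fieldform_alternating[OF fieldform_dF[OF aw] c x] fieldform_alternating[OF fieldform_dF[OF ha] c x]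
        fieldform_alternating[OF fieldform_dF[OF hJa] c x] by simp_all
    have half: "hodge N 6 (dF 5 (hodge N 1 (Jstar N \<alpha>))) c x v =
        (1/2) * hodge N 6 (dF 5 (wedgeF 1 4 \<alpha> (kform2 N))) c x v" for v
      unfolding hodge_def[of N 6] e6 by (rule star6[OF alt1(1)])
    show ?item3 using d0(1) half by simp
    have L28: "P.W2 = L28 N c x" by (simp add: P.W2_def L28_def f)
    have L312: "P.W3 = L312 N c x" by (simp add: P.W3_def L312_def f)
    have d66: "hodge_pt (Met N c x) (volF N c x) 5 (dF 4 ?aO c x) = d6_6 N \<alpha> c x"
      by (simp add: d6_6_def hodge_def)
    \<comment> \<open>The coefficient \<star>(d\<alpha> \<and> \<omega>^2) / 6 is \<star>d(\<alpha>
      \<and> \<omega>^2) / 6, which \<open>half\<close> turns into \<star>d\<star>J^*\<alpha> / 3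
      and \<open>d0\<close> into minus a third of the codifferential.\<close>
    show ?item1
      using P.decomposition_2[OF fieldform_alternating[OF da c x], of v]
      by (simp only: f(2-4) L28 e1[symmetric] e2[symmetric] d66 d0(1) half)
        (simp add: hodge_def wedgeF_def Jstar_def d6_8_def pi28_def)
    have "codiff N 3 ?aO c x = (\<lambda>v. - hodge N 3 (dF 2 ?s) c x v)"
      using codiff_3[OF aO c x] by blast
    then have d12: "d6_12 N \<alpha> c x = orth_proj (Met N c x) 3 (L312 N c x) (\<lambda>v. - hodge_pt (Met N c x) (volF N c x) 3 (dF 2 ?s c x) v)"
      by (simp add: d6_12_def pi312_def hodge_def)
    \<comment> \<open>The factors 2 in \<open>e4\<close> and \<open>e5\<close> turn 1/4 into 1/2,
      and \<open>d0\<close> reverses the signs in front of \<Omega>^+ and \<Omega>^-.\<close>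
    show ?item2
      using P.decomposition_3[OF fieldform_alternating[OF ds c x], of v]
      by (simp only: f(2-4) L312 e3[symmetric] e4 e5 d66 d0 star6[OF alt1(2)] star6[OF alt1(3)] hodge_def[of N 3] hodge_def[of N 6] d12)
        (simp add: wedgeF_def Jstar_def)
  qed
  then show ?thesis by blast
qed

end
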